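(* Let $n\ge 2$ and $F=x^2(y_1^2+\cdots+y_n^2)\in\mathbb{C}[x,y_1,\ldots,y_n]$. If $\mathbb{X}\subset\mathbb{P}^n$ is a set of $\operatorname{Rk}F=3n$ distinct points apolar to $F$, then the following facts hold. (i) The forbidden locus of $F$ is $\mathcal{F}_F=V(Y_1^2+\cdots+Y_n^2)$. (ii) If $\mathbb{Y}$ is the projection of $\mathbb{X}$ from $V(Y_1,\ldots,Y_n)$ on $V(X)$, then $\mathbb{Y}$ is a set of $n$ distinct points in linear general position; that is, $\operatorname{HF}(\mathbb{Y},0)=1$ and $\operatorname{HF}(\mathbb{Y},i)=n$ for all $i\ge 1$. (iii) Let $\mathbb{Y}=\{Q_1,\ldots,Q_n\}$ and let $P=V(Y_1,\ldots,Y_n)=[1:0:\cdots:0]$. If $\Lambda_i=\langle Q_i,P\rangle$ denotes the linear span of $Q_i$ and $P$, then $\mathbb{X}\cap\Lambda_i$ is a set of three distinct points for $1\le i\le n$. (iv) The Hilbert function of $\mathbb{X}$ is $\operatorname{HF}(\mathbb{X},0)=1$, $\operatorname{HF}(\mathbb{X},1)=n+1$, $\operatorname{HF}(\mathbb{X},2)=2n+1$, and $\operatorname{HF}(\mathbb{X},i)=3n$ for all $i\ge 3$. (v) If $\mathbb{X}$ is a minimal apolar set to $F$, then there exist $\sigma\in O(n)$, the orthogonal group on the variables $Y_1,\ldots,Y_n$, and linear forms $L_i\in\mathbb{C}[X,Y_1,\ldots,Y_n]$, $2\le i\le n$, such that $$I(\sigma(\mathbb{X}))=\Big(\{Y_iY_j\}_{1\le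 i<j\le n},\ X^3+\sum_{i=2}^n L_i(Y_1^2-Y_i^2)\Big).$$
   Context: Let $S=\mathbb{C}[x,y_1,\ldots,y_n]$ and $T=\mathbb{C}[X,Y_1,\ldots,Y_n]$, both standard graded. $T$ acts on $S$ by differentiation (apolarity): $X$ acts as $\partial/\partial x$ and $Y_j$ as $\partial/\partial y_j$; the action is written $g\circ F$. For a form $F\in S$, $F^\perp=\{g\in T: g\circ F=0\}$. A point $[a:b_1:\cdots:b_n]\in\mathbb{P}^n$ corresponds to the linear form $ax+b_1y_1+\cdots+b_ny_n$, and $T$ is the homogeneous coordinate ring of $\mathbb{P}^n$. For $J\subset T$ homogeneous, $V(J)\subset\mathbb{P}^n$ is its zero locus. For a finite set of points $\mathbb{X}\subset\mathbb{P}^n$, $I(\mathbb{X})\subset T$ is its homogeneous (radical) ideal and $\operatorname{HF}(\mathbb{X},i)=\dim_{\mathbb{C}}(T/I(\mathbb{X}))_i$. $\mathbb{X}$ is apolar to $F$ if $I(\mathbb{X})\subset F^\perp$. The Waring rank $\operatorname{Rk}F$ of a form $F$ of degree $d$ is the least $r$ such that $F=\sum_{i=1}^r\alpha_iL_i^d$ with $\alpha_i\in\mathbb{C}$ and $L_i$ linear forms; equivalently, the least cardinality of a finite set of points apolar to $F$. It is known that $\operatorname{Rk}(x^2(y_1^2+\cdots+y_n^2))=3n$ for $n\geq 2$. A minimal apolar set is an apolar set of points of cardinality $\operatorname{Rk}F$. The Waring locus $\mathcal{W}_F$ is the set of points of $\mathbb{P}^n$ that belong to some minimal apolar set of $F$;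 the forbidden locus is $\mathcal{F}_F=\mathbb{P}^n\setminus\mathcal{W}_F$. The projection from $V(Y_1,\ldots,Y_n)$ on $V(X)$ is the map $[a:b_1:\cdots:b_n]\mapsto[0:b_1:\cdots:b_n]$. $O(n)$ is the group of complex orthogonal $n\times n$ matrices, acting linearly on the coordinates $(b_1,\ldots,b_n)$ of points $[a:b_1:\cdots:b_n]$ and trivially on the coordinate $a$. A set of points is in linear general position if each of its subsets has the maximal possible linear span. *)

theory Defs
  imports "HOL-Analysis.Analysis" "HOL-Library.Poly_Mapping"
begin

section \<open>Polynomials\<close>

text \<open>
  \<open>'v mpoly\<close> is the ring of complex polynomials in the variables \<open>Var i\<close>, \<open>i :: 'v\<close>;
  a monomial is its exponent vector in \<open>'v \<Rightarrow>\<^sub>0 nat\<close>. The ring \<open>S\<close> of forms and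
  the ring \<open>T\<close> of differential operators are both represented by this type. With
  \<open>'v = 'n option\<close>, the index \<open>None\<close> belongs to \<open>x\<close> (or \<open>X\<close>) and
  \<open>Some j\<close> to \<open>y\<^sub>j\<close> (or \<open>Y\<^sub>j\<close>).
\<close>

type_synonym 'v mpoly = "('v \<Rightarrow>\<^sub>0 nat) \<Rightarrow>\<^sub>0 complex"

definition Const :: "complex \<Rightarrow> 'v mpoly" where
  "Const c = Poly_Mapping.single 0 c"

definition Var :: "'v \<Rightarrow> 'v mpoly" where
  "Var i = Poly_Mapping.single (Poly_Mapping.single i 1) 1"

definition mdeg :: "('v \<Rightarrow>\<^sub>0 nat) \<Rightarrow> nat" where
  "mdeg m = (\<Sum>i\<in>Poly_Mapping.keys m. Poly_Mapping.lookup m i)"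

definition total_degree :: "'v mpoly \<Rightarrow> nat" where
  "total_degree p = Max (insert 0 (mdeg ` Poly_Mapping.keys p))"

text \<open>The vector space of forms of degree \<open>d\<close>; it contains \<open>0\<close>.\<close>

definition forms :: "nat \<Rightarrow> 'v mpoly set" where
  "forms d = {p. \<forall>m\<in>Poly_Mapping.keys p. mdeg m = d}"

definition eval_at :: "complex ^ 'v \<Rightarrow> 'v mpoly \<Rightarrow> complex" where
  "eval_at v p = (\<Sum>m\<in>Poly_Mapping.keys p. Poly_Mapping.lookup p m *
     (\<Prod>i\<in>Poly_Mapping.keys m. (v $ i) ^ Poly_Mapping.lookup m i))"

definition ideal_gen :: "'v mpoly set \<Rightarrow> 'v mpoly set" where
  "ideal_gen G = module.span (*) G"


section \<open>Apolarity\<close>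

text \<open>
  On monomials the action is
  \<open>\<partial>\<^sup>a (x\<^sup>b) = (\<Prod>\<^sub>i b\<^sub>i (b\<^sub>i - 1) \<cdots> (b\<^sub>i - a\<^sub>i + 1)) x\<^sup>b\<^sup>-\<^sup>a\<close>. The coefficient is
  zero unless \<open>a \<le> b\<close> pointwise, so the truncation in \<open>b - a\<close> is harmless. The lemmas
  \<open>diff_act_Var\<close>, \<open>diff_act_one\<close>, \<open>diff_act_mult\<close> and the linearity lemmas below
  show that this is the module structure in which \<open>Var i\<close> acts as the \<open>i\<close>-th partial
  derivative.
\<close>

definition falling :: "('v::finite \<Rightarrow>\<^sub>0 nat) \<Rightarrow> ('v \<Rightarrow>\<^sub>0 nat) \<Rightarrow> complex" where
  "falling b a =
     (\<Prod>i\<in>UNIV. \<Prod>j<Poly_Mapping.lookup a i. of_nat (Poly_Mapping.lookup b i) - of_nat j)"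

definition diff_act :: "'v::finite mpoly \<Rightarrow> 'v mpoly \<Rightarrow> 'v mpoly" where
  "diff_act g F = (\<Sum>a\<in>Poly_Mapping.keys g. \<Sum>b\<in>Poly_Mapping.keys F.
     Poly_Mapping.single (b - a)
       (Poly_Mapping.lookup g a * Poly_Mapping.lookup F b * falling b a))"

definition perp :: "'v::finite mpoly \<Rightarrow> 'v mpoly set" where
  "perp F = {g. diff_act g F = 0}"

lemma diff_act_superset:
  assumes "finite A" "finite B" "Poly_Mapping.keys g \<subseteq> A" "Poly_Mapping.keys F \<subseteq> B"
  shows "diff_act g F = (\<Sum>a\<in>A. \<Sum>b\<in>B. Poly_Mapping.single (b - a)
       (Poly_Mapping.lookup g a * Poly_Mapping.lookup F b * falling b a))"
proof -
  have "diff_act g F = (\<Sum>a\<in>Poly_Mapping.keys g. \<Sum>b\<in>B. Poly_Mapping.single (b - a)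
       (Poly_Mapping.lookup g a * Poly_Mapping.lookup F b * falling b a))"
    unfolding diff_act_def using assms
    by (intro sum.cong sum.mono_neutral_left) (auto simp: in_keys_iff)
  also have "\<dots> = (\<Sum>a\<in>A. \<Sum>b\<in>B. Poly_Mapping.single (b - a)
       (Poly_Mapping.lookup g a * Poly_Mapping.lookup F b * falling b a))"
    using assms by (intro sum.mono_neutral_left) (auto simp: in_keys_iff)
  finally show ?thesis .
qed

lemma diff_act_add_left: "diff_act (g + h) F = diff_act g F + diff_act h F"
proof -
  let ?A = "Poly_Mapping.keys g \<union> Poly_Mapping.keys h"
  have "Poly_Mapping.keys (g + h) \<subseteq> ?A" by (rule Poly_Mapping.keys_add)
  then show ?thesis
    by (simp add: diff_act_superset[of ?A "Poly_Mapping.keys F"] lookup_add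
        distrib_right single_add sum.distrib)
qed

lemma diff_act_add_right: "diff_act g (F + G) = diff_act g F + diff_act g G"
proof -
  let ?B = "Poly_Mapping.keys F \<union> Poly_Mapping.keys G"
  have "Poly_Mapping.keys (F + G) \<subseteq> ?B" by (rule Poly_Mapping.keys_add)
  then show ?thesis
    by (simp add: diff_act_superset[of "Poly_Mapping.keys g" ?B] lookup_add
        distrib_left distrib_right single_add sum.distrib)
qed

lemma diff_act_zero_left [simp]: "diff_act 0 F = 0"
  by (simp add: diff_act_def)

lemma diff_act_zero_right [simp]: "diff_act g 0 = 0"
  by (simp add: diff_act_def)

lemma diff_act_single:
  "diff_act (Poly_Mapping.single a c) (Poly_Mapping.single b d) =
     Poly_Mapping.single (b - a) (c * d * falling b a)"
  by (subst diff_act_superset[of "{a}" "{b}"]) auto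

lemma diff_act_one: "diff_act 1 F = F"
proof -
  have single: "diff_act 1 (Poly_Mapping.single b d) = Poly_Mapping.single b d"
    for b :: "'a \<Rightarrow>\<^sub>0 nat" and d :: complex
    using diff_act_single[of 0 1 b d] by (simp add: falling_def)
  show ?thesis
  proof (induction F rule: update_induct)
    case const
    show ?case by simp
  next
    case (update f a b)
    have "Poly_Mapping.update a b f = f + Poly_Mapping.single a b"
      using update.hyps by (intro poly_mapping_eqI)
        (auto simp: lookup_update lookup_add lookup_single in_keys_iff when_def)
    then show ?case using update.IH single by (simp add: diff_act_add_right)
  qed
qed

lemma diff_act_Var:
  "diff_act (Var i) (Poly_Mapping.single b d) =
     Poly_Mapping.single (b - Poly_Mapping.single i 1) (of_nat (Poly_Mapping.lookup b i) * d)"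
proof -
  have "falling b (Poly_Mapping.single i 1) =
      (\<Prod>k\<in>UNIV. if k = i then of_nat (Poly_Mapping.lookup b i) else 1)"
    unfolding falling_def by (intro prod.cong) (auto simp: lookup_single when_def)
  then have "falling b (Poly_Mapping.single i 1) = of_nat (Poly_Mapping.lookup b i)"
    by simp
  then show ?thesis by (simp add: Var_def diff_act_single mult.commute)
qed

lemma falling_add: "falling b (a + a') = falling b a' * falling (b - a') a"
proof -
  have prod_split: "(\<Prod>j<k + l. (of_nat m - of_nat j :: complex)) =
      (\<Prod>j<l. of_nat m - of_nat j) * (\<Prod>j<k. of_nat (m - l) - of_nat j)" for k l m
  proof (cases "l \<le> m")
    case True
    then show ?thesis
      by (induction k) (simp_all add: of_nat_diff algebra_simps)
  next
    case False
    then have "(\<Prod>j<l. (of_nat m - of_nat j :: complex)) = 0"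
      "(\<Prod>j<k + l. (of_nat m - of_nat j :: complex)) = 0"
      by (auto intro!: prod_zero bexI[of _ m])
    then show ?thesis by (simp only: mult_zero_left)
  qed
  show ?thesis
    by (simp add: falling_def lookup_add lookup_minus prod_split prod.distrib)
qed

lemma diff_act_mult: "diff_act (g * h) F = diff_act g (diff_act h F)"
proof -
  have upd: "Poly_Mapping.update a b f = f + Poly_Mapping.single a b"
    if "a \<notin> Poly_Mapping.keys f" for a :: "'a \<Rightarrow>\<^sub>0 nat" and b :: complex and f
    using that by (intro poly_mapping_eqI)
      (auto simp: lookup_update lookup_add lookup_single in_keys_iff when_def)
  have mono: "diff_act (Poly_Mapping.single a c * Poly_Mapping.single a' c') (Poly_Mapping.single b d)
      = diff_act (Poly_Mapping.single a c) (diff_act (Poly_Mapping.single a' c') (Poly_Mapping.single b d))"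
    for a a' b :: "'a \<Rightarrow>\<^sub>0 nat" and c c' d :: complex
  proof -
    have "b - (a + a') = b - a' - a"
      by (metis add.commute diff_diff_eq)
    then show ?thesis
      unfolding mult_single diff_act_single falling_add by (simp only: mult_ac)
  qed
  have mono2: "diff_act (Poly_Mapping.single a c * Poly_Mapping.single a' c') F
      = diff_act (Poly_Mapping.single a c) (diff_act (Poly_Mapping.single a' c') F)"
    for a a' :: "'a \<Rightarrow>\<^sub>0 nat" and c c' :: complex
    by (induction F rule: update_induct) (simp_all add: upd diff_act_add_right mono)
  have mono3: "diff_act (Poly_Mapping.single a c * h) F
      = diff_act (Poly_Mapping.single a c) (diff_act h F)"
    for a :: "'a \<Rightarrow>\<^sub>0 nat" and c :: complex
    by (induction h rule: update_induct)
      (simp_all add: upd diff_act_add_right diff_act_add_left distrib_left mono2)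
  show ?thesis
    by (induction g rule: update_induct)
      (simp_all add: upd diff_act_add_left distrib_right mono3)
qed


section \<open>Projective space\<close>

text \<open>
  A point of the projective space with coordinates indexed by \<open>'v\<close> is a one-dimensional
  linear subspace of \<open>complex ^ 'v\<close>.
\<close>

definition proj_space :: "(complex ^ 'v::finite) set set" where
  "proj_space = {vec.span {v} | v. v \<noteq> 0}"

text \<open>The affine cone over the linear span of a set of points.\<close>

definition lin_span :: "(complex ^ 'v::finite) set set \<Rightarrow> (complex ^ 'v) set" where
  "lin_span Z = vec.span (\<Union>Z)"

text \<open>
  The representative \<open>v = 0\<close> in \<open>p\<close> does no harm: a form of positive degree vanishes there, and a
  constant vanishes there iff it is zero.
\<close>

definition vanishes_at :: "'v::finite mpoly \<Rightarrow> (complex ^ 'v) set \<Rightarrow> bool" where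
  "vanishes_at g p \<longleftrightarrow> (\<forall>v\<in>p. eval_at v g = 0)"

definition zero_locus :: "'v::finite mpoly set \<Rightarrow> (complex ^ 'v) set set" where
  "zero_locus J = {p \<in> proj_space. \<forall>g\<in>J. vanishes_at g p}"

definition point_ideal :: "(complex ^ 'v::finite) set set \<Rightarrow> 'v mpoly set" where
  "point_ideal Z = ideal_gen {g. (\<exists>d. g \<in> forms d) \<and> (\<forall>p\<in>Z. vanishes_at g p)}"

text \<open>\<open>B\<close> is a set of representatives of a basis of the image of \<open>V\<close> in the quotient by \<open>I\<close>.\<close>

definition basis_mod :: "'v mpoly set \<Rightarrow> 'v mpoly set \<Rightarrow> 'v mpoly set \<Rightarrow> bool" where
  "basis_mod I V B \<longleftrightarrow> finite B \<and> B \<subseteq> V \<and>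
     (\<forall>c. (\<Sum>b\<in>B. Const (c b) * b) \<in> I \<longrightarrow> (\<forall>b\<in>B. c b = 0)) \<and>
     (\<forall>p\<in>V. \<exists>c. p - (\<Sum>b\<in>B. Const (c b) * b) \<in> I)"

definition HF :: "(complex ^ 'v::finite) set set \<Rightarrow> nat \<Rightarrow> nat" where
  "HF Z i = (THE r. \<exists>B. basis_mod (point_ideal Z) (forms i) B \<and> card B = r)"

definition linear_general_position :: "(complex ^ 'v::finite) set set \<Rightarrow> bool" where
  "linear_general_position Y \<longleftrightarrow>
     (\<forall>Z\<subseteq>Y. finite Z \<longrightarrow> vec.dim (lin_span Z) = min (card Z) CARD('v))"


section \<open>Waring rank and Waring loci\<close>

definition waring_rank :: "'v mpoly \<Rightarrow> nat" where
  "waring_rank F = (LEAST r. \<exists>\<alpha> L. (\<forall>i<r. L i \<in> forms 1) \<and>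
     F = (\<Sum>i<r. Const (\<alpha> i) * L i ^ total_degree F))"

definition apolar_set :: "'v::finite mpoly \<Rightarrow> (complex ^ 'v) set set \<Rightarrow> bool" where
  "apolar_set F Z \<longleftrightarrow> finite Z \<and> Z \<subseteq> proj_space \<and> point_ideal Z \<subseteq> perp F"

definition minimal_apolar_set :: "'v::finite mpoly \<Rightarrow> (complex ^ 'v) set set \<Rightarrow> bool" where
  "minimal_apolar_set F Z \<longleftrightarrow> apolar_set F Z \<and> card Z = waring_rank F"

definition waring_locus :: "'v::finite mpoly \<Rightarrow> (complex ^ 'v) set set" where
  "waring_locus F = \<Union>{Z. minimal_apolar_set F Z}"

definition forbidden_locus :: "'v::finite mpoly \<Rightarrow> (complex ^ 'v) set set" where
  "forbidden_locus F = proj_space - waring_locus F"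


section \<open>The distinguished coordinate\<close>

definition apex :: "(complex ^ 'n::finite option) set" where
  "apex = vec.span {axis None 1}"

text \<open>
  Projection from \<open>apex\<close> on the hyperplane \<open>X = 0\<close>, as a map of lines. It is meaningful away from
  \<open>apex\<close>, which it sends to the zero subspace, not a point.
\<close>

definition proj_from_apex :: "(complex ^ 'n::finite option) set \<Rightarrow> (complex ^ 'n option) set" where
  "proj_from_apex p = (\<lambda>v. \<chi> k. case k of None \<Rightarrow> 0 | Some j \<Rightarrow> v $ Some j) ` p"

definition act_point ::
    "complex ^ 'n ^ 'n \<Rightarrow> (complex ^ 'n::finite option) set \<Rightarrow> (complex ^ 'n option) set" where
  "act_point \<sigma> p = (\<lambda>v. \<chi> k. case k of None \<Rightarrow> v $ None
     | Some j \<Rightarrow> (\<sigma> *v (\<chi> i. v $ Some i)) $ j) ` p"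

end

theory Submission
  imports Defs
begin

text \<open>
  Write \<open>q = y\<^sub>1\<^sup>2 + \<dots> + y\<^sub>n\<^sup>2\<close>, so that the form is \<open>x\<^sup>2 q\<close>. Everything follows from a normal form of the
  minimal apolar sets (\<open>minimal_apolar_set_iff_config\<close>): there is an orthonormal basis \<open>A\<^sub>1, \<dots>, A\<^sub>n\<close> of
  \<open>\<complex>\<^sup>n\<close> for the bilinear form of \<open>q\<close>, and on each line joining the apex \<open>[1 : 0]\<close> to \<open>[0 : A\<^sub>j]\<close> there are
  exactly three points \<open>[a : A\<^sub>j]\<close>, whose coordinates \<open>a\<close> are the roots of a cubic
  \<open>X\<^sup>3 + p\<^sub>j X + r\<^sub>j\<close>; the only relation between the \<open>n\<close> cubics is \<open>p\<^sub>1 + \<dots> + p\<^sub>n = 0\<close>.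

  For the lower bound, let \<open>t\<close> be a linear form in the \<open>Y\<^sub>j\<close> without zeros at the points of an apolar
  set other than the apex. The \<open>3 n\<close> cubics \<open>t\<^sup>2 Y\<^sub>j\<close>, \<open>t X Y\<^sub>j\<close>, \<open>X\<^sup>2 Y\<^sub>j\<close> are linearly independent as
  functions on these points (\<open>cubics_independent\<close>), because a combination vanishing there must
  annihilate \<open>x\<^sup>2 q\<close>, which kills its terms one after the other, and \<open>t\<close> can be cancelled in between.
  So there are at least \<open>3 n\<close> points other than the apex.

  If there are only \<open>3 n\<close> points, these cubics take all values on them. Expressing \<open>t Y\<^sub>i Y\<^sub>j\<close> in this
  way and reading off coefficients shows that \<open>Y\<^sub>i Y\<^sub>j\<close> agrees on the points with \<open>t\<close> times a linear
  form in the \<open>Y\<^sub>j\<close>. Hence the functions \<open>A / t\<close>, with \<open>A\<close> linear in the \<open>Y\<^sub>j\<close>, form an algebra of dimension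
  \<open>n\<close> that separates the projected points; it contains their indicator functions, so there are
  exactly \<open>n\<close> projected points, they are linearly independent, and products of two distinct indicators
  are apolar quadrics, which makes the points orthogonal (\<open>projected_points_orthonormal\<close>). Forms
  of degree \<open>3\<close> and \<open>4\<close> through the points give the statements about the lines and the cubics
  (\<open>minimal_apolar_vectors_config\<close>).

  Conversely, the divided difference of \<open>(a x + A\<^sub>j)\<^sup>4\<close> over the three roots \<open>a\<close> on a line is \<open>6 x\<^sup>2 A\<^sub>j\<^sup>2\<close>
  up to a multiple of \<open>x\<^sup>4\<close>, and these multiples cancel in the sum over the lines
  (\<open>config_decomposition\<close>). This gives the rank and, since a nonisotropic vector can be extended to an
  orthonormal basis, the forbidden locus. The ideal of a configuration is generated by the products
  \<open>A\<^sub>i A\<^sub>j\<close> and one cubic gluing the cubics of the lines: modulo these, every form reduces to monomials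
  \<open>X\<^sup>a A\<^sub>j\<^sup>b\<close> with \<open>a \<le> 2\<close>, and, apart from the equality of the \<open>n\<close> ways to write \<open>X\<^sup>d\<close>, these are
  independent on the points (\<open>point_ideal_config\<close>, \<open>HF_config\<close>). The orthogonal matrix with rows \<open>A\<^sub>j\<close>
  moves the configuration to the coordinate lines.
\<close>

section \<open>Evaluation and forms\<close>

lemma poly_mapping_induct [case_names zero single add]:
  fixes p :: "'a \<Rightarrow>\<^sub>0 'b::comm_monoid_add"
  assumes "P 0" "\<And>a c. P (Poly_Mapping.single a c)" "\<And>p q. P p \<Longrightarrow> P q \<Longrightarrow> P (p + q)"
  shows "P p"
proof (induction p rule: update_induct)
  case const
  show ?case by (rule assms(1))
next
  case (update f a b)
  have "Poly_Mapping.update a b f = f + Poly_Mapping.single a b"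
    using update.hyps by (intro poly_mapping_eqI)
      (auto simp: lookup_update lookup_add lookup_single in_keys_iff when_def)
  then show ?case using update.IH assms(2,3) by simp
qed

definition mon_at :: "complex ^ 'v::finite \<Rightarrow> ('v \<Rightarrow>\<^sub>0 nat) \<Rightarrow> complex" where
  "mon_at v m = (\<Prod>i\<in>UNIV. (v $ i) ^ Poly_Mapping.lookup m i)"

lemma mon_at_add: "mon_at v (a + b) = mon_at v a * mon_at v b"
  by (simp add: mon_at_def lookup_add power_add prod.distrib)

lemma mon_at_zero [simp]: "mon_at v 0 = 1"
  by (simp add: mon_at_def)

lemma mon_at_single [simp]: "mon_at v (Poly_Mapping.single i k) = (v $ i) ^ k"
proof -
  have "mon_at v (Poly_Mapping.single i k) = (\<Prod>j\<in>UNIV. if j = i then (v $ i) ^ k else 1)"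
    unfolding mon_at_def by (intro prod.cong) (auto simp: lookup_single when_def)
  then show ?thesis by simp
qed

lemma eval_at_superset:
  assumes "finite A" "Poly_Mapping.keys p \<subseteq> A"
  shows "eval_at v p = (\<Sum>m\<in>A. Poly_Mapping.lookup p m * mon_at v m)"
proof -
  have "(\<Prod>i\<in>Poly_Mapping.keys m. (v $ i) ^ Poly_Mapping.lookup m i) = mon_at v m" for m
    unfolding mon_at_def by (intro prod.mono_neutral_left) (auto simp: in_keys_iff)
  then have "eval_at v p = (\<Sum>m\<in>Poly_Mapping.keys p. Poly_Mapping.lookup p m * mon_at v m)"
    by (simp add: eval_at_def)
  also have "\<dots> = (\<Sum>m\<in>A. Poly_Mapping.lookup p m * mon_at v m)"
    using assms by (intro sum.mono_neutral_left) (auto simp: in_keys_iff)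
  finally show ?thesis .
qed

lemma eval_at_zero [simp]: "eval_at v 0 = 0"
  by (simp add: eval_at_def)

lemma eval_at_single: "eval_at v (Poly_Mapping.single m c) = c * mon_at v m"
  by (subst eval_at_superset[of "{m}"]) auto

lemma eval_at_add [simp]: "eval_at v (p + q) = eval_at v p + eval_at v q"
proof -
  have "Poly_Mapping.keys (p + q) \<subseteq> Poly_Mapping.keys p \<union> Poly_Mapping.keys q"
    by (rule Poly_Mapping.keys_add)
  then show ?thesis
    by (simp add: eval_at_superset[of "Poly_Mapping.keys p \<union> Poly_Mapping.keys q"]
        lookup_add distrib_right sum.distrib)
qed

lemma eval_at_mult [simp]: "eval_at v (p * q) = eval_at v p * eval_at v q"
proof (induction p rule: poly_mapping_induct)
  case (single a c)
  show ?case
    by (induction q rule: poly_mapping_induct)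
      (simp_all add: mult_single eval_at_single mon_at_add algebra_simps)
qed (simp_all add: distrib_right)

lemma eval_at_Const [simp]: "eval_at v (Const c) = c"
  by (simp add: Const_def eval_at_single)

lemma Const_zero [simp]: "Const 0 = 0"
  by (simp add: Const_def)

lemma Const_one [simp]: "Const 1 = 1"
  by (simp add: Const_def)

lemma Const_add: "Const (a + b) = Const a + Const b"
  by (simp add: Const_def single_add)

lemma Const_uminus: "Const (- a) = - Const a"
  by (simp add: Const_def single_uminus)

lemma Const_mult: "Const (a * b) = Const a * Const b"
  by (simp add: Const_def mult_single)

lemma Const_power: "Const (a ^ k) = Const a ^ k"
  by (induction k) (simp_all add: Const_mult)

lemma Const_numeral [simp]: "Const (numeral k) = numeral k"
  by (simp add: Const_def)

lemma Const_sum: "Const (sum f A) = (\<Sum>i\<in>A. Const (f i))"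
  by (induction A rule: infinite_finite_induct) (simp_all add: Const_add)

lemma eval_at_one [simp]: "eval_at v 1 = 1"
  using eval_at_Const[of v 1] by simp

lemma eval_at_numeral [simp]: "eval_at v (numeral k) = numeral k"
  using eval_at_Const[of v "numeral k"] by simp

lemma eval_at_uminus [simp]: "eval_at v (- p) = - eval_at v p"
  using eval_at_add[of v p "- p"] by (simp add: eq_neg_iff_add_eq_0 add.commute)

lemma eval_at_diff [simp]: "eval_at v (p - q) = eval_at v p - eval_at v q"
  using eval_at_add[of v p "- q"] by simp

lemma eval_at_power [simp]: "eval_at v (p ^ k) = eval_at v p ^ k"
  by (induction k) simp_all

lemma eval_at_sum [simp]: "eval_at v (sum f A) = (\<Sum>i\<in>A. eval_at v (f i))"
  by (induction A rule: infinite_finite_induct) simp_all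

lemma eval_at_Var [simp]: "eval_at v (Var i) = v $ i"
  by (simp add: Var_def eval_at_single)

lemma mdeg_UNIV: "mdeg m = (\<Sum>i\<in>UNIV. Poly_Mapping.lookup m i)" for m :: "'v::finite \<Rightarrow>\<^sub>0 nat"
  unfolding mdeg_def by (intro sum.mono_neutral_left) (auto simp: in_keys_iff)

lemma mdeg_add [simp]: "mdeg (a + b) = mdeg a + mdeg b" for a :: "'v::finite \<Rightarrow>\<^sub>0 nat"
  by (simp add: mdeg_UNIV lookup_add sum.distrib)

lemma mdeg_single [simp]: "mdeg (Poly_Mapping.single i k) = k"
  by (cases "k = 0") (simp_all add: mdeg_def)

lemma mdeg_zero [simp]: "mdeg 0 = 0"
  by (simp add: mdeg_def)

lemma mdeg_eq_0_iff: "mdeg m = 0 \<longleftrightarrow> m = 0" for m :: "'v::finite \<Rightarrow>\<^sub>0 nat"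
  by (auto simp: mdeg_UNIV intro: poly_mapping_eqI)

lemma mdeg_SucE:
  fixes m :: "'v::finite \<Rightarrow>\<^sub>0 nat"
  assumes "mdeg m = Suc d"
  obtains i m' where "m = Poly_Mapping.single i 1 + m'" "mdeg m' = d"
proof -
  obtain i where i: "Poly_Mapping.lookup m i \<noteq> 0"
    using assms by (metis mdeg_eq_0_iff nat.distinct(1) poly_mapping_eqI lookup_zero)
  have "m = Poly_Mapping.single i 1 + (m - Poly_Mapping.single i 1)"
    using i by (intro poly_mapping_eqI)
      (auto simp: lookup_add lookup_minus lookup_single when_def)
  then show thesis using that assms
    by (metis mdeg_add mdeg_single plus_1_eq_Suc diff_Suc_1 add_diff_cancel_left')
qed

lemma forms_zero [simp]: "0 \<in> forms d"
  by (simp add: forms_def)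

lemma forms_add [intro]: "p \<in> forms d \<Longrightarrow> q \<in> forms d \<Longrightarrow> p + q \<in> forms d"
  using Poly_Mapping.keys_add[of p q] 
    by (auto simp: forms_def image_iff ex_in_conv)

lemma forms_uminus [intro]: "p \<in> forms d \<Longrightarrow> - p \<in> forms d"
  by (simp add: forms_def in_keys_iff)

lemma forms_diff [intro]: "p \<in> forms d \<Longrightarrow> q \<in> forms d \<Longrightarrow> p - q \<in> forms d"
  using forms_add[of p d "- q"] by auto

lemma forms_mult [intro]:
  fixes p q :: "'v::finite mpoly"
  shows "p \<in> forms d \<Longrightarrow> q \<in> forms e \<Longrightarrow> p * q \<in> forms (d + e)"
  using Poly_Mapping.keys_mult[of p q] by (fastforce simp: forms_def)

lemma forms_Const [intro]: "Const c \<in> forms 0"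
  by (simp add: forms_def Const_def)

lemma forms_one [intro]: "1 \<in> forms 0"
  using forms_Const[of 1] by simp

lemma forms_Var [intro]: "Var i \<in> forms 1"
  by (simp add: forms_def Var_def)

lemma forms_Const_mult [intro]:
  fixes p :: "'v::finite mpoly"
  shows "p \<in> forms d \<Longrightarrow> Const c * p \<in> forms d"
  using forms_mult[OF forms_Const, of p d c] by simp

lemma forms_sum [intro]: "(\<And>i. i \<in> A \<Longrightarrow> f i \<in> forms d) \<Longrightarrow> sum f A \<in> forms d"
  by (induction A rule: infinite_finite_induct) auto

lemma forms_power [intro]:
  fixes p :: "'v::finite mpoly"
  shows "p \<in> forms d \<Longrightarrow> p ^ k \<in> forms (k * d)"
  by (induction k) auto

lemma forms_mult_eq:
  fixes p q :: "'v::finite mpoly"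
  shows "p \<in> forms d \<Longrightarrow> q \<in> forms e \<Longrightarrow> k = d + e \<Longrightarrow> p * q \<in> forms k"
  by auto

lemma forms_power1:
  fixes p :: "'v::finite mpoly"
  shows "p \<in> forms 1 \<Longrightarrow> p ^ k \<in> forms k"
  using forms_power[of p 1 k] by simp

text \<open>
  Multiplication with single variables and addition reach every form, so that statements about
  forms need only be checked on variables.
\<close>

lemma forms_induct [consumes 1, case_names Const mult add]:
  fixes p :: "'v::finite mpoly"
  assumes "p \<in> forms d"
    and Const: "\<And>c. P 0 (Const c)"
    and mult: "\<And>d i p. p \<in> forms d \<Longrightarrow> P d p \<Longrightarrow> P (Suc d) (Var i * p)"
    and add: "\<And>d p q. p \<in> forms d \<Longrightarrow> q \<in> forms d \<Longrightarrow> P d p \<Longrightarrow> P d q \<Longrightarrow> P d (p + q)"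
  shows "P d p"
proof -
  have single: "P d (Poly_Mapping.single m c)" if "mdeg m = d" for d m c
    using that
  proof (induction d arbitrary: m)
    case 0
    then show ?case using Const[of c] by (simp add: mdeg_eq_0_iff Const_def)
  next
    case (Suc d)
    then obtain i m' where m: "m = Poly_Mapping.single i 1 + m'" "mdeg m' = d"
      by (metis mdeg_SucE)
    have "Poly_Mapping.single m' c \<in> forms d" using m by (simp add: forms_def)
    from mult[OF this Suc.IH, of i] m show ?case by (simp add: Var_def mult_single)
  qed
  have "p \<in> forms d \<longrightarrow> P d p"
  proof (induction p rule: update_induct)
    case const
    obtain i :: 'v where True by simp
    have "P d 0" 
      using single[of "Poly_Mapping.single i d" d 0] by simp
    then show ?case by simp
  next
    case (update f a b)
    have eq: "Poly_Mapping.update a b f = f + Poly_Mapping.single a b"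
      using update.hyps by (intro poly_mapping_eqI)
        (auto simp: lookup_update lookup_add lookup_single in_keys_iff when_def)
    have keys: "Poly_Mapping.keys (Poly_Mapping.update a b f) = insert a (Poly_Mapping.keys f)"
      using update.hyps by (auto simp: in_keys_iff lookup_update split: if_splits)
    show ?case
    proof
      assume "Poly_Mapping.update a b f \<in> forms d"
      then have "f \<in> forms d" "mdeg a = d" using keys by (auto simp: forms_def)
      moreover from this have "Poly_Mapping.single a b \<in> forms d" by (simp add: forms_def)
      ultimately show "P d (Poly_Mapping.update a b f)"
        unfolding eq using update.IH single by (intro add) auto
    qed
  qed
  then show ?thesis using assms(1) by simp
qed

lemma eval_at_scale:
  assumes "p \<in> forms d"
  shows "eval_at (c *s v) p = c ^ d * eval_at v p"
  using assms by (induction rule: forms_induct) (simp_all add: algebra_simps)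

lemma total_degree_forms:
  assumes "p \<in> forms d" "p \<noteq> 0"
  shows "total_degree p = d"
proof -
  have "Poly_Mapping.keys p \<noteq> {}"
    using assms(2) by (metis ex_in_conv in_keys_iff lookup_zero poly_mapping_eqI)
  then have "mdeg ` Poly_Mapping.keys p = {d}" using assms(1) 
    by (auto simp: forms_def image_iff ex_in_conv)
  then show ?thesis by (simp add: total_degree_def)
qed


section \<open>Differentiation\<close>

lemma diff_act_Const: "diff_act (Const c) F = Const c * F"
  by (induction F rule: poly_mapping_induct)
    (simp_all add: diff_act_add_right distrib_left Const_def diff_act_single mult_single falling_def)

lemma diff_act_Const_mult_left: "diff_act (Const c * g) F = Const c * diff_act g F"
  by (simp add: diff_act_mult diff_act_Const)

lemma diff_act_Const_mult_right: "diff_act g (Const c * F) = Const c * diff_act g F"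
  by (metis diff_act_mult diff_act_Const mult.commute)

lemma diff_act_uminus_left: "diff_act (- g) F = - diff_act g F"
  using diff_act_Const_mult_left[of "-1" g F] by (simp add: Const_uminus)

lemma diff_act_diff_left: "diff_act (g - h) F = diff_act g F - diff_act h F"
  using diff_act_add_left[of g "- h" F] by (simp add: diff_act_uminus_left)

lemma diff_act_sum_left: "diff_act (sum f A) F = (\<Sum>i\<in>A. diff_act (f i) F)"
  by (induction A rule: infinite_finite_induct) (simp_all add: diff_act_add_left)

lemma diff_act_sum_right: "diff_act g (sum f A) = (\<Sum>i\<in>A. diff_act g (f i))"
  by (induction A rule: infinite_finite_induct) (simp_all add: diff_act_add_right)

lemma diff_act_Var_product:
  "diff_act (Var i) (G * H) = diff_act (Var i) G * H + G * diff_act (Var i) H"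
proof (induction G rule: poly_mapping_induct)
  case (single b c)
  show ?case
  proof (induction H rule: poly_mapping_induct)
    case (single b' c')
    let ?e = "Poly_Mapping.single i (1::nat)"
    let ?l = "Poly_Mapping.lookup"
    have 1: "?l b i = 0 \<or> b + b' - ?e = (b - ?e) + b'"
      by (auto intro!: poly_mapping_eqI simp: lookup_add lookup_minus lookup_single when_def)
    have 2: "?l b' i = 0 \<or> b + b' - ?e = b + (b' - ?e)"
      by (auto intro!: poly_mapping_eqI simp: lookup_add lookup_minus lookup_single when_def)
    have "Poly_Mapping.single (b + b' - ?e) (of_nat (?l (b + b') i) * (c * c')) =
        Poly_Mapping.single (b + b' - ?e) (of_nat (?l b i) * c * c') +
        Poly_Mapping.single (b + b' - ?e) (c * (of_nat (?l b' i) * c'))"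
      by (simp add: single_add[symmetric] lookup_add algebra_simps)
    also have "Poly_Mapping.single (b + b' - ?e) (of_nat (?l b i) * c * c') =
        Poly_Mapping.single ((b - ?e) + b') (of_nat (?l b i) * c * c')"
      using 1 by auto
    also have "Poly_Mapping.single (b + b' - ?e) (c * (of_nat (?l b' i) * c')) =
        Poly_Mapping.single (b + (b' - ?e)) (c * (of_nat (?l b' i) * c'))"
      using 2 by auto
    finally show ?case
      by (simp only: mult_single diff_act_Var)
  qed (simp_all add: diff_act_add_right distrib_left)
qed (simp_all add: diff_act_add_right distrib_right)

lemma diff_act_Var_Var: "diff_act (Var i) (Var j) = (if i = j then 1 else 0)"
  unfolding Var_def[of j] diff_act_Var by (simp add: lookup_single when_def)

definition lf :: "complex ^ 'v::finite \<Rightarrow> 'v mpoly" where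
  "lf v = (\<Sum>i\<in>UNIV. Const (v $ i) * Var i)"

text \<open>
  Bilinear and not Hermitian: this is the polarisation of \<open>y\<^sub>1\<^sup>2 + \<dots> + y\<^sub>n\<^sup>2\<close>, and nonzero vectors
  may be isotropic.
\<close>

definition bil :: "complex ^ 'v::finite \<Rightarrow> complex ^ 'v \<Rightarrow> complex" (infixl "\<bullet>\<^sub>b" 70) where
  "u \<bullet>\<^sub>b v = (\<Sum>i\<in>UNIV. u $ i * v $ i)"

lemma bil_commute: "u \<bullet>\<^sub>b v = v \<bullet>\<^sub>b u"
  by (simp add: bil_def mult.commute)

lemma bil_simps [simp]:
  "0 \<bullet>\<^sub>b v = 0" "v \<bullet>\<^sub>b 0 = 0" "(u + u') \<bullet>\<^sub>b v = u \<bullet>\<^sub>b v + u' \<bullet>\<^sub>b v" "v \<bullet>\<^sub>b (u + u') = v \<bullet>\<^sub>b u + v \<bullet>\<^sub>b u'"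
  "(u - u') \<bullet>\<^sub>b v = u \<bullet>\<^sub>b v - u' \<bullet>\<^sub>b v" "v \<bullet>\<^sub>b (u - u') = v \<bullet>\<^sub>b u - v \<bullet>\<^sub>b u'"
  "(- u) \<bullet>\<^sub>b v = - (u \<bullet>\<^sub>b v)" "v \<bullet>\<^sub>b (- u) = - (v \<bullet>\<^sub>b u)"
  "(c *s u) \<bullet>\<^sub>b v = c * (u \<bullet>\<^sub>b v)" "v \<bullet>\<^sub>b (c *s u) = c * (v \<bullet>\<^sub>b u)"
  by (simp_all add: bil_def sum.distrib sum_subtractf sum_negf sum_distrib_left algebra_simps)

lemma bil_sum_left: "(\<Sum>i\<in>I. f i) \<bullet>\<^sub>b v = (\<Sum>i\<in>I. f i \<bullet>\<^sub>b v)"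
  by (induction I rule: infinite_finite_induct) simp_all

lemma bil_axis [simp]: "axis i c \<bullet>\<^sub>b v = c * v $ i" "v \<bullet>\<^sub>b axis i c = c * v $ i"
proof -
  have "axis i c \<bullet>\<^sub>b v = (\<Sum>j\<in>UNIV. if j = i then c * v $ i else 0)"
    unfolding bil_def by (intro sum.cong) (auto simp: axis_def)
  then show "axis i c \<bullet>\<^sub>b v = c * v $ i" by simp
  then show "v \<bullet>\<^sub>b axis i c = c * v $ i" by (simp add: bil_commute)
qed

lemma forms_lf [intro]: "lf v \<in> forms 1"
  unfolding lf_def by (intro forms_sum forms_Const_mult forms_Var)

lemma eval_at_lf [simp]: "eval_at w (lf v) = v \<bullet>\<^sub>b w"
  by (simp add: lf_def bil_def)

lemma diff_act_lf: "diff_act (lf u) G = (\<Sum>i\<in>UNIV. Const (u $ i) * diff_act (Var i) G)"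
  by (simp add: lf_def diff_act_sum_left diff_act_Const_mult_left)

lemma diff_act_lf_product:
  "diff_act (lf u) (G * H) = diff_act (lf u) G * H + G * diff_act (lf u) H"
  by (simp add: diff_act_lf diff_act_Var_product sum.distrib sum_distrib_left sum_distrib_right
      algebra_simps)

lemma diff_act_Var_lf: "diff_act (Var i) (lf v) = Const (v $ i)"
proof -
  have "diff_act (Var i) (lf v) = (\<Sum>j\<in>UNIV. if i = j then Const (v $ i) else 0)"
    unfolding lf_def diff_act_sum_right diff_act_Const_mult_right diff_act_Var_Var
    by (intro sum.cong) auto
  then show ?thesis by simp
qed

lemma diff_act_lf_lf: "diff_act (lf u) (lf v) = Const (u \<bullet>\<^sub>b v)"
  by (simp add: diff_act_lf diff_act_Var_lf bil_def Const_sum Const_mult)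

lemma diff_act_lf_Const: "diff_act (lf u) (Const c) = 0"
proof -
  have "diff_act (Var i) (Const c) = 0" for i :: 'a
    unfolding Const_def diff_act_Var by simp
  then show ?thesis by (simp add: diff_act_lf)
qed

lemma Var_eq_lf: "Var i = lf (axis i 1)"
proof -
  have "lf (axis i 1) = (\<Sum>j\<in>UNIV. if j = i then Var i else 0)"
    unfolding lf_def by (intro sum.cong) (auto simp: axis_def)
  then show ?thesis by simp
qed

lemma lf_of_form:
  assumes "p \<in> forms 1"
  obtains v where "p = lf v"
proof -
  have lf_add: "lf u + lf v = lf (u + v)" for u v :: "complex ^ 'a"
    by (simp add: lf_def sum.distrib[symmetric] Const_add distrib_right)
  have "(d = 0 \<longrightarrow> (\<exists>c. p = Const c)) \<and> (d = 1 \<longrightarrow> (\<exists>v. p = lf v))" if "p \<in> forms d"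
    for d and p :: "'a mpoly"
    using that
  proof (induction rule: forms_induct)
    case (mult d i p)
    show ?case
    proof (intro conjI impI)
      assume "Suc d = 1"
      then obtain c where p: "p = Const c" using mult by auto
      have "lf (c *s axis i 1) = (\<Sum>j\<in>UNIV. if j = i then Const c * Var i else 0)"
        unfolding lf_def by (intro sum.cong) (auto simp: axis_def)
      then show "\<exists>v. Var i * p = lf v"
        by (intro exI[of _ "c *s axis i 1"]) (simp add: p mult.commute)
    qed auto
  next
    case (add d p q)
    then show ?case by (metis Const_add lf_add)
  qed auto
  with assms that show thesis by blast
qed

text \<open>
  Vanishing of a form on the points of a decomposition makes it annihilate the decomposed form,
  because differentiating a power of a linear form amounts to evaluating at its coefficient vector.
  For \<open>k < d\<close> the numerical factor is zero, so the truncated exponent \<open>k - d\<close> does no harm.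
\<close>

lemma diff_act_lf_power:
  assumes "g \<in> forms d"
  shows "diff_act g (lf v ^ k) =
    Const ((\<Prod>j<d. of_nat (k - j)) * eval_at v g) * lf v ^ (k - d)"
  using assms
proof (induction rule: forms_induct)
  case (Const c)
  then show ?case by (simp add: diff_act_Const)
next
  case (mult d i p)
  have pow: "diff_act (Var i) (lf v ^ m) = Const (of_nat m * v $ i) * lf v ^ (m - 1)" for m
  proof (induction m)
    case (Suc m)
    have "diff_act (Var i) (lf v ^ Suc m) = Const (v $ i) * lf v ^ m
        + lf v * (Const (of_nat m * v $ i) * lf v ^ (m - 1))"
      by (simp add: diff_act_Var_product diff_act_Var_lf Suc)
    also have "lf v * (Const (of_nat m * v $ i) * lf v ^ (m - 1)) = Const (of_nat m * v $ i) * lf v ^ m"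
      by (cases m) (simp_all add: algebra_simps)
    finally show ?case by (simp add: Const_add algebra_simps)
  next
    case 0
    have "diff_act (lf (axis i 1)) (Const 1) = 0" by (rule diff_act_lf_Const)
    then show ?case by (simp add: Var_eq_lf)
  qed
  show ?case
    by (simp add: diff_act_mult mult.IH diff_act_Const_mult_right pow Const_mult[symmetric]
        mult.assoc[symmetric]) (simp add: mult_ac)
next
  case (add d p q)
  then show ?case by (simp add: diff_act_add_left Const_add algebra_simps)
qed

section \<open>Ideals and Hilbert functions\<close>

lemma module_mult: "module ((*) :: 'a::comm_ring_1 \<Rightarrow> 'a \<Rightarrow> 'a)"
  by (simp add: module_def algebra_simps)

lemma ideal_gen_base: "g \<in> G \<Longrightarrow> g \<in> ideal_gen G"
  unfolding ideal_gen_def by (rule module.span_base[OF module_mult])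

lemma ideal_gen_zero: "0 \<in> ideal_gen G"
  unfolding ideal_gen_def by (rule module.span_zero[OF module_mult])

lemma ideal_gen_add: "p \<in> ideal_gen G \<Longrightarrow> q \<in> ideal_gen G \<Longrightarrow> p + q \<in> ideal_gen G"
  unfolding ideal_gen_def by (rule module.span_add[OF module_mult])

lemma ideal_gen_diff: "p \<in> ideal_gen G \<Longrightarrow> q \<in> ideal_gen G \<Longrightarrow> p - q \<in> ideal_gen G"
  unfolding ideal_gen_def by (rule module.span_diff[OF module_mult])

lemma ideal_gen_mult: "p \<in> ideal_gen G \<Longrightarrow> h * p \<in> ideal_gen G"
  unfolding ideal_gen_def by (rule module.span_scale[OF module_mult])

lemma ideal_gen_sum: "(\<And>i. i \<in> A \<Longrightarrow> f i \<in> ideal_gen G) \<Longrightarrow> sum f A \<in> ideal_gen G"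
  unfolding ideal_gen_def by (rule module.span_sum[OF module_mult])

lemma ideal_gen_minimal:
  assumes "G \<subseteq> J" "0 \<in> J" "\<And>p q. p \<in> J \<Longrightarrow> q \<in> J \<Longrightarrow> p + q \<in> J"
    "\<And>h p. p \<in> J \<Longrightarrow> h * p \<in> J"
  shows "ideal_gen G \<subseteq> J"
  unfolding ideal_gen_def using assms
  by (intro module.span_minimal[OF module_mult] module.subspaceI[OF module_mult])

lemma ideal_gen_subset: "G \<subseteq> ideal_gen H \<Longrightarrow> ideal_gen G \<subseteq> ideal_gen H"
  by (rule ideal_gen_minimal) (auto intro: ideal_gen_zero ideal_gen_add ideal_gen_mult)

lemma vanishes_at_span:
  assumes "g \<in> forms d"
  shows "vanishes_at g (vec.span {v}) \<longleftrightarrow> eval_at v g = 0"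
proof
  assume "vanishes_at g (vec.span {v})"
  then show "eval_at v g = 0" by (simp add: vanishes_at_def vec.span_base)
next
  assume "eval_at v g = 0"
  then show "vanishes_at g (vec.span {v})"
    by (auto simp: vanishes_at_def vec.span_singleton eval_at_scale[OF assms])
qed

lemma point_ideal_vanishes: "g \<in> point_ideal ((\<lambda>v. vec.span {v}) ` S) \<Longrightarrow> v \<in> S \<Longrightarrow> eval_at v g = 0"
proof -
  assume g: "g \<in> point_ideal ((\<lambda>v. vec.span {v}) ` S)" and v: "v \<in> S"
  have "point_ideal ((\<lambda>v. vec.span {v}) ` S) \<subseteq> {g. eval_at v g = 0}"
    unfolding point_ideal_def
    by (rule ideal_gen_minimal) (use v in \<open>auto simp: vanishes_at_span\<close>)
  with g show ?thesis by auto
qed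

text \<open>
  Every element of the ideal vanishes at the points, because evaluation is multiplicative. For
  forms, this condition on values is also sufficient.
\<close>

lemma point_ideal_form_iff:
  assumes "g \<in> forms d"
  shows "g \<in> point_ideal ((\<lambda>v. vec.span {v}) ` S) \<longleftrightarrow> (\<forall>v\<in>S. eval_at v g = 0)"
proof
  assume "\<forall>v\<in>S. eval_at v g = 0"
  then show "g \<in> point_ideal ((\<lambda>v. vec.span {v}) ` S)"
    unfolding point_ideal_def using assms
    by (intro ideal_gen_base) (auto simp: vanishes_at_span)
qed (use point_ideal_vanishes in blast)

lemma point_ideal_eqI:
  assumes "\<And>d g. g \<in> forms d \<Longrightarrow> \<forall>v\<in>S. eval_at v g = 0 \<Longrightarrow> g \<in> ideal_gen G"
    and "\<And>g. g \<in> G \<Longrightarrow> \<exists>d. g \<in> forms d" "\<And>g v. g \<in> G \<Longrightarrow> v \<in> S \<Longrightarrow> eval_at v g = 0"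
  shows "point_ideal ((\<lambda>v. vec.span {v}) ` S) = ideal_gen G"
proof
  show "point_ideal ((\<lambda>v. vec.span {v}) ` S) \<subseteq> ideal_gen G"
    unfolding point_ideal_def
    by (rule ideal_gen_subset) (use assms(1) in \<open>auto simp: vanishes_at_span\<close>)
  show "ideal_gen G \<subseteq> point_ideal ((\<lambda>v. vec.span {v}) ` S)"
    unfolding point_ideal_def[of "(\<lambda>v. vec.span {v}) ` S"]
  proof (rule ideal_gen_subset, rule subsetI)
    fix g assume "g \<in> G"
    with assms(2,3) obtain d where "g \<in> forms d" "\<forall>v\<in>S. eval_at v g = 0" by blast
    then show "g \<in> ideal_gen {g. (\<exists>d. g \<in> forms d) \<and>
        (\<forall>p\<in>(\<lambda>v. vec.span {v}) ` S. vanishes_at g p)}"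
      using point_ideal_form_iff[of g d S] by (simp add: point_ideal_def)
  qed
qed

text \<open>
  Each equation eliminates one unknown, and one unknown remains. Index sets in place of a vector
  space make this applicable to functions on points.
\<close>

lemma underdetermined_system:
  fixes M :: "'s \<Rightarrow> 'i \<Rightarrow> 'a::field"
  assumes "finite S" "finite I" "card S < card I"
  shows "\<exists>c. (\<exists>i\<in>I. c i \<noteq> 0) \<and> (\<forall>s\<in>S. (\<Sum>i\<in>I. c i * M s i) = 0)"
  using assms
proof (induction S arbitrary: I M rule: finite_induct)
  case empty
  then have "I \<noteq> {}" by auto
  then show ?case by (intro exI[of _ "\<lambda>_. 1"]) auto
next
  case (insert s S)
  show ?case
  proof (cases "\<forall>i\<in>I. M s i = 0")
    case True
    with insert.IH[of I M] insert.prems insert.hyps show ?thesis by auto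
  next
    case False
    then obtain k where k: "k \<in> I" "M s k \<noteq> 0" by blast
    let ?M = "\<lambda>r i. M r i - M r k * M s i / M s k"
    have "card S < card (I - {k})" using insert k by simp
    then obtain c where c: "\<exists>i\<in>I - {k}. c i \<noteq> 0" "\<forall>r\<in>S. (\<Sum>i\<in>I - {k}. c i * ?M r i) = 0"
      using insert.IH[of "I - {k}" ?M] insert.prems by auto
    define z where "z = - (\<Sum>i\<in>I - {k}. c i * M s i) / M s k"
    define c' where "c' = c(k := z)"
    have sum: "(\<Sum>i\<in>I. c' i * M r i) = z * M r k + (\<Sum>i\<in>I - {k}. c i * M r i)" for r
      using k insert.prems by (subst sum.remove[of I k]) (auto simp: c'_def intro!: sum.cong)
    have "(\<Sum>i\<in>I. c' i * M s i) = 0" using k by (simp add: sum z_def)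
    moreover have "(\<Sum>i\<in>I. c' i * M r i) = 0" if "r \<in> S" for r
    proof -
      have "(\<Sum>i\<in>I - {k}. c i * ?M r i) =
          (\<Sum>i\<in>I - {k}. c i * M r i) - (\<Sum>i\<in>I - {k}. c i * M s i) * (M r k / M s k)"
        unfolding sum_distrib_right sum_subtractf[symmetric]
        by (intro sum.cong) (simp_all add: right_diff_distrib mult_ac)
      also have "\<dots> = (\<Sum>i\<in>I. c' i * M r i)"
        using k by (simp add: sum z_def)
      finally show ?thesis using c(2) that by simp
    qed
    moreover have "\<exists>i\<in>I. c' i \<noteq> 0" using c(1) by (auto simp: c'_def)
    ultimately show ?thesis by auto
  qed
qed

lemma Const_sum_mult_eval:
  "eval_at v (\<Sum>k\<in>K. Const (c k) * b k) = (\<Sum>k\<in>K. c k * eval_at v (b k))"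
  by simp

lemma basis_mod_card_le:
  assumes B: "basis_mod (ideal_gen G) V B" and B': "basis_mod (ideal_gen G) V B'"
  shows "card B' \<le> card B"
proof (rule ccontr)
  assume "\<not> card B' \<le> card B"
  then have less: "card B < card B'" by simp
  have fin: "finite B" "finite B'" using B B' by (auto simp: basis_mod_def)
  have "\<forall>b'\<in>B'. \<exists>m. b' - (\<Sum>b\<in>B. Const (m b) * b) \<in> ideal_gen G"
    using B B' unfolding basis_mod_def by blast
  from bchoice[OF this] obtain m
    where m: "b' - (\<Sum>b\<in>B. Const (m b' b) * b) \<in> ideal_gen G" if "b' \<in> B'" for b'
    by blast
  obtain c where c: "\<exists>b'\<in>B'. c b' \<noteq> 0" "\<forall>b\<in>B. (\<Sum>b'\<in>B'. c b' * m b' b) = 0"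
    using underdetermined_system[OF fin less, of "\<lambda>b b'. m b' b"] by auto
  have "(\<Sum>b'\<in>B'. Const (c b') * (b' - (\<Sum>b\<in>B. Const (m b' b) * b))) \<in> ideal_gen G"
    by (intro ideal_gen_sum ideal_gen_mult m)
  also have "(\<Sum>b'\<in>B'. Const (c b') * (b' - (\<Sum>b\<in>B. Const (m b' b) * b))) =
      (\<Sum>b'\<in>B'. Const (c b') * b') - (\<Sum>b'\<in>B'. \<Sum>b\<in>B. Const (c b' * m b' b) * b)"
    by (simp add: right_diff_distrib sum_subtractf sum_distrib_left Const_mult mult.assoc)
  also have "(\<Sum>b'\<in>B'. \<Sum>b\<in>B. Const (c b' * m b' b) * b) =
      (\<Sum>b\<in>B. Const (\<Sum>b'\<in>B'. c b' * m b' b) * b)"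
    by (subst sum.swap) (simp add: Const_sum sum_distrib_right)
  also have "\<dots> = 0" using c(2) by simp
  finally have "\<forall>b'\<in>B'. c b' = 0" using B' unfolding basis_mod_def by auto
  with c(1) show False by blast
qed

text \<open>
  Evaluation at representatives turns the Hilbert function into the dimension of a space of
  functions on a set of vectors.
\<close>

lemma HF_eqI:
  fixes b :: "'k \<Rightarrow> 'v::finite mpoly"
  assumes fin: "finite K" and b: "\<And>k. k \<in> K \<Longrightarrow> b k \<in> forms d"
    and indep: "\<And>c. \<forall>v\<in>S. (\<Sum>k\<in>K. c k * eval_at v (b k)) = 0 \<Longrightarrow> \<forall>k\<in>K. c k = 0"
    and span: "\<And>p. p \<in> forms d \<Longrightarrow> \<exists>c. \<forall>v\<in>S. eval_at v p = (\<Sum>k\<in>K. c k * eval_at v (b k))"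
  shows "HF ((\<lambda>v. vec.span {v}) ` S) d = card K"
proof -
  let ?I = "point_ideal ((\<lambda>v. vec.span {v}) ` S)"
  have inj: "inj_on b K"
  proof (rule inj_onI, rule ccontr)
    fix k l assume kl: "k \<in> K" "l \<in> K" "b k = b l" "k \<noteq> l"
    let ?c = "\<lambda>i. if i = k then 1 else if i = l then - 1 else (0::complex)"
    have "(\<Sum>i\<in>K. ?c i * eval_at v (b i)) = 0" for v
    proof -
      have "(\<Sum>i\<in>K. ?c i * eval_at v (b i)) =
          (\<Sum>i\<in>K. (if i = k then eval_at v (b k) else 0) - (if i = l then eval_at v (b l) else 0))"
        using kl by (intro sum.cong) auto
      then show ?thesis using kl fin by (simp add: sum_subtractf)
    qed
    then have "?c k = 0" using indep[of ?c] kl by blast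
    then show False by simp
  qed
  have reindex: "(\<Sum>x\<in>b ` K. Const (c x) * x) = (\<Sum>k\<in>K. Const (c (b k)) * b k)" for c
    using inj by (simp add: sum.reindex)
  have form: "(\<Sum>k\<in>K. Const (c k) * b k) \<in> forms d" for c
    using b by (intro forms_sum forms_Const_mult)
  have "basis_mod ?I (forms d) (b ` K)"
    unfolding basis_mod_def
  proof (intro conjI allI impI ballI)
    show "finite (b ` K)" using fin by simp
    show "b ` K \<subseteq> forms d" using b by auto
  next
    fix c x assume "(\<Sum>x\<in>b ` K. Const (c x) * x) \<in> ?I" and x: "x \<in> b ` K"
    then have "(\<Sum>k\<in>K. Const (c (b k)) * b k) \<in> ?I" by (simp only: reindex)
    then have "\<forall>v\<in>S. eval_at v (\<Sum>k\<in>K. Const (c (b k)) * b k) = 0"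
      by (rule iffD1[OF point_ideal_form_iff[OF form]])
    then have "\<forall>k\<in>K. c (b k) = 0"
      unfolding Const_sum_mult_eval by (rule indep)
    then show "c x = 0" using x by blast
  next
    fix p :: "'v mpoly" assume p: "p \<in> forms d"
    then obtain c where c: "\<forall>v\<in>S. eval_at v p = (\<Sum>k\<in>K. c k * eval_at v (b k))"
      using span by blast
    have "(\<Sum>x\<in>b ` K. Const (c (the_inv_into K b x)) * x) = (\<Sum>k\<in>K. Const (c k) * b k)"
      unfolding reindex using inj by (intro sum.cong) (auto simp: the_inv_into_f_f)
    moreover have "p - (\<Sum>k\<in>K. Const (c k) * b k) \<in> ?I"
      using c by (intro iffD2[OF point_ideal_form_iff[OF forms_diff[OF p form]]])
        (simp only: eval_at_diff Const_sum_mult_eval, simp)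
    ultimately show "\<exists>c. p - (\<Sum>x\<in>b ` K. Const (c x) * x) \<in> ?I"
      by (intro exI[of _ "\<lambda>x. c (the_inv_into K b x)"]) (simp only:)
  qed
  note basis = this
  have card: "card (b ` K) = card K" using inj by (rule card_image)
  show ?thesis
    unfolding HF_def
  proof (rule the_equality)
    show "\<exists>B. basis_mod ?I (forms d) B \<and> card B = card K" using basis card by blast
  next
    fix r assume "\<exists>B. basis_mod ?I (forms d) B \<and> card B = r"
    then obtain B where B: "basis_mod ?I (forms d) B" "card B = r" by blast
    have "card B = card (b ` K)"
      using B(1) basis unfolding point_ideal_def by (intro order_antisym basis_mod_card_le)
    with B(2) card show "r = card K" by simp
  qed
qed

text \<open>
  Together with \<open>f\<close> there are more functions than points, hence a linear relation, in which \<open>f\<close>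
  must occur.
\<close>

lemma independent_functions_interpolate:
  fixes e :: "'s \<Rightarrow> 'k \<Rightarrow> 'a::field"
  assumes fin: "finite S" "finite K" "card S \<le> card K"
    and indep: "\<And>c. \<forall>v\<in>S. (\<Sum>k\<in>K. c k * e v k) = 0 \<Longrightarrow> \<forall>k\<in>K. c k = 0"
  shows "\<exists>c. \<forall>v\<in>S. f v = (\<Sum>k\<in>K. c k * e v k)"
proof -
  let ?M = "\<lambda>v k. case k of None \<Rightarrow> f v | Some k \<Rightarrow> e v k"
  have "card S < card (insert None (Some ` K))"
    using fin by (simp add: card_image less_Suc_eq_le)
  then obtain c where c: "\<exists>i\<in>insert None (Some ` K). c i \<noteq> 0"
    "\<forall>v\<in>S. (\<Sum>i\<in>insert None (Some ` K). c i * ?M v i) = 0"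
    using underdetermined_system[of S "insert None (Some ` K)" ?M] fin by auto
  have eq: "c None * f v + (\<Sum>k\<in>K. c (Some k) * e v k) = 0" if "v \<in> S" for v
    using c(2) that fin by (simp add: sum.reindex)
  have "c None \<noteq> 0"
  proof
    assume 0: "c None = 0"
    then have "\<forall>k\<in>K. c (Some k) = 0" using eq by (intro indep) auto
    with 0 c(1) show False by auto
  qed
  then have "f v = (\<Sum>k\<in>K. - c (Some k) / c None * e v k)" if "v \<in> S" for v
  proof -
    have "(\<Sum>k\<in>K. - c (Some k) / c None * e v k) = - (\<Sum>k\<in>K. c (Some k) * e v k) / c None"
      by (simp add: sum_negf sum_divide_distrib)
    also have "(\<Sum>k\<in>K. c (Some k) * e v k) = - (c None * f v)"
      using eq[OF that] by (simp add: eq_neg_iff_add_eq_0 add.commute)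
    finally show ?thesis using \<open>c None \<noteq> 0\<close> by simp
  qed
  then show ?thesis by (intro exI[of _ "\<lambda>k. - c (Some k) / c None"]) blast
qed

section \<open>The quartic and its derivatives\<close>

definition pt :: "complex \<Rightarrow> complex ^ 'n::finite \<Rightarrow> complex ^ 'n option" where
  "pt a b = (\<chi> k. case k of None \<Rightarrow> a | Some j \<Rightarrow> b $ j)"

definition body :: "complex ^ 'n::finite option \<Rightarrow> complex ^ 'n" where
  "body v = (\<chi> j. v $ Some j)"

abbreviation X\<^sub>0 :: "'n::finite option mpoly" where
  "X\<^sub>0 \<equiv> Var None"

abbreviation lin :: "complex ^ 'n::finite \<Rightarrow> 'n option mpoly" where
  "lin c \<equiv> lf (pt 0 c)"

definition qf :: "'n::finite option mpoly" where
  "qf = (\<Sum>j\<in>UNIV. Var (Some j) ^ 2)"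

definition quartic :: "'n::finite option mpoly" where
  "quartic = X\<^sub>0 ^ 2 * qf"

lemma pt_nth [simp]: "pt a b $ None = a" "pt a b $ Some j = b $ j"
  by (simp_all add: pt_def)

lemma body_nth [simp]: "body v $ j = v $ Some j"
  by (simp add: body_def)

lemma body_pt [simp]: "body (pt a b) = b"
  by (simp add: vec_eq_iff)

lemma pt_body: "pt (v $ None) (body v) = v"
  unfolding vec_eq_iff
proof
  fix i show "pt (v $ None) (body v) $ i = v $ i" by (cases i) simp_all
qed

lemma pt_eq_iff: "pt a b = pt a' b' \<longleftrightarrow> a = a' \<and> b = b'"
  by (metis body_pt pt_nth(1))

lemma pt_scale: "c *s pt a b = pt (c * a) (c *s b)"
  unfolding vec_eq_iff
proof
  fix i show "(c *s pt a b) $ i = pt (c * a) (c *s b) $ i" by (cases i) simp_all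
qed

lemma body_scale [simp]: "body (c *s v) = c *s body v"
  by (simp add: vec_eq_iff)

lemma sum_UNIV_option: "(\<Sum>k\<in>UNIV. f k) = f None + (\<Sum>j\<in>UNIV. f (Some j))"
  for f :: "'n::finite option \<Rightarrow> 'b::comm_monoid_add"
  by (simp add: UNIV_option_conv sum.reindex)

lemma bil_pt [simp]: "pt a b \<bullet>\<^sub>b v = a * v $ None + b \<bullet>\<^sub>b body v"
  by (simp add: bil_def sum_UNIV_option)

lemma lin_sum: "lin c = (\<Sum>j\<in>UNIV. Const (c $ j) * Var (Some j))"
  by (simp add: lf_def sum_UNIV_option)

lemma Var_Some_lin: "Var (Some j) = lin (axis j 1)"
proof -
  have "lin (axis j 1) = (\<Sum>k\<in>UNIV. if k = j then Var (Some j) else 0)"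
    unfolding lin_sum by (intro sum.cong) (auto simp: axis_def)
  also have "\<dots> = Var (Some j)" by simp
  finally show ?thesis ..
qed

lemma X_lf: "X\<^sub>0 = lf (pt 1 0)"
  by (simp add: lf_def sum_UNIV_option)

lemma forms_lin [intro]: "lin c \<in> forms 1"
  by (rule forms_lf)

lemma forms_X [intro]: "X\<^sub>0 \<in> forms 1"
  by (rule forms_Var)

lemma forms_products [intro]:
  "p \<in> forms d \<Longrightarrow> X\<^sub>0 * p \<in> forms (Suc d)" "p \<in> forms d \<Longrightarrow> lin c * p \<in> forms (Suc d)"
  "X\<^sub>0 ^ k \<in> forms k" "lin c ^ k \<in> forms k"
  using forms_mult[OF forms_X, of p d] forms_mult[OF forms_lin, of p d c] by (auto intro: forms_power1)

lemma forms_qf: "qf \<in> forms 2"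
  unfolding qf_def by (intro forms_sum forms_power1 forms_Var)

lemma forms_quartic: "quartic \<in> forms 4"
  unfolding quartic_def by (rule forms_mult_eq[OF forms_power1[OF forms_X] forms_qf]) simp

lemma eval_qf: "eval_at v qf = body v \<bullet>\<^sub>b body v"
  by (simp add: qf_def bil_def power2_eq_square)

lemma quartic_neq_0: "quartic \<noteq> (0 :: 'n::finite option mpoly)"
proof
  obtain j :: 'n where True by simp
  assume "quartic = (0 :: 'n option mpoly)"
  then have "eval_at (pt 1 (axis j 1)) (quartic :: 'n option mpoly) = 0" by simp
  then show False by (simp add: quartic_def eval_qf)
qed

lemma total_degree_quartic: "total_degree (quartic :: 'n::finite option mpoly) = 4"
  by (rule total_degree_forms[OF forms_quartic quartic_neq_0])

lemma dX_product: "diff_act X\<^sub>0 (G * H) = diff_act X\<^sub>0 G * H + G * diff_act X\<^sub>0 H"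
  by (rule diff_act_Var_product)

lemma d_basic:
  "diff_act X\<^sub>0 X\<^sub>0 = 1" "diff_act X\<^sub>0 (lin c) = 0" "diff_act (lin c) X\<^sub>0 = 0"
  "diff_act (lin d) (lin c) = Const (d \<bullet>\<^sub>b c)"
  "diff_act X\<^sub>0 (Const z) = 0" "diff_act (lin c) (Const z) = 0"
  using diff_act_lf_lf[of "pt 1 0" "pt 0 c"] diff_act_lf_lf[of "pt 0 c" "pt 1 0"]
    diff_act_lf_Const[of "pt 1 0" z]
  by (simp_all add: X_lf[symmetric] diff_act_Var_Var diff_act_lf_lf diff_act_lf_Const)

lemma d_one: "diff_act X\<^sub>0 1 = 0" "diff_act (lin c) 1 = 0"
  using d_basic(5,6)[where z = 1] by simp_all

lemma d_qf:
  fixes c :: "complex ^ 'n::finite"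
  shows "diff_act X\<^sub>0 (qf :: 'n option mpoly) = 0" "diff_act (lin c) qf = Const 2 * lin c"
proof -
  have 1: "diff_act X\<^sub>0 (Var (Some j) ^ 2) = 0" for j :: 'n
    unfolding Var_Some_lin power2_eq_square dX_product d_basic by simp
  have 2: "diff_act (lin c) (Var (Some j) ^ 2) = Const 2 * (Const (c $ j) * Var (Some j))" for j
    unfolding Var_Some_lin power2_eq_square diff_act_lf_product d_basic
    by (simp add: algebra_simps)
  show "diff_act X\<^sub>0 (qf :: 'n option mpoly) = 0" by (simp add: qf_def diff_act_sum_right 1)
  show "diff_act (lin c) qf = Const 2 * lin c"
    by (simp only: qf_def diff_act_sum_right 2 sum_distrib_left[symmetric] lin_sum[symmetric])
qed

lemma d_chain:
  "diff_act X\<^sub>0 quartic = Const 2 * (X\<^sub>0 * qf)"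
  "diff_act (lin c) quartic = Const 2 * (X\<^sub>0\<^sup>2 * lin c)"
  "diff_act X\<^sub>0 (X\<^sub>0 * qf) = qf"
  "diff_act (lin c) (X\<^sub>0 * qf) = Const 2 * (X\<^sub>0 * lin c)"
  "diff_act X\<^sub>0 (X\<^sub>0\<^sup>2 * lin c) = Const 2 * (X\<^sub>0 * lin c)"
  "diff_act (lin d) (X\<^sub>0\<^sup>2 * lin c) = Const (d \<bullet>\<^sub>b c) * X\<^sub>0\<^sup>2"
  "diff_act X\<^sub>0 (X\<^sub>0 * lin c) = lin c"
  "diff_act (lin d) (X\<^sub>0 * lin c) = Const (d \<bullet>\<^sub>b c) * X\<^sub>0"
  "diff_act X\<^sub>0 (X\<^sub>0\<^sup>2) = Const 2 * X\<^sub>0"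
  "diff_act (lin c) (X\<^sub>0\<^sup>2) = 0"
  unfolding quartic_def power2_eq_square dX_product diff_act_lf_product d_basic d_qf
  by (simp_all add: algebra_simps)

lemmas d_simps = d_chain d_basic d_one d_qf diff_act_Const_mult_right diff_act_Const_mult_left
  diff_act_add_left diff_act_diff_left diff_act_uminus_left diff_act_sum_left
  diff_act_Const diff_act_zero_right mult_zero_right

text \<open>
  The apolarity condition, in terms of coordinate vectors of points: zero vectors and repeated
  points are permitted, so that it applies directly to the linear forms of a decomposition.
\<close>

definition apolar_vectors :: "(complex ^ 'n::finite option) set \<Rightarrow> bool" where
  "apolar_vectors S \<longleftrightarrow>
     (\<forall>d. \<forall>g\<in>forms d. (\<forall>v\<in>S. eval_at v g = 0) \<longrightarrow> diff_act g quartic = 0)"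

lemma apolar_vectorsD:
  "apolar_vectors S \<Longrightarrow> g \<in> forms d \<Longrightarrow> (\<And>v. v \<in> S \<Longrightarrow> eval_at v g = 0) \<Longrightarrow> diff_act g quartic = 0"
  unfolding apolar_vectors_def by blast

lemma bil_eq_0I:
  assumes "\<And>b. c \<bullet>\<^sub>b b = 0"
  shows "c = 0"
proof -
  have "c $ j = 0" for j using bil_axis(2)[of c j 1] assms[of "axis j 1"] by simp
  then show "c = 0" by (simp add: vec_eq_iff)
qed

text \<open>
  A term \<open>X\<^sup>k M\<close> with \<open>M\<close> a form in the \<open>Y\<^sub>j\<close> sends \<open>x\<^sup>2 (y\<^sub>1\<^sup>2 + \<dots> + y\<^sub>n\<^sup>2)\<close> to \<open>x\<^sup>2\<^sup>-\<^sup>k\<close> times a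
  polynomial in the \<open>y\<^sub>j\<close>, which is zero unless \<open>k \<le> 2\<close> and \<open>M\<close> has degree at most \<open>2\<close>. Different
  \<open>k\<close> give different powers of \<open>x\<close>, so the terms of a form vanishing on apolar vectors can be
  examined one by one.
\<close>

lemma apolar_linear:
  assumes "apolar_vectors S" "\<And>v. v \<in> S \<Longrightarrow> c \<bullet>\<^sub>b body v = 0"
  shows "c = 0"
proof -
  have "diff_act (lin c) quartic = 0"
    by (rule apolar_vectorsD[OF assms(1) forms_lin]) (simp add: assms(2))
  then have "Const 2 * (X\<^sub>0\<^sup>2 * lin c) = 0" by (simp only: d_chain)
  then have "eval_at (pt 1 b) (Const 2 * (X\<^sub>0\<^sup>2 * lin c)) = 0" for b by (simp only: eval_at_zero)
  then show ?thesis by (intro bil_eq_0I) simp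
qed

lemma apolar_quadratic:
  assumes S: "apolar_vectors S"
    and zero: "\<And>v. v \<in> S \<Longrightarrow> (c \<bullet>\<^sub>b body v) * (d \<bullet>\<^sub>b body v) + (t \<bullet>\<^sub>b body v) * (e \<bullet>\<^sub>b body v)
      + v $ None * (f \<bullet>\<^sub>b body v) = 0"
  shows "f = 0" and "c \<bullet>\<^sub>b d + t \<bullet>\<^sub>b e = 0"
proof -
  let ?g = "lin c * lin d + lin t * lin e + X\<^sub>0 * lin f"
  have "?g \<in> forms (Suc 1)" by (intro forms_add forms_products forms_lin)
  then have "diff_act ?g quartic = 0"
    by (rule apolar_vectorsD[OF S]) (simp add: zero)
  then have "Const (2 * (c \<bullet>\<^sub>b d + t \<bullet>\<^sub>b e)) * X\<^sub>0\<^sup>2 + Const 4 * (X\<^sub>0 * lin f) = 0"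
    by (simp only: diff_act_mult d_simps)
      (simp add: Const_mult Const_add algebra_simps)
  then have "eval_at (pt 1 b) (Const (2 * (c \<bullet>\<^sub>b d + t \<bullet>\<^sub>b e)) * X\<^sub>0\<^sup>2 + Const 4 * (X\<^sub>0 * lin f)) = 0" for b
    by (simp only: eval_at_zero)
  then have eq: "2 * (c \<bullet>\<^sub>b d + t \<bullet>\<^sub>b e) + 4 * (f \<bullet>\<^sub>b b) = 0" for b
    by simp
  show 1: "c \<bullet>\<^sub>b d + t \<bullet>\<^sub>b e = 0" using eq[of 0] by (simp add: distrib_left[symmetric] del: distrib_left_numeral)
  show "f = 0" using eq unfolding 1 by (intro bil_eq_0I) simp
qed

lemma apolar_cubic:
  assumes S: "apolar_vectors S"
    and zero: "\<And>v. v \<in> S \<Longrightarrow> (t \<bullet>\<^sub>b body v) * ((c \<bullet>\<^sub>b body v) * (d \<bullet>\<^sub>b body v))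
      + (t \<bullet>\<^sub>b body v)\<^sup>2 * (e \<bullet>\<^sub>b body v) + v $ None * ((t \<bullet>\<^sub>b body v) * (f \<bullet>\<^sub>b body v))
      + (v $ None)\<^sup>2 * (g \<bullet>\<^sub>b body v) = 0"
  shows "g = 0"
proof -
  let ?g = "lin t * (lin c * lin d) + lin t * (lin t * lin e) + X\<^sub>0 * (lin t * lin f) + X\<^sub>0 * (X\<^sub>0 * lin g)"
  have "?g \<in> forms (Suc (Suc 1))"
    by (intro forms_add forms_products forms_lin)
  then have "diff_act ?g quartic = 0"
    by (rule apolar_vectorsD[OF S]) (use zero in \<open>simp add: power2_eq_square mult.assoc\<close>)
  then have "Const (4 * (t \<bullet>\<^sub>b f)) * X\<^sub>0 + Const 4 * lin g = 0"
    by (simp only: diff_act_mult d_simps)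
      (simp add: Const_mult algebra_simps)
  then have "eval_at (pt 0 b) (Const (4 * (t \<bullet>\<^sub>b f)) * X\<^sub>0 + Const 4 * lin g) = 0" for b
    by (simp only: eval_at_zero)
  then show ?thesis by (intro bil_eq_0I) simp
qed


section \<open>The lower bound for the rank\<close>

lemma exists_nonvanishing_functional:
  fixes B :: "(complex ^ 'n::finite) set"
  assumes "finite B" "0 \<notin> B"
  shows "\<exists>t. \<forall>b\<in>B. t \<bullet>\<^sub>b b \<noteq> 0"
  using assms
proof (induction B rule: finite_induct)
  case (insert b B)
  then obtain t where t: "\<forall>b\<in>B. t \<bullet>\<^sub>b b \<noteq> 0" by auto
  show ?case
  proof (cases "t \<bullet>\<^sub>b b = 0")
    case True
    have "b \<noteq> 0" using insert.prems by auto
    then obtain u where u: "u \<bullet>\<^sub>b b \<noteq> 0" using bil_eq_0I by (metis bil_commute)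
    let ?bad = "insert 0 ((\<lambda>b. - (t \<bullet>\<^sub>b b) / (u \<bullet>\<^sub>b b)) ` B)"
    have "finite ?bad" using insert.hyps by simp
    then obtain z where z: "z \<notin> ?bad" using ex_new_if_finite[of ?bad] infinite_UNIV_char_0 by auto
    have "(t + z *s u) \<bullet>\<^sub>b b' \<noteq> 0" if "b' \<in> B" for b'
    proof
      assume 0: "(t + z *s u) \<bullet>\<^sub>b b' = 0"
      then have "u \<bullet>\<^sub>b b' \<noteq> 0" using t that by auto
      with 0 have "z = - (t \<bullet>\<^sub>b b') / (u \<bullet>\<^sub>b b')"
        by (simp add: field_simps eq_neg_iff_add_eq_0)
      with z that show False by blast
    qed
    moreover have "(t + z *s u) \<bullet>\<^sub>b b \<noteq> 0" using True u z by simp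
    ultimately show ?thesis by blast
  qed (use t in auto)
qed simp

text \<open>
  The cubics \<open>t\<^sup>2 a + t X b + X\<^sup>2 c\<close>, where \<open>a\<close>, \<open>b\<close>, \<open>c\<close> and \<open>t\<close> are
  linear forms in the \<open>Y\<^sub>j\<close> and \<open>t\<close> is fixed, all vanish at the apex. If one of them vanishes on
  the other points too, apolarity shows \<open>c = 0\<close>. Then \<open>t\<close>, which has no zero at these points, can be
  cancelled, apolarity of the remaining quadric shows \<open>b = 0\<close>, and cancelling \<open>t\<close> again leaves the
  linear form \<open>a\<close>, which is zero as well.
\<close>

lemma cubics_independent:
  assumes S: "apolar_vectors S"
    and t: "\<And>v. v \<in> S \<Longrightarrow> body v \<noteq> 0 \<Longrightarrow> t \<bullet>\<^sub>b body v \<noteq> 0"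
    and zero: "\<And>v. v \<in> S \<Longrightarrow> body v \<noteq> 0 \<Longrightarrow> (t \<bullet>\<^sub>b body v)\<^sup>2 * (a \<bullet>\<^sub>b body v)
      + v $ None * ((t \<bullet>\<^sub>b body v) * (b \<bullet>\<^sub>b body v)) + (v $ None)\<^sup>2 * (c \<bullet>\<^sub>b body v) = 0"
  shows "a = 0" "b = 0" "c = 0"
proof -
  have all: "v \<in> S \<Longrightarrow> (t \<bullet>\<^sub>b body v)\<^sup>2 * (a \<bullet>\<^sub>b body v)
      + v $ None * ((t \<bullet>\<^sub>b body v) * (b \<bullet>\<^sub>b body v)) + (v $ None)\<^sup>2 * (c \<bullet>\<^sub>b body v) = 0" for v
    using zero[of v] by (cases "body v = 0") simp_all
  show c: "c = 0"
    by (rule apolar_cubic[OF S, of t 0 0 a b]) (use all in simp)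
  have all: "(t \<bullet>\<^sub>b body v) * (a \<bullet>\<^sub>b body v) + v $ None * (b \<bullet>\<^sub>b body v) = 0" if "v \<in> S" for v
  proof (cases "body v = 0")
    case False
    have "(t \<bullet>\<^sub>b body v) * ((t \<bullet>\<^sub>b body v) * (a \<bullet>\<^sub>b body v) + v $ None * (b \<bullet>\<^sub>b body v)) = 0"
      using all[OF that] unfolding c by (simp add: power2_eq_square algebra_simps)
    then show ?thesis using t[OF that False] by simp
  qed simp
  show b: "b = 0"
    by (rule apolar_quadratic(1)[OF S, of 0 0 t a]) (use all in simp)
  have "a \<bullet>\<^sub>b body v = 0" if "v \<in> S" for v
  proof (cases "body v = 0")
    case False
    then show ?thesis using all[OF that] t[OF that] unfolding b by simp
  qed simp
  then show "a = 0" by (rule apolar_linear[OF S])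
qed

text \<open>
  The functions \<open>t\<^sup>2 Y\<^sub>j\<close>, \<open>t X Y\<^sub>j\<close> and \<open>X\<^sup>2 Y\<^sub>j\<close> on coordinate vectors, which span the space of cubics
  above; there are \<open>3 n\<close> of them.
\<close>

definition cubic_coord :: "complex ^ 'n::finite \<Rightarrow> complex ^ 'n option \<Rightarrow> 'n \<times> nat \<Rightarrow> complex" where
  "cubic_coord t v = (\<lambda>(j, k). (t \<bullet>\<^sub>b body v) ^ (2 - k) * (v $ None) ^ k * v $ Some j)"

lemma sum_cubic_coord:
  "(\<Sum>k\<in>UNIV \<times> {..<3}. c k * cubic_coord t v k) =
    (t \<bullet>\<^sub>b body v)\<^sup>2 * ((\<chi> j. c (j, 0)) \<bullet>\<^sub>b body v)
    + v $ None * ((t \<bullet>\<^sub>b body v) * ((\<chi> j. c (j, 1)) \<bullet>\<^sub>b body v))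
    + (v $ None)\<^sup>2 * ((\<chi> j. c (j, 2)) \<bullet>\<^sub>b body v)"
proof -
  have "(\<Sum>k\<in>UNIV \<times> {..<3}. c k * cubic_coord t v k) =
      (\<Sum>j\<in>UNIV. \<Sum>k<3. c (j, k) * cubic_coord t v (j, k))"
    by (simp add: sum.cartesian_product)
  also have "\<dots> = (\<Sum>j\<in>UNIV. (t \<bullet>\<^sub>b body v)\<^sup>2 * (c (j, 0) * v $ Some j)
      + v $ None * ((t \<bullet>\<^sub>b body v) * (c (j, 1) * v $ Some j))
      + (v $ None)\<^sup>2 * (c (j, 2) * v $ Some j))"
    by (intro sum.cong) (simp_all add: cubic_coord_def numeral_3_eq_3 numeral_2_eq_2 algebra_simps)
  finally show ?thesis
    by (simp add: sum.distrib sum_distrib_left[symmetric] bil_def)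
qed

lemma cubic_coord_independent:
  assumes S: "apolar_vectors S"
    and t: "\<And>v. v \<in> S \<Longrightarrow> body v \<noteq> 0 \<Longrightarrow> t \<bullet>\<^sub>b body v \<noteq> 0"
    and zero: "\<forall>v\<in>{v \<in> S. body v \<noteq> 0}. (\<Sum>k\<in>UNIV \<times> {..<3}. c k * cubic_coord t v k) = 0"
  shows "\<forall>k\<in>UNIV \<times> {..<3}. c k = 0"
proof -
  have zero': "(t \<bullet>\<^sub>b body v)\<^sup>2 * ((\<chi> j. c (j, 0)) \<bullet>\<^sub>b body v)
    + v $ None * ((t \<bullet>\<^sub>b body v) * ((\<chi> j. c (j, 1)) \<bullet>\<^sub>b body v))
    + (v $ None)\<^sup>2 * ((\<chi> j. c (j, 2)) \<bullet>\<^sub>b body v) = 0" if "v \<in> S" "body v \<noteq> 0" for v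
    using bspec[OF zero, of v] that unfolding sum_cubic_coord by blast
  note z = cubics_independent[OF S t zero']
  have "c (j, 0) = 0 \<and> c (j, 1) = 0 \<and> c (j, 2) = 0" for j
    using z(1)[THEN arg_cong[where f = "\<lambda>x. x $ j"]] z(2)[THEN arg_cong[where f = "\<lambda>x. x $ j"]]
      z(3)[THEN arg_cong[where f = "\<lambda>x. x $ j"]] by simp
  then show ?thesis by (auto simp: numeral_3_eq_3 numeral_2_eq_2 less_Suc_eq)
qed

lemma apolar_card_lower_bound:
  fixes S :: "(complex ^ 'n::finite option) set"
  assumes S: "apolar_vectors S" and fin: "finite S"
  shows "3 * CARD('n) \<le> card {v \<in> S. body v \<noteq> 0}"
proof (rule ccontr)
  let ?I = "UNIV \<times> {..<3} :: ('n \<times> nat) set"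
  have "0 \<notin> body ` {v \<in> S. body v \<noteq> 0}" by auto
  then obtain t where t: "\<And>v. v \<in> S \<Longrightarrow> body v \<noteq> 0 \<Longrightarrow> t \<bullet>\<^sub>b body v \<noteq> 0"
    using exists_nonvanishing_functional[of "body ` {v \<in> S. body v \<noteq> 0}"] fin by auto
  assume "\<not> 3 * CARD('n) \<le> card {v \<in> S. body v \<noteq> 0}"
  then have "card {v \<in> S. body v \<noteq> 0} < card ?I" by (simp add: card_cartesian_product)
  then obtain c where "\<exists>k\<in>?I. c k \<noteq> 0"
    "\<forall>v\<in>{v \<in> S. body v \<noteq> 0}. (\<Sum>k\<in>?I. c k * cubic_coord t v k) = 0"
    using underdetermined_system[of "{v \<in> S. body v \<noteq> 0}" ?I "cubic_coord t"] fin by auto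
  with cubic_coord_independent[OF S t] show False by blast
qed

section \<open>The structure of minimal apolar sets\<close>

lemma apolar_vectors_rescale:
  assumes S: "apolar_vectors S" and scale: "\<And>v. v \<in> S \<Longrightarrow> \<exists>c. \<exists>w\<in>S'. v = c *s w"
  shows "apolar_vectors S'"
  unfolding apolar_vectors_def
proof (intro allI ballI impI)
  fix d and g :: "'a option mpoly"
  assume g: "g \<in> forms d" and zero: "\<forall>v\<in>S'. eval_at v g = 0"
  have "eval_at v g = 0" if "v \<in> S" for v
    using scale[OF that] zero by (auto simp: eval_at_scale[OF g])
  then show "diff_act g quartic = 0" by (rule apolar_vectorsD[OF S g])
qed

text \<open>
  Equality in the lower bound means that the cubics of the previous section take all values on
  \<open>S\<close>. Expressing \<open>t\<close> times a product of two linear forms through them and reading off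
  coefficients leaves only \<open>t\<^sup>2 A\<close>. So, after normalising \<open>t\<close> to \<open>1\<close> on \<open>S\<close>, the restrictions of
  linear forms in the \<open>Y\<^sub>j\<close> are closed under multiplication.
\<close>

lemma linear_functions_closed_under_product:
  fixes S :: "(complex ^ 'n::finite option) set"
  assumes S: "apolar_vectors S" and fin: "finite S" and card: "card S \<le> 3 * CARD('n)"
    and t: "\<And>v. v \<in> S \<Longrightarrow> t \<bullet>\<^sub>b body v = 1"
  shows "\<exists>e. \<forall>v\<in>S. (c \<bullet>\<^sub>b body v) * (d \<bullet>\<^sub>b body v) = e \<bullet>\<^sub>b body v"
proof -
  let ?I = "UNIV \<times> {..<3} :: ('n \<times> nat) set"
  let ?f = "\<lambda>v. (c \<bullet>\<^sub>b body v) * (d \<bullet>\<^sub>b body v)"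
  have t0: "v \<in> S \<Longrightarrow> t \<bullet>\<^sub>b body v \<noteq> 0" for v using t by simp
  have "{v \<in> S. body v \<noteq> 0} = S" using t by fastforce
  then have indep: "\<forall>v\<in>S. (\<Sum>k\<in>?I. c k * cubic_coord t v k) = 0 \<Longrightarrow> \<forall>k\<in>?I. c k = 0" for c
    using cubic_coord_independent[OF S t0, of c] by simp
  have cardI: "card S \<le> card ?I" using card by (simp add: card_cartesian_product)
  have "finite ?I" by simp
  then obtain z where z: "\<forall>v\<in>S. ?f v = (\<Sum>k\<in>?I. z k * cubic_coord t v k)"
    using independent_functions_interpolate[OF fin _ cardI indep, where f = ?f] by blast
  define p q r :: "complex ^ 'n"
    where "p = (\<chi> j. z (j, 0))" and "q = (\<chi> j. z (j, 1))" and "r = (\<chi> j. z (j, 2))"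
  have eq: "?f v = p \<bullet>\<^sub>b body v + v $ None * (q \<bullet>\<^sub>b body v) + (v $ None)\<^sup>2 * (r \<bullet>\<^sub>b body v)"
    if "v \<in> S" for v
    using bspec[OF z that] t[OF that] unfolding sum_cubic_coord p_def q_def r_def by simp
  have "- r = 0"
    by (rule apolar_cubic[OF S, of t c d "- p" "- q"]) (simp add: t eq)
  then have r: "r = 0" by simp
  have "- q = 0"
    by (rule apolar_quadratic(1)[OF S, of c d t "- p"]) (simp add: t eq r)
  then show ?thesis using eq r by (intro exI[of _ p]) simp
qed

text \<open>
  These functions also separate the points of the projection, so they contain the indicator
  function of each point.
\<close>

lemma linear_indicator:
  assumes D: "finite D" "b\<^sub>0 \<in> D" and t: "\<And>b. b \<in> D \<Longrightarrow> t \<bullet>\<^sub>b b = 1"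
    and closed: "\<And>c d. \<exists>e. \<forall>b\<in>D. (c \<bullet>\<^sub>b b) * (d \<bullet>\<^sub>b b) = e \<bullet>\<^sub>b b"
  shows "\<exists>c. \<forall>b\<in>D. c \<bullet>\<^sub>b b = (if b = b\<^sub>0 then 1 else 0)"
proof -
  have "\<exists>c. c \<bullet>\<^sub>b b\<^sub>0 = 1 \<and> (\<forall>b\<in>E. c \<bullet>\<^sub>b b = 0)" if "finite E" "E \<subseteq> D - {b\<^sub>0}" for E
    using that
  proof (induction E rule: finite_induct)
    case empty
    then show ?case using t[OF D(2)] by auto
  next
    case (insert b E)
    then obtain c where c: "c \<bullet>\<^sub>b b\<^sub>0 = 1" "\<forall>b\<in>E. c \<bullet>\<^sub>b b = 0" by auto
    from insert.prems have b: "b \<in> D" "b \<noteq> b\<^sub>0" by auto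
    then obtain i where i: "b\<^sub>0 $ i - b $ i \<noteq> 0" by (metis eq_iff_diff_eq_0 vec_eq_iff)
    define u where "u = (1 / (b\<^sub>0 $ i - b $ i)) *s (axis i 1 - b $ i *s t)"
    have "u \<bullet>\<^sub>b b = 0" using t[OF b(1)] by (simp add: u_def)
    moreover have "u \<bullet>\<^sub>b b\<^sub>0 = 1" using t[OF D(2)] i by (simp add: u_def diff_divide_distrib[symmetric])
    moreover obtain e where "\<forall>b\<in>D. (c \<bullet>\<^sub>b b) * (u \<bullet>\<^sub>b b) = e \<bullet>\<^sub>b b" using closed by blast
    ultimately have "e \<bullet>\<^sub>b b\<^sub>0 = 1 \<and> (\<forall>b\<in>insert b E. e \<bullet>\<^sub>b b = 0)"
      using c b D(2) insert.prems
      by (metis Diff_iff insert_iff mult_1 mult_zero_left mult_zero_right subset_iff)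
    then show ?case by blast
  qed
  from this[of "D - {b\<^sub>0}"] D show ?thesis by auto
qed

definition orthonormal :: "('n::finite \<Rightarrow> complex ^ 'n) \<Rightarrow> bool" where
  "orthonormal A \<longleftrightarrow> (\<forall>i j. A i \<bullet>\<^sub>b A j = (if i = j then 1 else 0))"

lemma orthonormalD: "orthonormal A \<Longrightarrow> A i \<bullet>\<^sub>b A j = (if i = j then 1 else 0)"
  by (simp add: orthonormal_def)

text \<open>
  The projected points are therefore a basis of \<open>\<complex>\<^sup>n\<close>, with the indicator functions as dual
  basis. Products of distinct indicators are quadrics through the points, and apolarity of such a
  quadric says that its two factors are orthogonal. A basis whose dual basis is orthogonal is
  orthogonal itself, and nondegeneracy of the pairing excludes isotropic members.
\<close>

lemma projected_points_orthonormal: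
  fixes S :: "(complex ^ 'n::finite option) set"
  assumes S: "apolar_vectors S" and fin: "finite S" and card: "card S \<le> 3 * CARD('n)"
    and t: "\<And>v. v \<in> S \<Longrightarrow> t \<bullet>\<^sub>b body v = 1"
  shows "\<exists>A. orthonormal A \<and> (\<forall>v\<in>S. \<exists>j r. r \<noteq> 0 \<and> body v = r *s A j)"
proof -
  define D where "D = body ` S"
  have finD: "finite D" using fin by (simp add: D_def)
  have tD: "b \<in> D \<Longrightarrow> t \<bullet>\<^sub>b b = 1" for b using t by (auto simp: D_def)
  have closed: "\<exists>e. \<forall>b\<in>D. (c \<bullet>\<^sub>b b) * (d \<bullet>\<^sub>b b) = e \<bullet>\<^sub>b b" for c d
    using linear_functions_closed_under_product[OF S fin card t, of c d] by (auto simp: D_def)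
  have "\<forall>b\<^sub>0\<in>D. \<exists>c. \<forall>b\<in>D. c \<bullet>\<^sub>b b = (if b = b\<^sub>0 then 1 else 0)"
    using linear_indicator[OF finD _ tD closed] by blast
  from bchoice[OF this] obtain ind
    where ind: "b\<^sub>0 \<in> D \<Longrightarrow> b \<in> D \<Longrightarrow> ind b\<^sub>0 \<bullet>\<^sub>b b = (if b = b\<^sub>0 then 1 else 0)" for b\<^sub>0 b
    by blast
  have zero: "c = 0" if "\<And>b. b \<in> D \<Longrightarrow> c \<bullet>\<^sub>b b = 0" for c
    by (rule apolar_linear[OF S]) (use that in \<open>simp add: D_def\<close>)
  have "\<not> card D < CARD('n)"
  proof
    assume "card D < CARD('n)"
    then obtain c where c: "\<exists>j::'n. c j \<noteq> 0" "\<forall>b\<in>D. (\<Sum>j\<in>UNIV. c j * b $ j) = 0"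
      using underdetermined_system[of D "UNIV :: 'n set" "\<lambda>b j. b $ j"] finD by auto
    then have "(\<chi> j. c j) = 0" by (intro zero) (simp add: bil_def)
    with c(1) show False by (simp add: vec_eq_iff)
  qed
  moreover have "\<not> CARD('n) < card D"
  proof
    assume "CARD('n) < card D"
    then obtain c where c: "\<exists>b\<in>D. c b \<noteq> 0" "\<forall>j::'n. (\<Sum>b\<in>D. c b * b $ j) = 0"
      using underdetermined_system[of "UNIV :: 'n set" D "\<lambda>j b. b $ j"] finD by auto
    have "(\<Sum>b\<in>D. c b *s b) = 0" using c(2) by (simp add: vec_eq_iff)
    have "c b\<^sub>0 = 0" if "b\<^sub>0 \<in> D" for b\<^sub>0
    proof -
      have "0 = ind b\<^sub>0 \<bullet>\<^sub>b (\<Sum>b\<in>D. c b *s b)"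
        unfolding \<open>(\<Sum>b\<in>D. c b *s b) = 0\<close> by simp
      also have "\<dots> = (\<Sum>b\<in>D. c b * (ind b\<^sub>0 \<bullet>\<^sub>b b))"
        by (simp add: bil_commute[of "ind b\<^sub>0"] bil_sum_left)
      also have "\<dots> = (\<Sum>b\<in>D. if b = b\<^sub>0 then c b else 0)"
        using ind[OF that] by (intro sum.cong) auto
      finally show ?thesis using that finD by simp
    qed
    with c(1) show False by blast
  qed
  ultimately have "card D = card (UNIV :: 'n set)" by simp
  then obtain \<delta> :: "'n \<Rightarrow> complex ^ 'n" where \<delta>: "bij_betw \<delta> UNIV D"
    using finD finite_same_card_bij[of "UNIV :: 'n set" D] by auto
  have \<delta>D: "\<delta> i \<in> D" for i using \<delta> by (auto simp: bij_betw_def)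
  have \<delta>_inj: "\<delta> i = \<delta> j \<longleftrightarrow> i = j" for i j using \<delta> by (auto simp: bij_betw_def inj_on_eq_iff)
  define c where "c i = ind (\<delta> i)" for i
  have dual: "c i \<bullet>\<^sub>b \<delta> j = (if i = j then 1 else 0)" for i j
    using ind[OF \<delta>D \<delta>D] by (auto simp: c_def \<delta>_inj)
  have orth: "c i \<bullet>\<^sub>b c j = 0" if "i \<noteq> j" for i j
  proof -
    have "c i \<bullet>\<^sub>b b * (c j \<bullet>\<^sub>b b) = 0" if b: "b \<in> D" for b
    proof -
      obtain k where "b = \<delta> k" using b \<delta> by (auto simp: bij_betw_def)
      then show ?thesis using \<open>i \<noteq> j\<close> by (auto simp: dual)
    qed
    then have "c i \<bullet>\<^sub>b c j + 0 \<bullet>\<^sub>b (0 :: complex ^ 'n) = 0"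
      by (intro apolar_quadratic(2)[OF S, of _ _ _ _ 0]) (simp add: D_def)
    then show ?thesis by simp
  qed
  have expand: "u = (\<Sum>i\<in>UNIV. (u \<bullet>\<^sub>b \<delta> i) *s c i)" for u
  proof -
    have "u - (\<Sum>i\<in>UNIV. (u \<bullet>\<^sub>b \<delta> i) *s c i) = 0"
    proof (rule zero)
      fix b assume "b \<in> D"
      then obtain k where b: "b = \<delta> k" using \<delta> by (auto simp: bij_betw_def)
      have "(\<Sum>i\<in>UNIV. (u \<bullet>\<^sub>b \<delta> i) * (c i \<bullet>\<^sub>b \<delta> k)) = (\<Sum>i\<in>UNIV. if i = k then u \<bullet>\<^sub>b \<delta> k else 0)"
        by (intro sum.cong) (auto simp: dual)
      then show "(u - (\<Sum>i\<in>UNIV. (u \<bullet>\<^sub>b \<delta> i) *s c i)) \<bullet>\<^sub>b b = 0"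
        by (simp add: bil_sum_left b)
    qed
    then show ?thesis by simp
  qed
  have pair: "c i \<bullet>\<^sub>b u = (c i \<bullet>\<^sub>b c i) * (\<delta> i \<bullet>\<^sub>b u)" for i u
  proof -
    have "c i \<bullet>\<^sub>b u = (\<Sum>k\<in>UNIV. (u \<bullet>\<^sub>b \<delta> k) *s c k) \<bullet>\<^sub>b c i"
      by (subst expand[of u]) (rule bil_commute)
    also have "\<dots> = (\<Sum>k\<in>UNIV. if k = i then (u \<bullet>\<^sub>b \<delta> i) * (c i \<bullet>\<^sub>b c i) else 0)"
      unfolding bil_sum_left by (intro sum.cong) (auto simp: orth)
    finally show ?thesis by (simp add: bil_commute mult.commute)
  qed
  have nonzero: "c i \<bullet>\<^sub>b c i \<noteq> 0" for i
  proof
    assume "c i \<bullet>\<^sub>b c i = 0"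
    then show False using pair[of i "\<delta> i"] dual[of i i] by simp
  qed
  define \<rho> where "\<rho> i = csqrt (c i \<bullet>\<^sub>b c i)" for i
  have \<rho>: "\<rho> i \<noteq> 0" "\<rho> i * \<rho> i = c i \<bullet>\<^sub>b c i" for i
    using nonzero[of i] power2_csqrt[of "c i \<bullet>\<^sub>b c i"] by (auto simp: \<rho>_def power2_eq_square)
  define A where "A i = (1 / \<rho> i) *s c i" for i
  have "orthonormal A"
    unfolding orthonormal_def
  proof (intro allI)
    fix i j
    show "A i \<bullet>\<^sub>b A j = (if i = j then 1 else 0)"
      using \<rho>[of i] by (cases "i = j") (simp_all add: A_def orth \<rho>(2)[symmetric])
  qed
  moreover have "\<exists>j r. r \<noteq> 0 \<and> body v = r *s A j" if "v \<in> S" for v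
  proof -
    have "body v \<in> D" using that by (simp add: D_def)
    then obtain j where j: "body v = \<delta> j" using \<delta> by (auto simp: bij_betw_def)
    have "c j - (c j \<bullet>\<^sub>b c j) *s \<delta> j = 0"
    proof (rule bil_eq_0I)
      fix u show "(c j - (c j \<bullet>\<^sub>b c j) *s \<delta> j) \<bullet>\<^sub>b u = 0" using pair[of j u] by simp
    qed
    then have "c j = (\<rho> j * \<rho> j) *s \<delta> j" by (simp add: \<rho>)
    then have "body v = (1 / \<rho> j) *s A j"
      using \<rho>(1)[of j] by (simp add: A_def j vec_eq_iff)
    then show ?thesis using \<rho>(1)[of j] by (intro exI[of _ j] exI[of _ "1 / \<rho> j"]) simp
  qed
  ultimately show ?thesis by blast
qed

text \<open>
  Each point other than the apex on the line joining the apex to \<open>[0 : A\<^sub>j]\<close> is \<open>[a : A\<^sub>j]\<close> for a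
  unique \<open>a\<close>; so \<open>V j\<close> describes a set of points on that line.
\<close>

definition line_points :: "('n::finite \<Rightarrow> complex ^ 'n) \<Rightarrow> ('n \<Rightarrow> complex set) \<Rightarrow> (complex ^ 'n option) set" where
  "line_points A V = (\<lambda>(j, a). pt a (A j)) ` (SIGMA j:UNIV. V j)"

lemma line_points_iff: "v \<in> line_points A V \<longleftrightarrow> (\<exists>j a. v = pt a (A j) \<and> a \<in> V j)"
  by (auto simp: line_points_def)

lemma span_eq_span_singleton_scale:
  fixes v :: "complex ^ 'v::finite"
  shows "c \<noteq> 0 \<Longrightarrow> vec.span {c *s v} = vec.span {v}"
proof -
  assume c: "c \<noteq> 0"
  have "\<exists>l. k *s v = l *s (c *s v)" for k
    using c by (intro exI[of _ "k / c"]) (simp add: vec_eq_iff)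
  moreover have "\<exists>l. k *s (c *s v) = l *s v" for k
    by (intro exI[of _ "k * c"]) (simp add: vec_eq_iff)
  ultimately show ?thesis by (auto simp: vec.span_singleton image_iff)
qed

lemma span_pt_eq_iff:
  assumes A: "orthonormal A"
  shows "vec.span {pt a (A i)} = vec.span {pt b (A j)} \<longleftrightarrow> i = j \<and> a = b"
proof
  assume "vec.span {pt a (A i)} = vec.span {pt b (A j)}"
  then have "pt a (A i) \<in> vec.span {pt b (A j)}" by (metis vec.span_base singletonI)
  then obtain c where "pt a (A i) = c *s pt b (A j)" by (auto simp: vec.span_singleton)
  then have a: "a = c * b" and Ai: "A i = c *s A j" by (simp_all add: pt_scale pt_eq_iff)
  have "A i \<bullet>\<^sub>b A i = c * (A i \<bullet>\<^sub>b A j)" by (metis Ai bil_simps(10))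
  then have "i = j \<and> c = 1" using orthonormalD[OF A] by (auto split: if_splits)
  with a show "i = j \<and> a = b" by simp
qed simp

lemma pt_orthonormal_nonzero: "orthonormal A \<Longrightarrow> pt a (A j) \<noteq> 0"
proof
  assume A: "orthonormal A" and 0: "pt a (A j) = 0"
  have "A j = body (pt a (A j))" by simp
  also have "\<dots> = 0" unfolding 0 by (simp add: vec_eq_iff)
  finally show False using orthonormalD[OF A, of j j] by simp
qed

text \<open>
  The monic cubic with roots \<open>V\<close> has no quadratic term, and Newton's identities express its other
  coefficients by power sums, which, unlike the elementary symmetric functions, need no ordering of
  the roots.
\<close>

lemma cube_of_root:
  fixes V :: "complex set"
  assumes "card V = 3" "\<Sum>V = 0" "a \<in> V"
  shows "a ^ 3 = (\<Sum>z\<in>V. z\<^sup>2) / 2 * a + (\<Sum>z\<in>V. z ^ 3) / 3"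
proof -
  obtain x y z where V: "V = {x, y, z}" "x \<noteq> y" "x \<noteq> z" "y \<noteq> z"
    using assms(1) by (metis card_3_iff)
  then have z: "z = - x - y" using assms(2) by (simp add: eq_neg_iff_add_eq_0 algebra_simps)
  have "(\<Sum>z\<in>V. z\<^sup>2) / 2 = x\<^sup>2 + x * y + y\<^sup>2"
    using V by (simp add: power2_eq_square, simp add: z algebra_simps)
  moreover have "(\<Sum>z\<in>V. z ^ 3) / 3 = - (x * y * (x + y))"
    using V by (simp add: power3_eq_cube, simp add: z algebra_simps)
  moreover have "a = x \<or> a = y \<or> a = - x - y" using assms(3) V(1) z by simp
  then have "a ^ 3 = (x\<^sup>2 + x * y + y\<^sup>2) * a + - (x * y * (x + y))"
    by (elim disjE; simp only:; simp add: power2_eq_square power3_eq_cube algebra_simps)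
  ultimately show ?thesis by simp
qed

text \<open>
  The normal form of minimal apolar sets. The last condition says that the linear coefficients of
  the \<open>n\<close> cubics with root sets \<open>V j\<close> have sum zero.
\<close>

definition config :: "('n::finite \<Rightarrow> complex ^ 'n) \<Rightarrow> ('n \<Rightarrow> complex set) \<Rightarrow> bool" where
  "config A V \<longleftrightarrow> orthonormal A \<and> (\<forall>j. card (V j) = 3 \<and> \<Sum>(V j) = 0) \<and>
     (\<Sum>j\<in>UNIV. \<Sum>a\<in>V j. a\<^sup>2) = 0"

lemma configD:
  assumes "config A V"
  shows "orthonormal A" "card (V j) = 3" "\<Sum>(V j) = 0" "(\<Sum>j\<in>UNIV. \<Sum>a\<in>V j. a\<^sup>2) = 0" "finite (V j)"
  using assms by (auto simp: config_def intro: card_ge_0_finite)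

text \<open>
  If the three numbers in each \<open>V j\<close> have sum zero, then this form restricts, on the line of \<open>A\<^sub>j\<close>,
  to the cubic with root set \<open>V j\<close>: the \<open>n\<close> cubics share the term \<open>X\<^sup>3\<close> and fit together.
\<close>

definition cubic_gen :: "('n::finite \<Rightarrow> complex ^ 'n) \<Rightarrow> ('n \<Rightarrow> complex set) \<Rightarrow> 'n option mpoly" where
  "cubic_gen A V = X\<^sub>0 * (X\<^sub>0 * X\<^sub>0) - (\<Sum>j\<in>UNIV. Const ((\<Sum>a\<in>V j. a\<^sup>2) / 2) * (X\<^sub>0 * (lin (A j) * lin (A j)))
     + Const ((\<Sum>a\<in>V j. a ^ 3) / 3) * (lin (A j) * (lin (A j) * lin (A j))))"

lemma forms_cubic_gen: "cubic_gen A V \<in> forms 3"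
proof -
  have "cubic_gen A V \<in> forms (Suc (Suc 1))"
    unfolding cubic_gen_def
    by (intro forms_diff forms_sum forms_add forms_Const_mult forms_products forms_lin forms_X)
  then show ?thesis by (simp add: numeral_3_eq_3)
qed

lemma eval_cubic_gen:
  assumes A: "orthonormal A"
  shows "eval_at (pt a (A l)) (cubic_gen A V) =
    a ^ 3 - ((\<Sum>z\<in>V l. z\<^sup>2) / 2 * a + (\<Sum>z\<in>V l. z ^ 3) / 3)"
proof -
  have "(\<Sum>j\<in>UNIV. eval_at (pt a (A l)) (Const ((\<Sum>a\<in>V j. a\<^sup>2) / 2) * (X\<^sub>0 * (lin (A j) * lin (A j)))
      + Const ((\<Sum>a\<in>V j. a ^ 3) / 3) * (lin (A j) * (lin (A j) * lin (A j)))))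
      = (\<Sum>j\<in>UNIV. if j = l then (\<Sum>z\<in>V l. z\<^sup>2) / 2 * a + (\<Sum>z\<in>V l. z ^ 3) / 3 else 0)"
    by (intro sum.cong) (auto simp: orthonormalD[OF A])
  then show ?thesis
    unfolding cubic_gen_def eval_at_diff eval_at_sum by (simp add: power3_eq_cube)
qed

text \<open>
  On each of the \<open>n\<close> lines there must be at least three points, since \<open>A\<^sub>j\<close> times a quadric
  \<open>(X - a\<^sub>1 A\<^sub>j) (X - a\<^sub>2 A\<^sub>j)\<close> through two points of a line contains the term \<open>X\<^sup>2 A\<^sub>j\<close>, which
  \<open>apolar_cubic\<close> excludes; so there are exactly three. That their coordinates have sum zero comes from the quartic
  \<open>A\<^sub>j (X - a\<^sub>1 A\<^sub>j) (X - a\<^sub>2 A\<^sub>j) (X - a\<^sub>3 A\<^sub>j)\<close>, and the condition on the squares from \<open>cubic_gen\<close>.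
\<close>

lemma minimal_apolar_vectors_config:
  fixes S :: "(complex ^ 'n::finite option) set"
  assumes S: "apolar_vectors S" and fin: "finite S" and card: "card S \<le> 3 * CARD('n)"
  shows "\<exists>A V. config A V \<and> (\<lambda>v. vec.span {v}) ` S = (\<lambda>v. vec.span {v}) ` line_points A V"
proof -
  have "3 * CARD('n) \<le> card {v \<in> S. body v \<noteq> 0}" by (rule apolar_card_lower_bound[OF S fin])
  then have "card S \<le> card {v \<in> S. body v \<noteq> 0}" using card by simp
  then have "{v \<in> S. body v \<noteq> 0} = S" using fin by (intro card_seteq) auto
  then have body: "v \<in> S \<Longrightarrow> body v \<noteq> 0" for v by blast
  then obtain t where t: "\<And>v. v \<in> S \<Longrightarrow> t \<bullet>\<^sub>b body v \<noteq> 0"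
    using exists_nonvanishing_functional[of "body ` S"] fin by force
  define f where "f v = 1 / (t \<bullet>\<^sub>b body v)" for v
  define S' where "S' = (\<lambda>v. f v *s v) ` S"
  have f: "v \<in> S \<Longrightarrow> f v \<noteq> 0" for v using t by (simp add: f_def)
  have S': "apolar_vectors S'"
  proof (rule apolar_vectors_rescale[OF S])
    fix v assume v: "v \<in> S"
    then have "v = (1 / f v) *s (f v *s v)" using f by (simp add: vec_eq_iff)
    then show "\<exists>c. \<exists>w\<in>S'. v = c *s w" using v unfolding S'_def by blast
  qed
  have "card S' \<le> 3 * CARD('n)" "finite S'"
    using card fin card_image_le[OF fin, of "\<lambda>v. f v *s v"] unfolding S'_def by auto
  moreover have "t \<bullet>\<^sub>b body v = 1" if "v \<in> S'" for v
    using that t by (auto simp: S'_def f_def)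
  ultimately obtain A where A: "orthonormal A" and "\<forall>v\<in>S'. \<exists>j r. r \<noteq> 0 \<and> body v = r *s A j"
    using projected_points_orthonormal[OF S'] by metis
  then have on_lines: "\<exists>j r. r \<noteq> 0 \<and> f v *s body v = r *s A j" if "v \<in> S" for v
    using that by (auto simp: S'_def)
  define V where "V j = {a. vec.span {pt a (A j)} \<in> (\<lambda>v. vec.span {v}) ` S}" for j
  have repr: "\<exists>r j a. r \<noteq> 0 \<and> a \<in> V j \<and> v = r *s pt a (A j)" if v: "v \<in> S" for v
  proof -
    obtain j r where r: "r \<noteq> 0" "f v *s body v = r *s A j" using on_lines[OF v] by blast
    have "body v = (r / f v) *s A j" using r(2) f[OF v]
      by (simp add: vec_eq_iff field_simps)
    then have eq: "v = (r / f v) *s pt (v $ None / (r / f v)) (A j)"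
      using r(1) f[OF v] pt_body[of v] by (simp add: pt_scale)
    have "vec.span {v} = vec.span {pt (v $ None / (r / f v)) (A j)}"
      by (subst eq) (rule span_eq_span_singleton_scale, use r f[OF v] in simp)
    then have "v $ None / (r / f v) \<in> V j" using v unfolding V_def by blast
    moreover have "r / f v \<noteq> 0" using r f[OF v] by simp
    ultimately show ?thesis using eq by blast
  qed
  have spans: "(\<lambda>v. vec.span {v}) ` S = (\<lambda>v. vec.span {v}) ` line_points A V"
  proof (intro equalityI subsetI)
    fix p assume "p \<in> (\<lambda>v. vec.span {v}) ` S"
    then obtain v where v: "v \<in> S" "p = vec.span {v}" by blast
    then obtain r j a where "r \<noteq> 0" "a \<in> V j" "v = r *s pt a (A j)" using repr by blast
    then have "p = vec.span {pt a (A j)}" "pt a (A j) \<in> line_points A V"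
      unfolding v(2) by (auto simp: line_points_iff span_eq_span_singleton_scale)
    then show "p \<in> (\<lambda>v. vec.span {v}) ` line_points A V" by blast
  next
    fix p assume "p \<in> (\<lambda>v. vec.span {v}) ` line_points A V"
    then show "p \<in> (\<lambda>v. vec.span {v}) ` S"
      by (auto simp: line_points_def V_def)
  qed
  have apolar: "apolar_vectors (line_points A V)"
  proof (rule apolar_vectors_rescale[OF S])
    fix v assume "v \<in> S"
    then obtain r j a where "a \<in> V j" "v = r *s pt a (A j)" using repr[of v] by auto
    then show "\<exists>c. \<exists>w\<in>line_points A V. v = c *s w"
      by (intro exI[of _ r] bexI[of _ "pt a (A j)"]) (auto simp: line_points_iff)
  qed
  have inj: "inj_on (\<lambda>(j, a). vec.span {pt a (A j)}) (SIGMA j:UNIV. V j)"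
    by (auto simp: inj_on_def span_pt_eq_iff[OF A])
  have image: "(\<lambda>(j, a). vec.span {pt a (A j)}) ` (SIGMA j:UNIV. V j) = (\<lambda>v. vec.span {v}) ` S"
    unfolding spans line_points_def image_image by (intro image_cong) auto
  have finSig: "finite (SIGMA j:UNIV. V j)"
    using inj fin by (metis finite_imageD finite_imageI image)
  have finV: "finite (V j)" for j
    by (rule finite_subset[OF _ finite_imageI[OF finSig, of snd]]) force
  have three: "3 \<le> card (V j)" for j
  proof (rule ccontr)
    assume "\<not> 3 \<le> card (V j)"
    then have "card (V j) \<le> 2" by simp
    then obtain x y where xy: "V j \<subseteq> {x, y}"
    proof -
      have "card (V j) = 0 \<or> card (V j) = 1 \<or> card (V j) = 2" using \<open>card (V j) \<le> 2\<close> by linarith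
      then show thesis
        using that finV[of j] by (auto simp: card_1_singleton_iff card_2_iff)
    qed
    have "A j = 0"
    proof (rule apolar_cubic[OF apolar, of "A j" 0 0 "(x * y) *s A j" "- (x + y) *s A j"])
      fix v assume "v \<in> line_points A V"
      then obtain l a where v: "v = pt a (A l)" "a \<in> V l" by (auto simp: line_points_iff)
      show "(A j \<bullet>\<^sub>b body v) * (0 \<bullet>\<^sub>b body v * (0 \<bullet>\<^sub>b body v)) +
          (A j \<bullet>\<^sub>b body v)\<^sup>2 * (((x * y) *s A j) \<bullet>\<^sub>b body v) +
          v $ None * (A j \<bullet>\<^sub>b body v * ((- (x + y) *s A j) \<bullet>\<^sub>b body v)) +
          (v $ None)\<^sup>2 * (A j \<bullet>\<^sub>b body v) = 0"
      proof (cases "l = j")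
        case True
        then have "a = x \<or> a = y" using v xy by auto
        then show ?thesis using True
          by (auto simp: v orthonormalD[OF A] power2_eq_square algebra_simps)
      qed (simp add: v orthonormalD[OF A])
    qed
    then show False using orthonormalD[OF A, of j j] by simp
  qed
  have "(\<Sum>j\<in>UNIV. card (V j)) = card (SIGMA j:UNIV. V j)"
    using finV by (simp add: card_SigmaI)
  also have "\<dots> = card ((\<lambda>v. vec.span {v}) ` S)"
    using card_image[OF inj] image by simp
  also have "\<dots> \<le> 3 * CARD('n)" using card_image_le[OF fin] card by (rule order_trans)
  finally have le: "(\<Sum>j\<in>UNIV. card (V j)) \<le> (\<Sum>j\<in>(UNIV :: 'n set). 3)" by simp
  have card3: "card (V j) = 3" for j
  proof (rule ccontr)
    assume "card (V j) \<noteq> 3"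
    then have "3 < card (V j)" using three[of j] by simp
    then have "(\<Sum>j\<in>(UNIV :: 'n set). 3) < (\<Sum>j\<in>UNIV. card (V j))"
      by (intro sum_strict_mono_ex1) (use three in auto)
    with le show False by simp
  qed
  have sum0: "\<Sum>(V j) = 0" for j
  proof -
    obtain x y z where V: "V j = {x, y, z}" "x \<noteq> y" "x \<noteq> z" "y \<noteq> z"
      using card3[of j] by (metis card_3_iff)
    let ?e = "x * y + x * z + y * z"
    let ?L = "lin (A j)"
    let ?g = "X\<^sub>0 * (X\<^sub>0 * (X\<^sub>0 * ?L)) - Const (x + y + z) * (X\<^sub>0 * (X\<^sub>0 * (?L * ?L)))
      + Const ?e * (X\<^sub>0 * (?L * (?L * ?L))) - Const (x * y * z) * (?L * (?L * (?L * ?L)))"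
    have "?g \<in> forms (Suc (Suc (Suc 1)))"
      by (intro forms_diff forms_add forms_Const_mult forms_products forms_lin)
    then have "diff_act ?g quartic = 0"
    proof (rule apolar_vectorsD[OF apolar])
      fix v assume "v \<in> line_points A V"
      then obtain l a where v: "v = pt a (A l)" "a \<in> V l" by (auto simp: line_points_iff)
      show "eval_at v ?g = 0"
      proof (cases "l = j")
        case True
        then have a: "a = x \<or> a = y \<or> a = z" using v V by auto
        have "eval_at v ?g = (a - x) * (a - y) * (a - z)"
          unfolding v(1) True by (simp add: orthonormalD[OF A] algebra_simps)
        then show ?thesis using a by auto
      qed (simp add: v orthonormalD[OF A])
    qed
    then have "Const (x + y + z) * (Const 4 * Const (A j \<bullet>\<^sub>b A j)) = (0 :: 'n option mpoly)"
      by (simp only: diff_act_mult diff_act_Const diff_act_zero_right mult_zero_right d_simps) (simp add: mult_ac)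
    then have "eval_at 0 (Const (x + y + z) * (Const 4 * Const (A j \<bullet>\<^sub>b A j)) :: 'n option mpoly) = 0"
      by (simp only: eval_at_zero)
    then have "x * 4 + y * 4 + z * 4 = 0" by (simp add: orthonormalD[OF A])
    then have "(x + y + z) * 4 = 0" by (simp only: distrib_right)
    then have "x + y + z = 0" by (simp del: distrib_right_numeral)
    then show ?thesis using V by (simp add: add.assoc)
  qed
  have "(\<Sum>j\<in>UNIV. \<Sum>a\<in>V j. a\<^sup>2) = 0"
  proof -
    have "diff_act (cubic_gen A V) quartic = 0"
    proof (rule apolar_vectorsD[OF apolar forms_cubic_gen])
      fix v assume "v \<in> line_points A V"
      then show "eval_at v (cubic_gen A V) = 0"
        by (auto simp: line_points_iff eval_cubic_gen[OF A] cube_of_root[OF card3 sum0])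
    qed
    then have "(\<Sum>j\<in>UNIV. Const ((\<Sum>a\<in>V j. a\<^sup>2) / 2) * (Const 4 * (Const (A j \<bullet>\<^sub>b A j) * X\<^sub>0))) = (0 :: 'n option mpoly)"
      unfolding cubic_gen_def by (simp only: diff_act_mult diff_act_Const diff_act_zero_right mult_zero_right d_simps) (simp add: algebra_simps)
    then have "eval_at (pt 1 0) (\<Sum>j\<in>UNIV. Const ((\<Sum>a\<in>V j. a\<^sup>2) / 2) * (Const 4 * (Const (A j \<bullet>\<^sub>b A j) * X\<^sub>0)) :: 'n option mpoly) = 0"
      by (simp only: eval_at_zero)
    then show ?thesis by (simp add: orthonormalD[OF A] sum_distrib_left[symmetric] sum_divide_distrib[symmetric])
  qed
  with A card3 sum0 have "config A V" by (simp add: config_def)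
  with spans show ?thesis by blast
qed

section \<open>The ideal and the Hilbert functions\<close>

lemma orthonormal_matrix:
  assumes "orthonormal A"
  shows "orthogonal_matrix (\<chi> i j. A i $ j)"
proof -
  let ?M = "\<chi> i j. A i $ j"
  have "?M ** transpose ?M = mat 1"
    using orthonormalD[OF assms]
    by (simp add: matrix_matrix_mult_def transpose_def mat_def vec_eq_iff bil_def)
  then show ?thesis by (simp add: orthogonal_matrix_def matrix_left_right_inverse)
qed

lemma orthonormal_completeness:
  assumes "orthonormal A"
  shows "(\<Sum>i\<in>UNIV. A i $ j * A i $ k) = (if j = k then 1 else 0)"
proof -
  let ?M = "\<chi> i j. A i $ j"
  have "transpose ?M ** ?M = mat 1"
    using orthonormal_matrix[OF assms] by (simp add: orthogonal_matrix_def)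
  then have "(transpose ?M ** ?M) $ j $ k = mat 1 $ j $ k" by simp
  then show ?thesis by (simp add: matrix_matrix_mult_def transpose_def mat_def)
qed

lemma Var_Some_expand:
  assumes "orthonormal A"
  shows "Var (Some j) = (\<Sum>i\<in>UNIV. Const (A i $ j) * lin (A i))"
proof -
  have "(\<Sum>i\<in>UNIV. Const (A i $ j) * lin (A i)) =
      (\<Sum>i\<in>UNIV. \<Sum>k\<in>UNIV. Const (A i $ j * A i $ k) * Var (Some k))"
    by (simp add: lin_sum sum_distrib_left Const_mult mult.assoc)
  also have "\<dots> = (\<Sum>k\<in>UNIV. Const (\<Sum>i\<in>UNIV. A i $ j * A i $ k) * Var (Some k))"
    by (subst sum.swap) (simp add: Const_sum sum_distrib_right)
  also have "\<dots> = (\<Sum>k\<in>UNIV. if k = j then Var (Some k) else 0)"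
    by (intro sum.cong) (auto simp: orthonormal_completeness[OF assms])
  finally show ?thesis by simp
qed

definition config_gens :: "('n::finite \<Rightarrow> complex ^ 'n) \<Rightarrow> ('n \<Rightarrow> complex set) \<Rightarrow> 'n option mpoly set" where
  "config_gens A V = {lin (A i) * lin (A j) | i j. i \<noteq> j} \<union> {cubic_gen A V}"

lemma config_gens_forms: "g \<in> config_gens A V \<Longrightarrow> \<exists>d. g \<in> forms d"
  using forms_products(2)[OF forms_lin] by (auto simp: config_gens_def intro: forms_cubic_gen)

lemma config_gens_vanish:
  assumes "config A V" "g \<in> config_gens A V" "v \<in> line_points A V"
  shows "eval_at v g = 0"
  using assms(2,3) cube_of_root[OF configD(2,3)[OF assms(1)]]
  by (auto simp: config_gens_def line_points_iff eval_cubic_gen[OF configD(1)[OF assms(1)]]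
      orthonormalD[OF configD(1)[OF assms(1)]])

lemma config_ideal_vanish:
  assumes "config A V" "g \<in> ideal_gen (config_gens A V)" "v \<in> line_points A V"
  shows "eval_at v g = 0"
proof -
  have "ideal_gen (config_gens A V) \<subseteq> {g. eval_at v g = 0}"
    by (rule ideal_gen_minimal) (use config_gens_vanish[OF assms(1) _ assms(3)] in auto)
  with assms(2) show ?thesis by auto
qed

text \<open>
  Modulo the generators, a monomial in \<open>X\<close> and the \<open>A\<^sub>j\<close> involves at most one \<open>A\<^sub>j\<close>, and \<open>X\<close> has
  exponent at most \<open>2\<close>. The index \<open>Some (j, a)\<close> stands for \<open>X\<^sup>a A\<^sub>j\<^sup>d\<^sup>-\<^sup>a\<close>; the pure power \<open>X\<^sup>d\<close>, common
  to all \<open>j\<close>, has index \<open>None\<close>.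
\<close>

definition normal_index :: "nat \<Rightarrow> ('n::finite \<times> nat) option set" where
  "normal_index d = (if d < 3 then {None} else {}) \<union> Some ` (UNIV \<times> {..<min 3 d})"

fun normal_monomial ::
    "('n::finite \<Rightarrow> complex ^ 'n) \<Rightarrow> nat \<Rightarrow> ('n \<times> nat) option \<Rightarrow> 'n option mpoly" where
  "normal_monomial A d None = X\<^sub>0 ^ d"
| "normal_monomial A d (Some (j, a)) = X\<^sub>0 ^ a * lin (A j) ^ (d - a)"

lemma finite_normal_index [simp]: "finite (normal_index d)"
  by (simp add: normal_index_def)

lemma normal_index_iff [simp]:
  "None \<in> normal_index d \<longleftrightarrow> d < 3" "Some (j, a) \<in> normal_index d \<longleftrightarrow> a < 3 \<and> a < d"
  by (auto simp: normal_index_def split: if_splits)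

lemma card_normal_index:
  "card (normal_index d :: ('n::finite \<times> nat) option set) = (if d < 3 then 1 else 0) + CARD('n) * min 3 d"
proof -
  have "card (normal_index d :: ('n \<times> nat) option set) =
      card (if d < 3 then {None} else {} :: ('n \<times> nat) option set)
      + card (Some ` (UNIV \<times> {..<min 3 d}) :: ('n \<times> nat) option set)"
    unfolding normal_index_def by (intro card_Un_disjoint) auto
  also have "card (Some ` (UNIV \<times> {..<min 3 d}) :: ('n \<times> nat) option set) = CARD('n) * min 3 d"
    by (subst card_image) (auto simp: card_cartesian_product)
  finally show ?thesis by simp
qed

lemma sum_normal_index:
  "(\<Sum>k\<in>normal_index d. f k) =
    (if d < 3 then f None else 0) + (\<Sum>j\<in>UNIV. \<Sum>a<min 3 d. f (Some (j, a)))"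
proof -
  have "(\<Sum>k\<in>normal_index d. f k) =
      (\<Sum>k\<in>(if d < 3 then {None} else {}). f k) + (\<Sum>k\<in>Some ` (UNIV \<times> {..<min 3 d}). f k)"
    unfolding normal_index_def by (intro sum.union_disjoint) auto
  also have "(\<Sum>k\<in>Some ` (UNIV \<times> {..<min 3 d}). f k) = (\<Sum>j\<in>UNIV. \<Sum>a<min 3 d. f (Some (j, a)))"
    by (simp add: sum.reindex sum.cartesian_product)
  finally show ?thesis by simp
qed

lemma forms_normal_monomial:
  assumes "k \<in> normal_index d"
  shows "normal_monomial A d k \<in> forms d"
proof (cases k)
  case (Some ja)
  then obtain j a where k: "k = Some (j, a)" by (cases ja) auto
  then have "a < d" using assms by auto
  then show ?thesis unfolding k normal_monomial.simps
    by (intro forms_mult_eq[OF forms_products(3,4)]) simp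
qed (simp add: forms_products(3))

lemma quadratic_three_roots:
  fixes V :: "complex set"
  assumes V: "card V = 3" and zero: "\<And>t. t \<in> V \<Longrightarrow> p + q * t + r * t\<^sup>2 = 0"
  shows "p = 0" "q = 0" "r = 0"
proof -
  obtain x y z where V: "V = {x, y, z}" "x \<noteq> y" "x \<noteq> z" "y \<noteq> z"
    using V by (metis card_3_iff)
  have x: "p + q * x + r * x\<^sup>2 = 0" and y: "p + q * y + r * y\<^sup>2 = 0" and z: "p + q * z + r * z\<^sup>2 = 0"
    using zero V by auto
  have "(x - y) * (q + r * (x + y)) = (p + q * x + r * x\<^sup>2) - (p + q * y + r * y\<^sup>2)"
    by (simp add: power2_eq_square algebra_simps)
  then have 1: "q + r * (x + y) = 0" using x y V by simp
  have "(x - z) * (q + r * (x + z)) = (p + q * x + r * x\<^sup>2) - (p + q * z + r * z\<^sup>2)"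
    by (simp add: power2_eq_square algebra_simps)
  then have 2: "q + r * (x + z) = 0" using x z V by simp
  have "(y - z) * r = (q + r * (x + y)) - (q + r * (x + z))" by (simp add: algebra_simps)
  then show r: "r = 0" using 1 2 V by simp
  then show q: "q = 0" using 1 by simp
  with r x show "p = 0" by simp
qed

lemma eval_normal_sum:
  assumes A: "orthonormal A"
  shows "(\<Sum>k\<in>normal_index d. c k * eval_at (pt t (A l)) (normal_monomial A d k)) =
    (if d < 3 then c None * t ^ d else 0) + (\<Sum>a<min 3 d. c (Some (l, a)) * t ^ a)"
proof -
  have "(\<Sum>j\<in>UNIV. \<Sum>a<min 3 d. c (Some (j, a)) * eval_at (pt t (A l)) (normal_monomial A d (Some (j, a))))
      = (\<Sum>j\<in>UNIV. if j = l then \<Sum>a<min 3 d. c (Some (l, a)) * t ^ a else 0)"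
  proof (intro sum.cong refl)
    fix j
    have "eval_at (pt t (A l)) (normal_monomial A d (Some (j, a))) = (if j = l then t ^ a else 0)"
      if "a < min 3 d" for a
      using that by (simp add: orthonormalD[OF A])
    then show "(\<Sum>a<min 3 d. c (Some (j, a)) * eval_at (pt t (A l)) (normal_monomial A d (Some (j, a))))
        = (if j = l then \<Sum>a<min 3 d. c (Some (l, a)) * t ^ a else 0)"
      by (auto intro!: sum.cong sum.neutral)
  qed
  then show ?thesis by (simp add: sum_normal_index)
qed

text \<open>
  On the line through the apex and \<open>A\<^sub>l\<close> a combination of normal monomials is a polynomial of
  degree at most \<open>2\<close> in the coordinate, and three points of the line lie in the configuration.
\<close>

lemma normal_monomials_independent:
  fixes A :: "'n::finite \<Rightarrow> complex ^ 'n"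
  assumes AV: "config A V"
    and zero: "\<forall>v\<in>line_points A V. (\<Sum>k\<in>normal_index d. c k * eval_at v (normal_monomial A d k)) = 0"
  shows "\<forall>k\<in>normal_index d. c k = 0"
proof -
  define e where "e l a = (if a < min 3 d then c (Some (l, a)) else if a = d then c None else 0)" for l a
  have e: "e l 0 = 0 \<and> e l 1 = 0 \<and> e l 2 = 0" for l
  proof -
    have "e l 0 + e l 1 * t + e l 2 * t\<^sup>2 = 0" if "t \<in> V l" for t
    proof -
      have "pt t (A l) \<in> line_points A V" using that by (auto simp: line_points_iff)
      with zero have 0: "(if d < 3 then c None * t ^ d else 0) + (\<Sum>a<min 3 d. c (Some (l, a)) * t ^ a) = 0"
        by (simp only: eval_normal_sum[OF configD(1)[OF AV], symmetric])
      consider "d = 0" | "d = 1" | "d = 2" | "d \<ge> 3" by linarith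
      then show ?thesis
        using 0 by cases (simp_all add: e_def numeral_3_eq_3 numeral_2_eq_2 algebra_simps min_def)
    qed
    then show ?thesis using quadratic_three_roots[OF configD(2)[OF AV, of l]] by blast
  qed
  show ?thesis
  proof
    fix k :: "('n \<times> nat) option" assume k: "k \<in> normal_index d"
    show "c k = 0"
    proof (cases k)
      case None
      then have "d < 3" using k by auto
      then have "d = 0 \<or> d = 1 \<or> d = 2" by linarith
      then have "e l d = 0" for l using e by auto
      then show ?thesis using None by (simp add: e_def)
    next
      case (Some ja)
      obtain j a where ja: "ja = (j, a)" by (cases ja)
      then have "a < min 3 d" using k Some by auto
      moreover from this have "e j a = 0" using e[of j]
        by (auto simp: numeral_3_eq_3 numeral_2_eq_2 less_Suc_eq)
      ultimately show ?thesis using Some ja by (simp add: e_def)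
    qed
  qed
qed

definition reducible_forms ::
    "('n::finite \<Rightarrow> complex ^ 'n) \<Rightarrow> ('n \<Rightarrow> complex set) \<Rightarrow> nat \<Rightarrow> 'n option mpoly set" where
  "reducible_forms A V d = {f. \<exists>c. f - (\<Sum>k\<in>normal_index d. Const (c k) * normal_monomial A d k)
     \<in> ideal_gen (config_gens A V)}"

lemma reducible_ideal: "f \<in> ideal_gen (config_gens A V) \<Longrightarrow> f \<in> reducible_forms A V d"
  unfolding reducible_forms_def by (auto intro!: exI[of _ "\<lambda>_. 0"])

lemma reducible_normal:
  assumes "k \<in> normal_index d"
  shows "normal_monomial A d k \<in> reducible_forms A V d"
proof -
  have "(\<Sum>l\<in>normal_index d. Const (if l = k then 1 else 0) * normal_monomial A d l) =
      (\<Sum>l\<in>normal_index d. if l = k then normal_monomial A d k else 0)"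
    by (intro sum.cong) auto
  also have "\<dots> = normal_monomial A d k" using assms by simp
  finally have "normal_monomial A d k -
      (\<Sum>l\<in>normal_index d. Const (if l = k then 1 else 0) * normal_monomial A d l) = 0" by simp
  then have "normal_monomial A d k -
      (\<Sum>l\<in>normal_index d. Const (if l = k then 1 else 0) * normal_monomial A d l)
      \<in> ideal_gen (config_gens A V)" by (simp only: ideal_gen_zero)
  then show ?thesis
    unfolding reducible_forms_def by (intro CollectI exI)
qed

lemma reducible_add:
  assumes "f \<in> reducible_forms A V d" "g \<in> reducible_forms A V d"
  shows "f + g \<in> reducible_forms A V d"
proof -
  let ?N = "\<lambda>c. \<Sum>k\<in>normal_index d. Const (c k) * normal_monomial A d k"
  obtain c c' where "f - ?N c \<in> ideal_gen (config_gens A V)" "g - ?N c' \<in> ideal_gen (config_gens A V)"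
    using assms by (auto simp: reducible_forms_def)
  then have "(f - ?N c) + (g - ?N c') \<in> ideal_gen (config_gens A V)" by (rule ideal_gen_add)
  also have "(f - ?N c) + (g - ?N c') = (f + g) - ?N (\<lambda>k. c k + c' k)"
    by (simp add: Const_add distrib_right sum.distrib)
  finally show ?thesis unfolding reducible_forms_def by (intro CollectI exI)
qed

lemma reducible_Const_mult:
  assumes "f \<in> reducible_forms A V d"
  shows "Const z * f \<in> reducible_forms A V d"
proof -
  let ?N = "\<lambda>c. \<Sum>k\<in>normal_index d. Const (c k) * normal_monomial A d k"
  obtain c where "f - ?N c \<in> ideal_gen (config_gens A V)"
    using assms by (auto simp: reducible_forms_def)
  then have "Const z * (f - ?N c) \<in> ideal_gen (config_gens A V)" by (rule ideal_gen_mult)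
  also have "Const z * (f - ?N c) = Const z * f - ?N (\<lambda>k. z * c k)"
    by (simp add: Const_mult right_diff_distrib sum_distrib_left mult.assoc)
  finally show ?thesis unfolding reducible_forms_def by (intro CollectI exI)
qed

lemma reducible_sum:
  "(\<And>i. i \<in> I \<Longrightarrow> f i \<in> reducible_forms A V d) \<Longrightarrow> sum f I \<in> reducible_forms A V d"
  by (induction I rule: infinite_finite_induct)
    (auto intro: reducible_ideal ideal_gen_zero reducible_add)

lemma mixed_product_in_ideal:
  assumes "i \<noteq> j"
  shows "h * (lin (A i) * lin (A j)) \<in> ideal_gen (config_gens A V)"
  using assms by (intro ideal_gen_mult ideal_gen_base) (auto simp: config_gens_def)

lemma mixed_product_reducible:
  "i \<noteq> j \<Longrightarrow> h * (lin (A i) * lin (A j)) \<in> reducible_forms A V d"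
  by (intro reducible_ideal mixed_product_in_ideal)

text \<open>
  Multiplication by \<open>h\<close> preserves the ideal, so only the products of \<open>h\<close> with normal monomials need
  to be reduced again.
\<close>

lemma reducible_mult:
  assumes f: "f \<in> reducible_forms A V d"
    and normal: "\<And>k. k \<in> normal_index d \<Longrightarrow> h * normal_monomial A d k \<in> reducible_forms A V (Suc d)"
  shows "h * f \<in> reducible_forms A V (Suc d)"
proof -
  let ?N = "\<lambda>c. \<Sum>k\<in>normal_index d. Const (c k) * normal_monomial A d k"
  obtain c where "f - ?N c \<in> ideal_gen (config_gens A V)"
    using f by (auto simp: reducible_forms_def)
  then have 1: "h * (f - ?N c) \<in> reducible_forms A V (Suc d)"
    by (intro reducible_ideal ideal_gen_mult)
  have "(\<Sum>k\<in>normal_index d. Const (c k) * (h * normal_monomial A d k)) \<in> reducible_forms A V (Suc d)"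
    using normal by (intro reducible_sum reducible_Const_mult)
  from reducible_add[OF 1 this] show ?thesis
    by (simp add: right_diff_distrib sum_distrib_left mult_ac)
qed

text \<open>
  The cubic generator replaces \<open>X\<^sup>3\<close> by a sum over all lines, in which, for \<open>e > 0\<close>, the remaining
  factor \<open>A\<^sub>j\<close> makes all terms but those of the \<open>j\<close>-th line mixed.
\<close>

lemma reducible_X_cubed:
  "X\<^sub>0 * (X\<^sub>0 * X\<^sub>0) * lin (A j) ^ e \<in> reducible_forms A V (e + 3)"
proof -
  let ?p = "\<lambda>i. (\<Sum>a\<in>V i. a\<^sup>2) / 2" and ?q = "\<lambda>i. (\<Sum>a\<in>V i. a ^ 3) / 3"
  let ?M = "lin (A j) ^ e"
  have "?M * cubic_gen A V \<in> reducible_forms A V (e + 3)"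
    by (intro reducible_ideal ideal_gen_mult ideal_gen_base) (simp add: config_gens_def)
  moreover have "(\<Sum>i\<in>UNIV. Const (?p i) * (?M * (X\<^sub>0 * (lin (A i) * lin (A i))))
      + Const (?q i) * (?M * (lin (A i) * (lin (A i) * lin (A i))))) \<in> reducible_forms A V (e + 3)"
  proof (intro reducible_sum reducible_add reducible_Const_mult)
    fix i
    have pow: "lin (A i) ^ 2 = lin (A i) * lin (A i)" "lin (A i) ^ 3 = lin (A i) * (lin (A i) * lin (A i))"
      by (simp_all add: power2_eq_square power3_eq_cube mult.assoc)
    show "?M * (X\<^sub>0 * (lin (A i) * lin (A i))) \<in> reducible_forms A V (e + 3)"
    proof (cases "i = j \<or> e = 0")
      case True
      then have "?M * (X\<^sub>0 * (lin (A i) * lin (A i))) = normal_monomial A (e + 3) (Some (i, 1))"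
        by (auto simp: pow power_add mult_ac)
      moreover have "Some (i, 1) \<in> normal_index (e + 3)" by simp
      ultimately show ?thesis by (simp only: reducible_normal)
    next
      case False
      then have "?M = lin (A j) ^ (e - 1) * lin (A j)" by (cases e) auto
      then have "?M * (X\<^sub>0 * (lin (A i) * lin (A i))) =
          (lin (A j) ^ (e - 1) * X\<^sub>0 * lin (A i)) * (lin (A i) * lin (A j))" by (simp add: mult_ac)
      then show ?thesis using False by (simp add: mixed_product_reducible)
    qed
    show "?M * (lin (A i) * (lin (A i) * lin (A i))) \<in> reducible_forms A V (e + 3)"
    proof (cases "i = j \<or> e = 0")
      case True
      then have "?M * (lin (A i) * (lin (A i) * lin (A i))) = normal_monomial A (e + 3) (Some (i, 0))"
        by (auto simp: pow power_add mult_ac)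
      moreover have "Some (i, 0) \<in> normal_index (e + 3)" by simp
      ultimately show ?thesis by (simp only: reducible_normal)
    next
      case False
      then have "?M = lin (A j) ^ (e - 1) * lin (A j)" by (cases e) auto
      then have "?M * (lin (A i) * (lin (A i) * lin (A i))) =
          (lin (A j) ^ (e - 1) * lin (A i) * lin (A i)) * (lin (A i) * lin (A j))" by (simp add: mult_ac)
      then show ?thesis using False by (simp add: mixed_product_reducible)
    qed
  qed
  ultimately have "?M * cubic_gen A V + (\<Sum>i\<in>UNIV. Const (?p i) * (?M * (X\<^sub>0 * (lin (A i) * lin (A i))))
      + Const (?q i) * (?M * (lin (A i) * (lin (A i) * lin (A i))))) \<in> reducible_forms A V (e + 3)"
    by (rule reducible_add)
  also have "?M * cubic_gen A V + (\<Sum>i\<in>UNIV. Const (?p i) * (?M * (X\<^sub>0 * (lin (A i) * lin (A i))))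
      + Const (?q i) * (?M * (lin (A i) * (lin (A i) * lin (A i))))) = X\<^sub>0 * (X\<^sub>0 * X\<^sub>0) * ?M"
    unfolding cubic_gen_def right_diff_distrib sum_distrib_left
    by (simp add: distrib_left mult_ac)
  finally show ?thesis .
qed

lemma reducible_X_mult:
  assumes "f \<in> reducible_forms A V d"
  shows "X\<^sub>0 * f \<in> reducible_forms A V (Suc d)"
proof (rule reducible_mult[OF assms])
  fix k :: "('a \<times> nat) option" assume k: "k \<in> normal_index d"
  show "X\<^sub>0 * normal_monomial A d k \<in> reducible_forms A V (Suc d)"
  proof (cases k)
    case None
    then have "d < 3" using k by auto
    show ?thesis
    proof (cases "d = 2")
      case True
      then show ?thesis using None reducible_X_cubed[of A undefined 0 V] by (simp add: power2_eq_square)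
    next
      case False
      then have "None \<in> (normal_index (Suc d) :: ('a \<times> nat) option set)"
        using \<open>d < 3\<close> by simp
      from reducible_normal[OF this, of A V] show ?thesis using None by simp
    qed
  next
    case (Some ja)
    obtain j a where ja: "ja = (j, a)" by (cases ja)
    then have a: "a < 3" "a < d" using k Some by auto
    show ?thesis
    proof (cases "a = 2")
      case True
      then show ?thesis using a Some ja reducible_X_cubed[of A j "d - 2" V]
        by (simp add: power2_eq_square mult.assoc Suc_diff_le)
    next
      case False
      then have "Some (j, Suc a) \<in> normal_index (Suc d)" using a by auto
      from reducible_normal[OF this, of A V] show ?thesis using Some ja by (simp add: mult.assoc)
    qed
  qed
qed

lemma reducible_lin_mult:
  assumes "f \<in> reducible_forms A V d"
  shows "lin (A i) * f \<in> reducible_forms A V (Suc d)"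
proof (rule reducible_mult[OF assms])
  fix k :: "('a \<times> nat) option" assume k: "k \<in> normal_index d"
  show "lin (A i) * normal_monomial A d k \<in> reducible_forms A V (Suc d)"
  proof (cases k)
    case None
    then have "Some (i, d) \<in> normal_index (Suc d)"
      using k by auto
    from reducible_normal[OF this, of A V] show ?thesis using None by (simp add: mult.commute)
  next
    case (Some ja)
    obtain j a where ja: "ja = (j, a)" by (cases ja)
    then have a: "a < 3" "a < d" using k Some by auto
    show ?thesis
    proof (cases "i = j")
      case True
      have "Some (j, a) \<in> normal_index (Suc d)" using a by auto
      from reducible_normal[OF this, of A V] show ?thesis
        using Some ja a True by (simp add: Suc_diff_le mult_ac)
    next
      case False
      have "lin (A j) ^ (d - a) = lin (A j) ^ (d - Suc a) * lin (A j)"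
        using a(2) by (simp only: power_Suc2[symmetric] Suc_diff_Suc)
      then have "lin (A i) * normal_monomial A d k = (X\<^sub>0 ^ a * lin (A j) ^ (d - Suc a)) * (lin (A i) * lin (A j))"
        using Some ja by (simp add: mult_ac)
      then show ?thesis using False by (simp add: mixed_product_reducible)
    qed
  qed
qed

lemma all_forms_reducible:
  assumes A: "orthonormal A" and f: "f \<in> forms d"
  shows "f \<in> reducible_forms A V d"
  using f
proof (induction rule: forms_induct)
  case (Const c)
  have "None \<in> (normal_index 0 :: ('a \<times> nat) option set)" by simp
  from reducible_Const_mult[OF reducible_normal[OF this, of A V], of c] show ?case by simp
next
  case (mult d i p)
  show ?case
  proof (cases i)
    case None
    then show ?thesis using reducible_X_mult[OF mult.IH] by simp
  next
    case (Some j)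
    have "Var i * p = (\<Sum>i\<in>UNIV. Const (A i $ j) * (lin (A i) * p))"
      unfolding Some Var_Some_expand[OF A] by (simp add: sum_distrib_right mult.assoc)
    then show ?thesis
      by (simp only: reducible_sum reducible_Const_mult reducible_lin_mult[OF mult.IH])
  qed
next
  case (add d p q)
  then show ?case by (intro reducible_add)
qed

text \<open>
  A form vanishing on the configuration is congruent to a combination of normal monomials that
  vanishes there too, and this combination is zero by independence.
\<close>

theorem point_ideal_config:
  assumes AV: "config A V"
  shows "point_ideal ((\<lambda>v. vec.span {v}) ` line_points A V) = ideal_gen (config_gens A V)"
proof (rule point_ideal_eqI)
  fix d f assume f: "f \<in> forms d" and zero: "\<forall>v\<in>line_points A V. eval_at v f = 0"
  obtain c where c: "f - (\<Sum>k\<in>normal_index d. Const (c k) * normal_monomial A d k) \<in> ideal_gen (config_gens A V)"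
    using all_forms_reducible[OF configD(1)[OF AV] f, of V] by (auto simp: reducible_forms_def)
  have "(\<Sum>k\<in>normal_index d. c k * eval_at v (normal_monomial A d k)) = 0" if "v \<in> line_points A V" for v
    using config_ideal_vanish[OF AV c that] zero that
    by (simp only: eval_at_diff Const_sum_mult_eval) simp
  then have "\<forall>k\<in>normal_index d. c k = 0" by (intro normal_monomials_independent[OF AV]) blast
  then show "f \<in> ideal_gen (config_gens A V)" using c by simp
qed (use config_gens_forms config_gens_vanish[OF AV] in blast)+

theorem HF_config:
  fixes A :: "'n::finite \<Rightarrow> complex ^ 'n"
  assumes AV: "config A V"
  shows "HF ((\<lambda>v. vec.span {v}) ` line_points A V) d = (if d < 3 then 1 else 0) + CARD('n) * min 3 d"
proof -
  have "HF ((\<lambda>v. vec.span {v}) ` line_points A V) d = card (normal_index d :: ('n \<times> nat) option set)"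
  proof (rule HF_eqI)
    fix p :: "'n option mpoly" assume p: "p \<in> forms d"
    obtain c where c: "p - (\<Sum>k\<in>normal_index d. Const (c k) * normal_monomial A d k) \<in> ideal_gen (config_gens A V)"
      using all_forms_reducible[OF configD(1)[OF AV] p, of V] by (auto simp: reducible_forms_def)
    have "eval_at v p = (\<Sum>k\<in>normal_index d. c k * eval_at v (normal_monomial A d k))"
      if "v \<in> line_points A V" for v
      using config_ideal_vanish[OF AV c that] by (simp only: eval_at_diff Const_sum_mult_eval) simp
    then show "\<exists>c. \<forall>v\<in>line_points A V. eval_at v p =
        (\<Sum>k\<in>normal_index d. c k * eval_at v (normal_monomial A d k))" by blast
  qed (use forms_normal_monomial normal_monomials_independent[OF AV] in auto)
  then show ?thesis by (simp only: card_normal_index)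
qed

section \<open>Decompositions and the rank\<close>

lemma lf_pt: "lf (pt a b) = Const a * X\<^sub>0 + lin b"
  by (simp add: lf_def sum_UNIV_option)

lemma apolar_vectors_of_decomposition:
  assumes "quartic = (\<Sum>i\<in>I. Const (\<alpha> i) * lf (v i) ^ 4)"
  shows "apolar_vectors (v ` I)"
  unfolding apolar_vectors_def
proof (intro allI ballI impI)
  fix d and g :: "'a option mpoly"
  assume g: "g \<in> forms d" and "\<forall>w\<in>v ` I. eval_at w g = 0"
  then have "diff_act g (lf (v i) ^ 4) = 0" if "i \<in> I" for i
    using that by (simp add: diff_act_lf_power[OF g])
  then show "diff_act g quartic = 0"
    unfolding assms by (simp add: diff_act_sum_right diff_act_Const_mult_right)
qed

lemma apolar_set_of_vectors:
  assumes "apolar_vectors S" "finite S" "0 \<notin> S"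
  shows "apolar_set quartic ((\<lambda>v. vec.span {v}) ` S)"
proof -
  have "point_ideal ((\<lambda>v. vec.span {v}) ` S) \<subseteq> perp quartic"
    unfolding point_ideal_def
  proof (rule ideal_gen_minimal)
    show "{g. (\<exists>d. g \<in> forms d) \<and> (\<forall>p\<in>(\<lambda>v. vec.span {v}) ` S. vanishes_at g p)} \<subseteq> perp quartic"
      using apolar_vectorsD[OF assms(1)] by (auto simp: perp_def vanishes_at_span)
  qed (auto simp: perp_def diff_act_add_left diff_act_mult)
  then show ?thesis using assms by (auto simp: apolar_set_def proj_space_def)
qed

lemma apolar_set_vectors:
  assumes "apolar_set quartic Z"
  obtains S where "Z = (\<lambda>v. vec.span {v}) ` S" "finite S" "card S = card Z" "apolar_vectors S"
proof -
  have Z: "finite Z" "Z \<subseteq> proj_space" "point_ideal Z \<subseteq> perp quartic"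
    using assms by (auto simp: apolar_set_def)
  have "\<forall>p\<in>Z. \<exists>v. p = vec.span {v}" using Z(2) by (auto simp: proj_space_def)
  from bchoice[OF this] obtain r where r: "p \<in> Z \<Longrightarrow> vec.span {r p} = p" for p by metis
  have "inj_on r Z" by (metis inj_onI r)
  moreover have image: "(\<lambda>v. vec.span {v}) ` r ` Z = Z" using r by (auto simp: image_image)
  moreover have "apolar_vectors (r ` Z)"
    unfolding apolar_vectors_def
  proof (intro allI ballI impI)
    fix d and g :: "'a option mpoly"
    assume "g \<in> forms d" "\<forall>v\<in>r ` Z. eval_at v g = 0"
    then have "g \<in> point_ideal Z" using point_ideal_form_iff[of g d "r ` Z"] image by simp
    then show "diff_act g quartic = 0" using Z(3) by (auto simp: perp_def)
  qed
  ultimately show thesis using that[of "r ` Z"] Z(1) by (simp add: card_image)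
qed

text \<open>
  The weights of the divided difference with nodes \<open>V\<close>. For three nodes, its value on \<open>a\<^sup>m\<close> is the
  complete homogeneous symmetric polynomial of degree \<open>m - 2\<close> in the nodes; for \<open>m = 3\<close> this is
  their sum.
\<close>

definition divided_weight :: "complex set \<Rightarrow> complex \<Rightarrow> complex" where
  "divided_weight V a = 1 / (\<Prod>b\<in>V - {a}. a - b)"

lemma divided_weight_moments:
  fixes V :: "complex set"
  assumes "card V = 3" "\<Sum>V = 0"
  shows "(\<Sum>a\<in>V. divided_weight V a) = 0" "(\<Sum>a\<in>V. divided_weight V a * a) = 0"
    "(\<Sum>a\<in>V. divided_weight V a * a\<^sup>2) = 1" "(\<Sum>a\<in>V. divided_weight V a * a ^ 3) = 0"
    "(\<Sum>a\<in>V. divided_weight V a * a ^ 4) = (\<Sum>a\<in>V. a\<^sup>2) / 2"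
proof -
  obtain x y z where V: "V = {x, y, z}" "x \<noteq> y" "x \<noteq> z" "y \<noteq> z"
    using assms(1) by (metis card_3_iff)
  have sum: "(\<Sum>a\<in>V. f a) = f x + f y + f z" for f :: "complex \<Rightarrow> complex"
    using V by (simp add: add.assoc)
  have diff: "V - {x} = {y, z}" "V - {y} = {x, z}" "V - {z} = {x, y}" using V by auto
  have w: "divided_weight V x = 1 / ((x - y) * (x - z))" "divided_weight V y = 1 / ((y - x) * (y - z))"
    "divided_weight V z = 1 / ((z - x) * (z - y))"
    unfolding divided_weight_def diff using V by simp_all
  have clear: "divided_weight V x * a + divided_weight V y * b + divided_weight V z * c = s"
    if "a * (y - z) - b * (x - z) + c * (x - y) = s * ((x - y) * (x - z) * (y - z))" for a b c s
  proof -
    have ne: "x - y \<noteq> 0" "x - z \<noteq> 0" "y - z \<noteq> 0" using V by auto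
    have "divided_weight V x * a + divided_weight V y * b + divided_weight V z * c =
        a / ((x - y) * (x - z)) - b / ((x - y) * (y - z)) + c / ((x - z) * (y - z))"
      unfolding w using ne by (simp add: divide_simps) (simp add: algebra_simps)
    also have "\<dots> = (a * (y - z) - b * (x - z) + c * (x - y)) / ((x - y) * (x - z) * (y - z))"
      using ne by (simp add: divide_simps)
    finally show ?thesis using ne unfolding that by simp
  qed
  have z: "z = - x - y" using assms(2) V by (simp add: eq_neg_iff_add_eq_0 algebra_simps)
  show "(\<Sum>a\<in>V. divided_weight V a) = 0"
    unfolding sum using clear[of 1 1 1 0] by simp
  show "(\<Sum>a\<in>V. divided_weight V a * a) = 0"
    unfolding sum by (rule clear) (simp add: algebra_simps)
  show "(\<Sum>a\<in>V. divided_weight V a * a\<^sup>2) = 1"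
    unfolding sum by (rule clear) (simp add: power2_eq_square algebra_simps)
  show "(\<Sum>a\<in>V. divided_weight V a * a ^ 3) = 0"
    unfolding sum by (rule clear) (simp add: z power3_eq_cube algebra_simps)
  show "(\<Sum>a\<in>V. divided_weight V a * a ^ 4) = (\<Sum>a\<in>V. a\<^sup>2) / 2"
  proof -
    have "(\<Sum>a\<in>V. a\<^sup>2) / 2 = x\<^sup>2 + x * y + y\<^sup>2"
      unfolding sum by (simp add: z power2_eq_square algebra_simps)
    then show ?thesis
      unfolding sum[of "\<lambda>a. divided_weight V a * a ^ 4"]
      by (intro clear) (simp add: z power2_eq_square power4_eq_xxxx algebra_simps)
  qed
qed

lemma fourth_power_sum:
  fixes x y :: "'a::comm_ring_1"
  shows "(x + y) ^ 4 = y ^ 4 + 4 * (x * y ^ 3) + 6 * (x\<^sup>2 * y\<^sup>2) + 4 * (x ^ 3 * y) + x ^ 4"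
  by (simp add: power4_eq_xxxx power2_eq_square power3_eq_cube algebra_simps)

lemma lf_pt_fourth_power:
  "lf (pt a b) ^ 4 = lin b ^ 4 + Const a * (4 * (X\<^sub>0 * lin b ^ 3)) + Const (a\<^sup>2) * (6 * (X\<^sub>0\<^sup>2 * lin b ^ 2))
     + Const (a ^ 3) * (4 * (X\<^sub>0 ^ 3 * lin b)) + Const (a ^ 4) * X\<^sub>0 ^ 4"
  by (subst lf_pt) (simp only: fourth_power_sum Const_power power_mult_distrib mult_ac)

lemma qf_orthonormal:
  assumes A: "orthonormal A"
  shows "(\<Sum>i\<in>UNIV. lin (A i) ^ 2) = qf"
proof -
  have "(\<Sum>i\<in>UNIV. lin (A i) ^ 2) =
      (\<Sum>i\<in>UNIV. \<Sum>j\<in>UNIV. \<Sum>k\<in>UNIV. Const (A i $ j * A i $ k) * (Var (Some j) * Var (Some k)))"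
    unfolding lin_sum power2_eq_square sum_product by (simp add: Const_mult mult_ac)
  also have "\<dots> = (\<Sum>j\<in>UNIV. \<Sum>i\<in>UNIV. \<Sum>k\<in>UNIV. Const (A i $ j * A i $ k) * (Var (Some j) * Var (Some k)))"
    by (rule sum.swap)
  also have "\<dots> = (\<Sum>j\<in>UNIV. \<Sum>k\<in>UNIV. \<Sum>i\<in>UNIV. Const (A i $ j * A i $ k) * (Var (Some j) * Var (Some k)))"
    by (intro sum.cong refl sum.swap)
  also have "\<dots> = (\<Sum>j\<in>UNIV. \<Sum>k\<in>UNIV. if k = j then Var (Some j) * Var (Some j) else 0)"
  proof (intro sum.cong refl)
    fix j k
    have "(\<Sum>i\<in>UNIV. Const (A i $ j * A i $ k) * (Var (Some j) * Var (Some k))) =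
        Const (\<Sum>i\<in>UNIV. A i $ j * A i $ k) * (Var (Some j) * Var (Some k))"
      by (simp add: Const_sum sum_distrib_right)
    then show "(\<Sum>i\<in>UNIV. Const (A i $ j * A i $ k) * (Var (Some j) * Var (Some k))) =
        (if k = j then Var (Some j) * Var (Some j) else 0)"
      by (auto simp: orthonormal_completeness[OF A])
  qed
  finally show ?thesis by (simp add: qf_def power2_eq_square)
qed

text \<open>
  The divided difference of \<open>(a X + A\<^sub>j)\<^sup>4\<close> over \<open>a \<in> V\<^sub>j\<close> is \<open>6 X\<^sup>2 A\<^sub>j\<^sup>2\<close> up to a multiple of \<open>X\<^sup>4\<close>;
  the condition on the squares in a configuration makes these multiples cancel.
\<close>

lemma config_decomposition:
  fixes A :: "'n::finite \<Rightarrow> complex ^ 'n"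
  assumes AV: "config A V"
  shows "quartic = (\<Sum>(j, a)\<in>(SIGMA j:UNIV. V j). Const (divided_weight (V j) a / 6) * lf (pt a (A j)) ^ 4)"
proof -
  have line: "(\<Sum>a\<in>V j. Const (divided_weight (V j) a) * lf (pt a (A j)) ^ 4) =
      6 * (X\<^sub>0\<^sup>2 * lin (A j) ^ 2) + Const ((\<Sum>a\<in>V j. a\<^sup>2) / 2) * X\<^sub>0 ^ 4" for j
  proof -
    let ?w = "divided_weight (V j)"
    have "(\<Sum>a\<in>V j. Const (?w a) * lf (pt a (A j)) ^ 4) =
        (\<Sum>a\<in>V j. Const (?w a) * lin (A j) ^ 4 + Const (?w a * a) * (4 * (X\<^sub>0 * lin (A j) ^ 3))
          + Const (?w a * a\<^sup>2) * (6 * (X\<^sub>0\<^sup>2 * lin (A j) ^ 2))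
          + Const (?w a * a ^ 3) * (4 * (X\<^sub>0 ^ 3 * lin (A j))) + Const (?w a * a ^ 4) * X\<^sub>0 ^ 4)"
      by (intro sum.cong refl, subst lf_pt_fourth_power)
        (simp only: distrib_left Const_mult mult.assoc)
    also have "\<dots> = Const (\<Sum>a\<in>V j. ?w a) * lin (A j) ^ 4
          + Const (\<Sum>a\<in>V j. ?w a * a) * (4 * (X\<^sub>0 * lin (A j) ^ 3))
          + Const (\<Sum>a\<in>V j. ?w a * a\<^sup>2) * (6 * (X\<^sub>0\<^sup>2 * lin (A j) ^ 2))
          + Const (\<Sum>a\<in>V j. ?w a * a ^ 3) * (4 * (X\<^sub>0 ^ 3 * lin (A j)))
          + Const (\<Sum>a\<in>V j. ?w a * a ^ 4) * X\<^sub>0 ^ 4"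
      unfolding sum.distrib sum_distrib_right[symmetric] Const_sum[symmetric] ..
    finally show ?thesis
      unfolding divided_weight_moments[OF configD(2,3)[OF AV]] by simp
  qed
  have "(\<Sum>(j, a)\<in>(SIGMA j:UNIV. V j). Const (divided_weight (V j) a) * lf (pt a (A j)) ^ 4) =
      (\<Sum>j\<in>UNIV. \<Sum>a\<in>V j. Const (divided_weight (V j) a) * lf (pt a (A j)) ^ 4)"
    using configD(5)[OF AV] by (subst sum.Sigma) auto
  also have "\<dots> = 6 * (X\<^sub>0\<^sup>2 * (\<Sum>j\<in>UNIV. lin (A j) ^ 2)) + Const ((\<Sum>j\<in>UNIV. \<Sum>a\<in>V j. a\<^sup>2) / 2) * X\<^sub>0 ^ 4"
    unfolding line sum.distrib sum_distrib_left[symmetric] sum_distrib_right[symmetric]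
      Const_sum[symmetric] sum_divide_distrib[symmetric] ..
  also have "\<dots> = Const 6 * quartic"
    unfolding qf_orthonormal[OF configD(1)[OF AV]] configD(4)[OF AV] quartic_def by simp
  finally have eq: "(\<Sum>(j, a)\<in>(SIGMA j:UNIV. V j). Const (divided_weight (V j) a) * lf (pt a (A j)) ^ 4) =
      Const 6 * quartic" .
  have "quartic = Const (1 / 6) * (Const 6 * quartic)"
    by (simp only: mult.assoc[symmetric] Const_mult[symmetric]) simp
  also have "\<dots> = (\<Sum>(j, a)\<in>(SIGMA j:UNIV. V j). Const (divided_weight (V j) a / 6) * lf (pt a (A j)) ^ 4)"
    unfolding eq[symmetric] sum_distrib_left
    by (intro sum.cong refl) (auto simp only: split_beta mult.assoc[symmetric] Const_mult[symmetric], simp)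
  finally show ?thesis .
qed

lemma card_config:
  fixes A :: "'n::finite \<Rightarrow> complex ^ 'n"
  assumes AV: "config A V"
  shows "card (SIGMA j:UNIV. V j) = 3 * CARD('n)"
  using configD(2,5)[OF AV] by (simp add: card_SigmaI)

text \<open>The products of \<open>a\<close> with the three cube roots of unity.\<close>

lemma roots_of_unity_triple:
  fixes a :: complex
  assumes "a \<noteq> 0"
  shows "\<exists>V. a \<in> V \<and> card V = 3 \<and> \<Sum>V = 0 \<and> (\<Sum>z\<in>V. z\<^sup>2) = 0"
proof -
  define w where "w = Complex (- 1 / 2) (sqrt 3 / 2)"
  have w2: "w * w = - 1 - w"
    by (simp add: w_def complex_eq_iff)
  have w1: "w \<noteq> 1" "w \<noteq> - 1 - w" "1 \<noteq> - 1 - w"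
    by (simp_all add: w_def complex_eq_iff)
  have ne: "a \<noteq> a * w" "a \<noteq> a * (- 1 - w)" "a * w \<noteq> a * (- 1 - w)"
    using w1 assms by (metis mult_cancel_left mult.right_neutral)+
  have "(a * w)\<^sup>2 = a\<^sup>2 * (- 1 - w)" by (simp add: power2_eq_square mult_ac w2[symmetric])
  moreover have "(a * (- 1 - w))\<^sup>2 = a\<^sup>2 * (1 + 2 * w + w * w)"
    by (simp add: power2_eq_square algebra_simps)
  then have "(a * (- 1 - w))\<^sup>2 = a\<^sup>2 * w" unfolding w2 by (simp add: algebra_simps)
  ultimately show ?thesis
    using ne by (intro exI[of _ "{a, a * w, a * (- 1 - w)}"]) (simp add: algebra_simps)
qed

lemma config_through:
  fixes A :: "'n::finite \<Rightarrow> complex ^ 'n"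
  assumes n: "CARD('n) \<ge> 2" and A: "orthonormal A"
  shows "\<exists>V. config A V \<and> a \<in> V k"
proof (cases "a = 0")
  case False
  then obtain V where "a \<in> V" "card V = 3" "\<Sum>V = 0" "(\<Sum>z\<in>V. z\<^sup>2) = 0"
    using roots_of_unity_triple by blast
  then show ?thesis using A by (intro exI[of _ "\<lambda>_. V"]) (simp add: config_def)
next
  case True
  obtain V where V: "card V = 3" "\<Sum>V = 0" "(\<Sum>z\<in>V. z\<^sup>2) = (0::complex)"
    using roots_of_unity_triple[of 1] by auto
  have "\<exists>l. l \<noteq> k"
  proof (rule ccontr)
    assume "\<not> (\<exists>l. l \<noteq> k)"
    then have "(UNIV :: 'n set) = {k}" by auto
    then have "CARD('n) = card {k}" by simp
    with n show False by simp
  qed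
  then obtain l where l: "l \<noteq> k" by blast
  \<comment> \<open>A triple of sum zero containing \<open>0\<close> has nonzero sum of squares, so a second line must compensate.\<close>
  define W where "W j = (if j = k then {0, 1, - 1} else if j = l then {0, \<i>, - \<i>} else V)" for j
  have "(\<Sum>z\<in>W j. z\<^sup>2) = (if j = k then 2 else 0) + (if j = l then - 2 else 0)" for j
    using l V by (auto simp: W_def)
  then have "(\<Sum>j\<in>UNIV. \<Sum>z\<in>W j. z\<^sup>2) = 0" by (simp add: sum.distrib)
  moreover have "card (W j) = 3 \<and> \<Sum>(W j) = 0" for j
    using V by (auto simp: W_def)
  ultimately show ?thesis using A True by (intro exI[of _ W]) (simp add: config_def, simp add: W_def)
qed

lemma orthonormal_axis: "orthonormal (\<lambda>j::'n::finite. axis j 1)"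
  unfolding orthonormal_def bil_axis by (auto simp: axis_def)

text \<open>
  The reflection along \<open>e\<^sub>k - u\<close> exchanges \<open>e\<^sub>k\<close> and \<open>u\<close>, so the images of the standard basis vectors
  are as desired. If \<open>e\<^sub>k - u\<close> is isotropic, then \<open>e\<^sub>k + u\<close> is not, and the negative of
  the reflection along it does the same.
\<close>

lemma orthonormal_extend:
  fixes u :: "complex ^ 'n::finite"
  assumes u: "u \<bullet>\<^sub>b u = 1"
  shows "\<exists>A. orthonormal A \<and> A k = u"
proof -
  have key: "\<exists>A. orthonormal A \<and> A k = s *s u"
    if s: "s * s = 1" and w: "w = s *s u - axis k 1" "w \<bullet>\<^sub>b w \<noteq> 0" for s w
  proof -
    define c where "c = 2 / (w \<bullet>\<^sub>b w)"
    have c: "c * (w \<bullet>\<^sub>b w) = 2" using w(2) by (simp add: c_def)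
    define A where "A j = axis j 1 - (c * w $ j) *s w" for j
    have "A i \<bullet>\<^sub>b A j = (if i = j then 1 else 0)" for i j
    proof -
      have "A i \<bullet>\<^sub>b A j = axis i 1 \<bullet>\<^sub>b axis j 1 - 2 * (c * w $ i * w $ j)
          + (c * (w \<bullet>\<^sub>b w)) * (c * w $ i * w $ j)"
        by (simp add: A_def algebra_simps)
      then show ?thesis unfolding c orthonormalD[OF orthonormal_axis] by simp
    qed
    moreover have "A k = s *s u"
    proof -
      have "w \<bullet>\<^sub>b w = s * s * (u \<bullet>\<^sub>b u) - 2 * (s * u $ k) + 1"
        unfolding w(1) by (simp add: algebra_simps)
      then have "w \<bullet>\<^sub>b w = - 2 * w $ k" unfolding s u w(1) by simp
      then have "- 2 * (c * w $ k + 1) = c * (w \<bullet>\<^sub>b w) - 2" by (simp add: algebra_simps)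
      then have "c * w $ k + 1 = 0" unfolding c diff_self by (simp only: mult_eq_0_iff) simp
      then have "c * w $ k = - 1" by (simp only: eq_neg_iff_add_eq_0)
      then have "A k = axis k 1 + w" by (simp add: A_def)
      then show ?thesis by (simp add: w(1))
    qed
    ultimately show ?thesis unfolding orthonormal_def by blast
  qed
  show ?thesis
  proof (cases "(u - axis k 1) \<bullet>\<^sub>b (u - axis k 1) = 0")
    case False
    then show ?thesis using key[of 1 "u - axis k 1"] by simp
  next
    case True
    then have "u $ k = 1" using u by (simp add: algebra_simps)
    then have "(- 1 *s u - axis k 1) \<bullet>\<^sub>b (- 1 *s u - axis k 1) \<noteq> 0"
      using u by (simp add: algebra_simps)
    then obtain A where A: "orthonormal A" "A k = - 1 *s u"
      using key[of "- 1" "- 1 *s u - axis k 1"] by auto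
    then have "orthonormal (\<lambda>j. - A j)" by (simp add: orthonormal_def)
    moreover have "- A k = u" using A(2) by simp
    ultimately show ?thesis by blast
  qed
qed

text \<open>
  The coefficient vectors of the linear forms in a decomposition are apolar vectors, so the lower
  bound applies to them; any configuration attains it.
\<close>

theorem waring_rank_quartic:
  assumes n: "CARD('n::finite) \<ge> 2"
  shows "waring_rank (quartic :: 'n option mpoly) = 3 * CARD('n)"
  unfolding waring_rank_def total_degree_quartic
proof (rule Least_equality)
  obtain V :: "'n \<Rightarrow> complex set" where AV: "config (\<lambda>j. axis j 1) V"
    using config_through[OF n orthonormal_axis] by blast
  let ?I = "SIGMA j:UNIV. V j"
  have "finite ?I" using configD(5)[OF AV] by auto
  then obtain h where h: "bij_betw h {..<3 * CARD('n)} ?I"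
    using card_config[OF AV] ex_bij_betw_nat_finite[of ?I] by (auto simp: atLeast0LessThan)
  let ?L = "\<lambda>i. lf (pt (snd (h i)) (axis (fst (h i)) 1)) :: 'n option mpoly"
  let ?\<alpha> = "\<lambda>i. divided_weight (V (fst (h i))) (snd (h i)) / 6"
  have "(quartic :: 'n option mpoly) = (\<Sum>i<3 * CARD('n). Const (?\<alpha> i) * ?L i ^ 4)"
    using sum.reindex_bij_betw[OF h, of "\<lambda>(j, a). Const (divided_weight (V j) a / 6) * lf (pt a (axis j 1)) ^ 4"]
      config_decomposition[OF AV] by (simp add: case_prod_beta)
  then show "\<exists>\<alpha> L. (\<forall>i<3 * CARD('n). L i \<in> forms 1) \<and>
      (quartic :: 'n option mpoly) = (\<Sum>i<3 * CARD('n). Const (\<alpha> i) * L i ^ 4)"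
    by (intro exI[of _ ?\<alpha>] exI[of _ ?L] conjI allI impI forms_lf)
next
  fix r :: nat assume "\<exists>\<alpha> L. (\<forall>i<r. L i \<in> forms 1) \<and>
      (quartic :: 'n option mpoly) = (\<Sum>i<r. Const (\<alpha> i) * L i ^ 4)"
  then obtain \<alpha> and L :: "nat \<Rightarrow> 'n option mpoly" where L: "\<forall>i\<in>{..<r}. L i \<in> forms 1"
    and eq: "quartic = (\<Sum>i<r. Const (\<alpha> i) * L i ^ 4)" by auto
  have "\<forall>i\<in>{..<r}. \<exists>v. L i = lf v" using L lf_of_form by blast
  from bchoice[OF this] obtain v where "\<forall>i\<in>{..<r}. L i = lf (v i)" by blast
  then have "quartic = (\<Sum>i<r. Const (\<alpha> i) * lf (v i) ^ 4)" unfolding eq by simp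
  then have "3 * CARD('n) \<le> card {w \<in> v ` {..<r}. body w \<noteq> 0}"
    by (intro apolar_card_lower_bound apolar_vectors_of_decomposition) auto
  also have "\<dots> \<le> card (v ` {..<r})" by (intro card_mono) auto
  also have "\<dots> \<le> r" using card_image_le[of "{..<r}" v] by simp
  finally show "3 * CARD('n) \<le> r" .
qed

theorem minimal_apolar_set_iff_config:
  fixes Z :: "(complex ^ 'n::finite option) set set"
  assumes n: "CARD('n) \<ge> 2"
  shows "minimal_apolar_set quartic Z \<longleftrightarrow>
    (\<exists>A V. config A V \<and> Z = (\<lambda>v. vec.span {v}) ` line_points A V)"
proof
  assume "minimal_apolar_set quartic Z"
  then have Z: "apolar_set quartic Z" "card Z = 3 * CARD('n)"
    by (simp_all add: minimal_apolar_set_def waring_rank_quartic[OF n])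
  obtain S where S: "Z = (\<lambda>v. vec.span {v}) ` S" "finite S" "card S = card Z" "apolar_vectors S"
    using apolar_set_vectors[OF Z(1)] by blast
  then show "\<exists>A V. config A V \<and> Z = (\<lambda>v. vec.span {v}) ` line_points A V"
    using minimal_apolar_vectors_config[OF S(4,2)] Z(2) by simp
next
  assume "\<exists>A V. config A V \<and> Z = (\<lambda>v. vec.span {v}) ` line_points A V"
  then obtain A V where AV: "config A V" and Z: "Z = (\<lambda>v. vec.span {v}) ` line_points A V" by blast
  note A = configD(1)[OF AV]
  have fin: "finite (SIGMA j:UNIV. V j)" using configD(5)[OF AV] by auto
  have "apolar_vectors ((\<lambda>(j, a). pt a (A j)) ` (SIGMA j:UNIV. V j))"
    using apolar_vectors_of_decomposition[of "\<lambda>(j, a). divided_weight (V j) a / 6" "\<lambda>(j, a). pt a (A j)"]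
      config_decomposition[OF AV] by (simp add: case_prod_beta)
  then have "apolar_set quartic Z"
    unfolding Z line_points_def using fin pt_orthonormal_nonzero[OF A]
    by (intro apolar_set_of_vectors) auto
  moreover have "card Z = 3 * CARD('n)"
  proof -
    have "inj_on (\<lambda>(j, a). vec.span {pt a (A j)}) (SIGMA j:UNIV. V j)"
      by (auto simp: inj_on_def span_pt_eq_iff[OF A])
    moreover have "Z = (\<lambda>(j, a). vec.span {pt a (A j)}) ` (SIGMA j:UNIV. V j)"
      unfolding Z line_points_def image_image by (intro image_cong) auto
    ultimately show ?thesis using card_config[OF AV] by (simp add: card_image)
  qed
  ultimately show "minimal_apolar_set quartic Z"
    by (simp add: minimal_apolar_set_def waring_rank_quartic[OF n])
qed

section \<open>Projection, lines, and the group action\<close>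

lemma span_singleton_pt: "vec.span {pt a b} = range (\<lambda>c. pt (c * a) (c *s b))"
  by (simp add: vec.span_singleton pt_scale)

lemma pt_eqI: "v $ None = a \<Longrightarrow> (\<And>j. v $ Some j = b $ j) \<Longrightarrow> v = pt a b"
  unfolding vec_eq_iff by (metis option.exhaust pt_nth)

lemma proj_from_apex_span: "proj_from_apex (vec.span {pt a b}) = vec.span {pt 0 b}"
proof -
  have "(\<chi> k. case k of None \<Rightarrow> 0 | Some j \<Rightarrow> pt a b $ Some j) = pt 0 b" for a and b :: "complex ^ 'a"
    by (rule pt_eqI) simp_all
  then show ?thesis
    by (simp only: proj_from_apex_def span_singleton_pt image_image mult_zero_right)
qed

lemma act_point_span: "act_point \<sigma> (vec.span {pt a b}) = vec.span {pt a (\<sigma> *v b)}"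
proof -
  have "(\<chi> k. case k of None \<Rightarrow> pt a b $ None | Some j \<Rightarrow> (\<sigma> *v (\<chi> i. pt a b $ Some i)) $ j)
      = pt a (\<sigma> *v b)" for a and b :: "complex ^ 'a"
  proof (rule pt_eqI)
    have "(\<chi> i. pt a b $ Some i) = b" by (simp add: vec_eq_iff)
    then show "(\<chi> k. case k of None \<Rightarrow> pt a b $ None | Some j \<Rightarrow> (\<sigma> *v (\<chi> i. pt a b $ Some i)) $ j)
      $ Some j = (\<sigma> *v b) $ j" for j by simp
  qed simp
  moreover have "\<sigma> *v (c *s b) = c *s (\<sigma> *v b)" for c and b :: "complex ^ 'a"
    by (simp add: vector_scalar_commute)
  ultimately show ?thesis
    by (simp only: act_point_def span_singleton_pt image_image)
qed

lemma image_line_points: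
  "f ` (\<lambda>v. vec.span {v}) ` line_points A V = (\<lambda>(j, a). f (vec.span {pt a (A j)})) ` (SIGMA j:UNIV. V j)"
  unfolding line_points_def image_image by (intro image_cong) auto

lemma proj_config:
  assumes AV: "config A V"
  shows "proj_from_apex ` (\<lambda>v. vec.span {v}) ` line_points A V = (\<lambda>v. vec.span {v}) ` range (\<lambda>j. pt 0 (A j))"
proof -
  have "\<exists>a. a \<in> V j" for j using configD(2)[OF AV, of j] by (metis card.empty ex_in_conv zero_neq_numeral)
  then have "fst ` (SIGMA j:UNIV. V j) = UNIV" by force
  then have "(\<lambda>v. vec.span {v}) ` range (\<lambda>j. pt 0 (A j)) =
      (\<lambda>j. vec.span {pt 0 (A j)}) ` fst ` (SIGMA j:UNIV. V j)"
    by (simp only: image_image)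
  also have "\<dots> = (\<lambda>(j, a). vec.span {pt 0 (A j)}) ` (SIGMA j:UNIV. V j)"
    unfolding image_image by (intro image_cong) auto
  finally show ?thesis
    unfolding image_line_points proj_from_apex_span ..
qed

lemma act_config:
  assumes AV: "config A V"
  shows "act_point (\<chi> i j. A i $ j) ` (\<lambda>v. vec.span {v}) ` line_points A V =
    (\<lambda>v. vec.span {v}) ` line_points (\<lambda>j. axis j 1) V"
proof -
  have eq: "(\<chi> i j. A i $ j) *v A j = axis j 1" for j
    using orthonormalD[OF configD(1)[OF AV], of _ j]
    by (simp add: matrix_vector_mult_def vec_eq_iff bil_def axis_def)
  then show ?thesis
    unfolding image_line_points act_point_span eq
    unfolding line_points_def image_image
    by (intro image_cong) auto
qed

lemma bil_span_zero:
  assumes "v \<in> vec.span B" "\<And>b. b \<in> B \<Longrightarrow> u \<bullet>\<^sub>b b = 0"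
  shows "u \<bullet>\<^sub>b v = 0"
proof -
  have "vec.subspace {v. u \<bullet>\<^sub>b v = 0}" by (rule vec.subspaceI) auto
  then have "vec.span B \<subseteq> {v. u \<bullet>\<^sub>b v = 0}" by (rule vec.span_minimal[rotated]) (use assms in auto)
  with assms(1) show ?thesis by auto
qed

text \<open>The pairing with \<open>A\<^sub>j\<close> is zero on the span of the other points, but not on the \<open>j\<close>-th one.\<close>

lemma general_position_orthonormal:
  fixes A :: "'n::finite \<Rightarrow> complex ^ 'n"
  assumes A: "orthonormal A"
  shows "linear_general_position ((\<lambda>v. vec.span {v}) ` range (\<lambda>j. pt 0 (A j)))"
  unfolding linear_general_position_def
proof (intro allI impI)
  fix Z assume "Z \<subseteq> (\<lambda>v. vec.span {v}) ` range (\<lambda>j. pt 0 (A j))"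
  then have "Z \<subseteq> (\<lambda>j. vec.span {pt 0 (A j)}) ` UNIV" by auto
  then obtain J where Z: "Z = (\<lambda>j. vec.span {pt 0 (A j)}) ` J" by (meson subset_imageE)
  let ?B = "(\<lambda>j. pt 0 (A j)) ` J"
  have "inj_on (\<lambda>j. vec.span {pt 0 (A j)}) J" by (auto simp: inj_on_def span_pt_eq_iff[OF A])
  then have cardZ: "card Z = card J" unfolding Z by (rule card_image)
  have injA: "inj_on (\<lambda>j. pt 0 (A j)) J"
  proof (rule inj_onI)
    fix i j assume "pt 0 (A i) = pt 0 (A j)"
    then have "vec.span {pt 0 (A i)} = vec.span {pt 0 (A j)}" by simp
    then show "i = j" by (simp add: span_pt_eq_iff[OF A])
  qed
  then have cardB: "card ?B = card J" by (rule card_image)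
  have "vec.independent ?B"
    unfolding vec.dependent_def
  proof
    assume "\<exists>a\<in>?B. a \<in> vec.span (?B - {a})"
    then obtain j where j: "pt 0 (A j) \<in> vec.span (?B - {pt 0 (A j)})" by auto
    have "pt 0 (A j) \<bullet>\<^sub>b pt 0 (A j) = 0"
      by (rule bil_span_zero[OF j]) (auto simp: orthonormalD[OF A])
    then show False by (simp add: orthonormalD[OF A])
  qed
  moreover have "lin_span Z = vec.span ?B"
    unfolding lin_span_def
  proof (rule subset_antisym; rule vec.span_minimal[OF _ vec.subspace_span])
    show "\<Union>Z \<subseteq> vec.span ?B"
    proof
      fix x assume "x \<in> \<Union>Z"
      then obtain j where "j \<in> J" "x \<in> vec.span {pt 0 (A j)}" unfolding Z by auto
      then show "x \<in> vec.span ?B" using vec.span_mono[of "{pt 0 (A j)}" ?B] by auto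
    qed
    show "?B \<subseteq> vec.span (\<Union>Z)"
    proof
      fix x assume "x \<in> ?B"
      then obtain j where "j \<in> J" "x = pt 0 (A j)" by auto
      then have "x \<in> \<Union>Z" unfolding Z by (auto intro: vec.span_base)
      then show "x \<in> vec.span (\<Union>Z)" by (rule vec.span_base)
    qed
  qed
  ultimately have "vec.dim (lin_span Z) = card J"
    using cardB vec.dim_eq_card_independent[of ?B] by simp
  moreover have "card J \<le> CARD('n option)"
    using card_mono[of "UNIV :: 'n set" J] by (simp add: card_option)
  ultimately show "vec.dim (lin_span Z) = min (card Z) CARD('n option)" using cardZ by simp
qed

lemma HF_0:
  assumes "S \<noteq> {}"
  shows "HF ((\<lambda>v. vec.span {v}) ` S) 0 = 1"
proof -
  have "HF ((\<lambda>v. vec.span {v}) ` S) 0 = card {()}"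
  proof (rule HF_eqI[where b = "\<lambda>_. 1"])
    fix p :: "'a mpoly" assume "p \<in> forms 0"
    then have "eval_at v p = eval_at 0 p" for v using eval_at_scale[of p 0 0 v] by simp
    then show "\<exists>c. \<forall>v\<in>S. eval_at v p = (\<Sum>k\<in>{()}. c k * eval_at v 1)"
      by (intro exI[of _ "\<lambda>_. eval_at 0 p"]) simp
  qed (use assms in auto)
  then show ?thesis by simp
qed

lemma HF_projection:
  fixes A :: "'n::finite \<Rightarrow> complex ^ 'n"
  assumes A: "orthonormal A" and i: "i \<ge> 1"
  shows "HF ((\<lambda>v. vec.span {v}) ` range (\<lambda>j. pt 0 (A j))) i = CARD('n)"
proof (rule HF_eqI[where b = "\<lambda>j. lin (A j) ^ i"])
  have coeff: "(\<Sum>j\<in>UNIV. c j * eval_at (pt 0 (A l)) (lin (A j) ^ i)) = c l" for c l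
  proof -
    have "(\<Sum>j\<in>UNIV. c j * eval_at (pt 0 (A l)) (lin (A j) ^ i)) = (\<Sum>j\<in>UNIV. if j = l then c l else 0)"
      using i by (intro sum.cong) (auto simp: orthonormalD[OF A])
    then show ?thesis by simp
  qed
  show "\<forall>k\<in>UNIV. c k = 0"
    if "\<forall>v\<in>range (\<lambda>j. pt 0 (A j)). (\<Sum>k\<in>UNIV. c k * eval_at v (lin (A k) ^ i)) = 0" for c
    using that unfolding ball_simps coeff by simp
  show "\<exists>c. \<forall>v\<in>range (\<lambda>j. pt 0 (A j)). eval_at v p = (\<Sum>k\<in>UNIV. c k * eval_at v (lin (A k) ^ i))" for p
    by (intro exI[of _ "\<lambda>l. eval_at (pt 0 (A l)) p"]) (unfold ball_simps coeff, simp)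
qed auto

lemma pt_in_line_iff:
  assumes A: "orthonormal A"
  shows "vec.span {pt a (A l)} \<subseteq> lin_span {vec.span {pt 0 (A j)}, apex} \<longleftrightarrow> l = j"
proof -
  let ?L = "lin_span {vec.span {pt 0 (A j)}, apex}"
  have apex: "apex = vec.span {pt 1 0 :: complex ^ 'a option}"
  proof -
    have "axis None 1 = (pt 1 0 :: complex ^ 'a option)"
      unfolding vec_eq_iff
    proof
      fix k :: "'a option" show "axis None 1 $ k = (pt 1 0 :: complex ^ 'a option) $ k"
        by (cases k) (simp_all add: axis_def)
    qed
    then show ?thesis by (simp add: apex_def)
  qed
  have base: "pt 0 (A j) \<in> ?L" "pt 1 0 \<in> ?L"
    unfolding lin_span_def apex by (auto intro!: vec.span_base)
  have sub: "vec.subspace ?L" by (simp add: lin_span_def)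
  show ?thesis
  proof
    assume "l = j"
    have "pt 0 (A j) + a *s pt 1 0 \<in> ?L" using base sub by (intro vec.subspace_add vec.subspace_scale)
    moreover have "pt 0 (A j) + a *s pt 1 0 = pt a (A j)"
      unfolding vec_eq_iff
    proof
      fix k show "(pt 0 (A j) + a *s pt 1 0) $ k = pt a (A j) $ k" by (cases k) simp_all
    qed
    ultimately show "vec.span {pt a (A l)} \<subseteq> ?L"
      using \<open>l = j\<close> sub by (intro vec.span_minimal) auto
  next
    assume "vec.span {pt a (A l)} \<subseteq> ?L"
    then have l: "pt a (A l) \<in> vec.span (\<Union>{vec.span {pt 0 (A j)}, vec.span {pt 1 0}})"
      unfolding lin_span_def apex by (auto intro: vec.span_base)
    show "l = j"
    proof (rule ccontr)
      assume "l \<noteq> j"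
      have "pt 0 (A l) \<bullet>\<^sub>b pt a (A l) = 0"
        by (rule bil_span_zero[OF l])
          (use \<open>l \<noteq> j\<close> in \<open>auto simp: span_singleton_pt orthonormalD[OF A]\<close>)
      then show False by (simp add: orthonormalD[OF A])
    qed
  qed
qed

lemma card_points_on_line:
  assumes AV: "config A V"
  shows "card {p \<in> (\<lambda>v. vec.span {v}) ` line_points A V. p \<subseteq> lin_span {vec.span {pt 0 (A j)}, apex}} = 3"
proof -
  note A = configD(1)[OF AV]
  have "{p \<in> (\<lambda>v. vec.span {v}) ` line_points A V. p \<subseteq> lin_span {vec.span {pt 0 (A j)}, apex}} =
      (\<lambda>a. vec.span {pt a (A j)}) ` V j" (is "?P = ?Q")
  proof (intro equalityI subsetI)
    fix p assume p: "p \<in> ?P"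
    then obtain l a where "p = vec.span {pt a (A l)}" "a \<in> V l" by (auto simp: line_points_iff)
    with p show "p \<in> ?Q" by (simp add: pt_in_line_iff[OF A])
  next
    fix p assume "p \<in> ?Q"
    then obtain a where p: "p = vec.span {pt a (A j)}" and "a \<in> V j" by blast
    then have "pt a (A j) \<in> line_points A V" by (auto simp: line_points_iff)
    then show "p \<in> ?P" unfolding p by (simp add: pt_in_line_iff[OF A])
  qed
  moreover have "inj_on (\<lambda>a. vec.span {pt a (A j)}) (V j)"
    by (auto simp: inj_on_def span_pt_eq_iff[OF A])
  ultimately show ?thesis using configD(2)[OF AV] by (simp add: card_image)
qed

lemma ideal_gen_exchange:
  assumes "g - h \<in> ideal_gen M"
  shows "ideal_gen (M \<union> {g}) = ideal_gen (M \<union> {h})"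
proof -
  have sub: "ideal_gen (M \<union> {g}) \<subseteq> ideal_gen (M \<union> {h})" if gh: "g - h \<in> ideal_gen M" for g h
  proof (rule ideal_gen_subset)
    have "ideal_gen M \<subseteq> ideal_gen (M \<union> {h})" by (rule ideal_gen_subset) (auto intro: ideal_gen_base)
    then have "(g - h) + h \<in> ideal_gen (M \<union> {h})"
      using gh by (intro ideal_gen_add) (auto intro: ideal_gen_base)
    then show "M \<union> {g} \<subseteq> ideal_gen (M \<union> {h})" by (auto intro: ideal_gen_base)
  qed
  have "h - g \<in> ideal_gen M" using ideal_gen_diff[OF ideal_gen_zero assms] by simp
  with assms show ?thesis by (intro subset_antisym sub)
qed

text \<open>
  In standard coordinates the cubic generator is congruent to one of the form
  \<open>X\<^sup>3 + \<Sum> L\<^sub>i (Y\<^sub>k\<^sup>2 - Y\<^sub>i\<^sup>2)\<close>: the terms of \<open>L\<^sub>i\<close> in \<open>X\<close> and \<open>Y\<^sub>i\<close> are dictated by the line through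
  \<open>Y\<^sub>i\<close>, the coefficients of \<open>X Y\<^sub>k\<^sup>2\<close> then agree because those of all the \<open>X Y\<^sub>j\<^sup>2\<close> have sum zero, and
  the coefficient of \<open>Y\<^sub>k\<^sup>3\<close> is distributed evenly over the \<open>L\<^sub>i\<close>.
\<close>

lemma config_ideal_standard:
  fixes V :: "'n::finite \<Rightarrow> complex set"
  assumes n: "CARD('n) \<ge> 2" and AV: "config (\<lambda>j. axis j 1) V"
  shows "\<exists>L. (\<forall>i. i \<noteq> k \<longrightarrow> L i \<in> forms 1) \<and>
    ideal_gen (config_gens (\<lambda>j. axis j 1) V) =
      ideal_gen ({Var (Some i) * Var (Some j) | i j. i \<noteq> j} \<union>
        {X\<^sub>0 ^ 3 + (\<Sum>i\<in>UNIV - {k}. L i * (Var (Some k) ^ 2 - Var (Some i) ^ 2))})"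
proof -
  let ?Y = "\<lambda>j. Var (Some j) :: 'n option mpoly"
  let ?M = "{?Y i * ?Y j | i j. i \<noteq> j}"
  define p where "p j = (\<Sum>a\<in>V j. a\<^sup>2) / 2" for j
  define q where "q j = (\<Sum>a\<in>V j. a ^ 3) / 3" for j
  define r where "r = - q k / of_nat (CARD('n) - 1)"
  define L where "L i = Const (p i) * X\<^sub>0 + Const (q i) * ?Y i + Const r * ?Y k" for i
  define H where "H = X\<^sub>0 ^ 3 + (\<Sum>i\<in>UNIV - {k}. L i * (?Y k ^ 2 - ?Y i ^ 2))"
  let ?G = "cubic_gen (\<lambda>j. axis j 1) V"
  have G: "?G = X\<^sub>0 ^ 3 - (\<Sum>j\<in>UNIV. Const (p j) * (X\<^sub>0 * ?Y j ^ 2) + Const (q j) * ?Y j ^ 3)"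
    by (simp add: cubic_gen_def Var_Some_lin[symmetric] p_def q_def power2_eq_square power3_eq_cube
        mult.assoc)
  have "(\<Sum>j\<in>UNIV. p j) = 0" using configD(4)[OF AV] by (simp add: p_def sum_divide_distrib[symmetric])
  then have p: "(\<Sum>i\<in>UNIV - {k}. p i) = - p k" by (simp add: sum_diff1)
  have r: "of_nat (card (UNIV - {k})) * r = - q k" using n by (simp add: r_def)
  have summand: "L i * (?Y k ^ 2 - ?Y i ^ 2) = Const (p i) * (X\<^sub>0 * ?Y k ^ 2) + Const r * ?Y k ^ 3
      - (Const (p i) * (X\<^sub>0 * ?Y i ^ 2) + Const (q i) * ?Y i ^ 3)
      + (Const (q i) * ?Y k * (?Y i * ?Y k) - Const r * ?Y i * (?Y i * ?Y k))" for i
    unfolding L_def by (simp add: power2_eq_square power3_eq_cube algebra_simps)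
  have "H = X\<^sub>0 ^ 3 + (Const (\<Sum>i\<in>UNIV - {k}. p i) * (X\<^sub>0 * ?Y k ^ 2)
        + Const (of_nat (card (UNIV - {k})) * r) * ?Y k ^ 3
        - (\<Sum>i\<in>UNIV - {k}. Const (p i) * (X\<^sub>0 * ?Y i ^ 2) + Const (q i) * ?Y i ^ 3)
        + (\<Sum>i\<in>UNIV - {k}. Const (q i) * ?Y k * (?Y i * ?Y k) - Const r * ?Y i * (?Y i * ?Y k)))"
  proof -
    have const: "(\<Sum>i\<in>UNIV - {k}. Const r * ?Y k ^ 3) = Const (of_nat (card (UNIV - {k})) * r) * ?Y k ^ 3"
      by (simp only: sum_distrib_right[symmetric] Const_sum[symmetric] sum_constant)
    show ?thesis
      unfolding H_def summand sum.distrib sum_subtractf const Const_sum sum_distrib_right ..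
  qed
  also have "\<dots> = X\<^sub>0 ^ 3 - ((Const (p k) * (X\<^sub>0 * ?Y k ^ 2) + Const (q k) * ?Y k ^ 3)
        + (\<Sum>i\<in>UNIV - {k}. Const (p i) * (X\<^sub>0 * ?Y i ^ 2) + Const (q i) * ?Y i ^ 3))
        + (\<Sum>i\<in>UNIV - {k}. Const (q i) * ?Y k * (?Y i * ?Y k) - Const r * ?Y i * (?Y i * ?Y k))"
    unfolding p r Const_uminus by (simp add: algebra_simps)
  also have "(Const (p k) * (X\<^sub>0 * ?Y k ^ 2) + Const (q k) * ?Y k ^ 3)
        + (\<Sum>i\<in>UNIV - {k}. Const (p i) * (X\<^sub>0 * ?Y i ^ 2) + Const (q i) * ?Y i ^ 3) =
      (\<Sum>j\<in>UNIV. Const (p j) * (X\<^sub>0 * ?Y j ^ 2) + Const (q j) * ?Y j ^ 3)"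
    by (rule sum.remove[symmetric]) auto
  finally have "H - ?G = (\<Sum>i\<in>UNIV - {k}. Const (q i) * ?Y k * (?Y i * ?Y k) - Const r * ?Y i * (?Y i * ?Y k))"
    unfolding G by simp
  also have "\<dots> \<in> ideal_gen ?M"
    by (intro ideal_gen_sum ideal_gen_diff ideal_gen_mult ideal_gen_base) auto
  finally have "ideal_gen (?M \<union> {H}) = ideal_gen (?M \<union> {?G})" by (rule ideal_gen_exchange)
  moreover have "config_gens (\<lambda>j. axis j 1) V = ?M \<union> {?G}"
    by (simp add: config_gens_def Var_Some_lin[symmetric])
  moreover have "L i \<in> forms 1" for i
    unfolding L_def by (intro forms_add forms_Const_mult forms_Var)
  ultimately show ?thesis unfolding H_def by (intro exI[of _ L]) simp
qed

text \<open>
  The points of a configuration have \<open>b\<close>-parts proportional to some \<open>A\<^sub>j\<close>, hence not isotropic.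
  Conversely, a nonisotropic \<open>b\<close> can be normalised and extended to an orthonormal basis, and
  every point other than the apex on one of the resulting lines lies in some configuration.
\<close>

lemma forbidden_locus_quartic:
  assumes n: "CARD('n::finite) \<ge> 2"
  shows "forbidden_locus (quartic :: 'n option mpoly) = zero_locus {qf}"
proof -
  have "p \<in> waring_locus quartic \<longleftrightarrow> \<not> vanishes_at qf p" if p_point: "p \<in> proj_space"
    for p :: "(complex ^ 'n option) set"
  proof
    assume "p \<in> waring_locus quartic"
    then obtain A V where AV: "config A V" and p: "p \<in> (\<lambda>v. vec.span {v}) ` line_points A V"
      by (auto simp: waring_locus_def minimal_apolar_set_iff_config[OF n])
    then obtain a j where "p = vec.span {pt a (A j)}" by (auto simp: line_points_def)
    then show "\<not> vanishes_at qf p"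
      by (simp add: vanishes_at_span[OF forms_qf] eval_qf orthonormalD[OF configD(1)[OF AV]])
  next
    assume nv: "\<not> vanishes_at qf p"
    obtain v where p: "p = vec.span {v}" using p_point by (auto simp: proj_space_def)
    let ?b = "body v"
    define \<rho> where "\<rho> = csqrt (?b \<bullet>\<^sub>b ?b)"
    have "?b \<bullet>\<^sub>b ?b \<noteq> 0" using nv by (simp add: p vanishes_at_span[OF forms_qf] eval_qf)
    then have \<rho>: "\<rho> \<noteq> 0" "\<rho> * \<rho> = ?b \<bullet>\<^sub>b ?b"
      using power2_csqrt[of "?b \<bullet>\<^sub>b ?b"] by (auto simp: \<rho>_def power2_eq_square)
    define u where "u = (1 / \<rho>) *s ?b"
    have "u \<bullet>\<^sub>b u = 1" using \<rho>(1) by (simp add: u_def \<rho>(2)[symmetric])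
    fix k :: 'n
    obtain A where A: "orthonormal A" "A k = u" using orthonormal_extend[OF \<open>u \<bullet>\<^sub>b u = 1\<close>] by blast
    obtain V where V: "config A V" "v $ None / \<rho> \<in> V k" using config_through[OF n A(1)] by blast
    have "v = \<rho> *s pt (v $ None / \<rho>) (A k)"
      using \<rho>(1) pt_body[of v] by (simp add: A(2) u_def pt_scale)
    then have "p = vec.span {pt (v $ None / \<rho>) (A k)}"
      unfolding p by (metis \<rho>(1) span_eq_span_singleton_scale)
    moreover have "pt (v $ None / \<rho>) (A k) \<in> line_points A V" using V(2) by (auto simp: line_points_iff)
    ultimately have "p \<in> (\<lambda>v. vec.span {v}) ` line_points A V" by blast
    then show "p \<in> waring_locus quartic"
      using V(1) by (auto simp: waring_locus_def minimal_apolar_set_iff_config[OF n])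
  qed
  then show ?thesis by (auto simp: forbidden_locus_def zero_locus_def)
qed

theorem theoremA:
  fixes F :: "'n::finite option mpoly"
  assumes n_ge_2: "CARD('n) \<ge> 2"
    and F: "F = Var None ^ 2 * (\<Sum>j\<in>UNIV. Var (Some j) ^ 2)"
  shows "waring_rank F = 3 * CARD('n) \<and>
    forbidden_locus F = zero_locus {\<Sum>j\<in>UNIV. Var (Some j) ^ 2} \<and>
    (\<forall>X Y. minimal_apolar_set F X \<and> Y = proj_from_apex ` X \<longrightarrow>
      (Y \<subseteq> proj_space \<and> card Y = CARD('n) \<and> linear_general_position Y \<and>
        HF Y 0 = 1 \<and> (\<forall>i\<ge>1. HF Y i = CARD('n))) \<and>
      (\<forall>Q\<in>Y. card {p \<in> X. p \<subseteq> lin_span {Q, apex}} = 3) \<and>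
      (HF X 0 = 1 \<and> HF X 1 = CARD('n) + 1 \<and> HF X 2 = 2 * CARD('n) + 1 \<and>
        (\<forall>i\<ge>3. HF X i = 3 * CARD('n))) \<and>
      (\<forall>k. \<exists>(\<sigma> :: complex ^ 'n ^ 'n) L. orthogonal_matrix \<sigma> \<and>
        (\<forall>i. i \<noteq> k \<longrightarrow> L i \<in> forms 1) \<and>
        point_ideal (act_point \<sigma> ` X) =
          ideal_gen ({Var (Some i) * Var (Some j) | i j. i \<noteq> j} \<union>
            {Var None ^ 3 + (\<Sum>i\<in>UNIV - {k}. L i * (Var (Some k) ^ 2 - Var (Some i) ^ 2))})))"
proof -
  have quartic: "F = quartic" by (simp add: F quartic_def qf_def)
  have minimal: "(Y \<subseteq> proj_space \<and> card Y = CARD('n) \<and> linear_general_position Y \<and>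
        HF Y 0 = 1 \<and> (\<forall>i\<ge>1. HF Y i = CARD('n))) \<and>
      (\<forall>Q\<in>Y. card {p \<in> Z. p \<subseteq> lin_span {Q, apex}} = 3) \<and>
      (HF Z 0 = 1 \<and> HF Z 1 = CARD('n) + 1 \<and> HF Z 2 = 2 * CARD('n) + 1 \<and>
        (\<forall>i\<ge>3. HF Z i = 3 * CARD('n))) \<and>
      (\<forall>k. \<exists>(\<sigma> :: complex ^ 'n ^ 'n) L. orthogonal_matrix \<sigma> \<and>
        (\<forall>i. i \<noteq> k \<longrightarrow> L i \<in> forms 1) \<and>
        point_ideal (act_point \<sigma> ` Z) =
          ideal_gen ({Var (Some i) * Var (Some j) | i j. i \<noteq> j} \<union>
            {Var None ^ 3 + (\<Sum>i\<in>UNIV - {k}. L i * (Var (Some k) ^ 2 - Var (Some i) ^ 2))}))"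
    if min: "minimal_apolar_set F Z" and Y: "Y = proj_from_apex ` Z" for Z Y
  proof -
    obtain A V where AV: "config A V" and Z: "Z = (\<lambda>v. vec.span {v}) ` line_points A V"
      using min unfolding quartic minimal_apolar_set_iff_config[OF n_ge_2] by blast
    note A = configD(1)[OF AV]
    have Y: "Y = (\<lambda>v. vec.span {v}) ` range (\<lambda>j. pt 0 (A j))"
      unfolding Y Z by (rule proj_config[OF AV])
    have "Y \<subseteq> proj_space" using pt_orthonormal_nonzero[OF A] unfolding Y proj_space_def by blast
    moreover have "card Y = CARD('n)"
      unfolding Y image_image by (intro card_image) (auto simp: inj_on_def span_pt_eq_iff[OF A])
    moreover have "linear_general_position Y" unfolding Y by (rule general_position_orthonormal[OF A])
    moreover have "HF Y 0 = 1" unfolding Y by (rule HF_0) simp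
    moreover have "\<forall>i\<ge>1. HF Y i = CARD('n)" unfolding Y using HF_projection[OF A] by blast
    moreover have "\<forall>Q\<in>Y. card {p \<in> Z. p \<subseteq> lin_span {Q, apex}} = 3"
      unfolding Y Z using card_points_on_line[OF AV] by blast
    moreover have "HF Z 0 = 1" "HF Z 1 = CARD('n) + 1" "HF Z 2 = 2 * CARD('n) + 1"
      "\<forall>i\<ge>3. HF Z i = 3 * CARD('n)"
      unfolding Z HF_config[OF AV] by (simp_all add: min_def)
    moreover have "\<exists>(\<sigma> :: complex ^ 'n ^ 'n) L. orthogonal_matrix \<sigma> \<and>
        (\<forall>i. i \<noteq> k \<longrightarrow> L i \<in> forms 1) \<and>
        point_ideal (act_point \<sigma> ` Z) =
          ideal_gen ({Var (Some i) * Var (Some j) | i j. i \<noteq> j} \<union>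
            {Var None ^ 3 + (\<Sum>i\<in>UNIV - {k}. L i * (Var (Some k) ^ 2 - Var (Some i) ^ 2))})" for k
    proof -
      have AV': "config (\<lambda>j. axis j 1) V"
        using AV orthonormal_axis by (simp add: config_def)
      have ideal: "point_ideal (act_point (\<chi> i j. A i $ j) ` Z) = ideal_gen (config_gens (\<lambda>j. axis j 1) V)"
        unfolding Z act_config[OF AV] by (rule point_ideal_config[OF AV'])
      obtain L where L: "\<forall>i. i \<noteq> k \<longrightarrow> L i \<in> forms 1" "ideal_gen (config_gens (\<lambda>j. axis j 1) V) =
          ideal_gen ({Var (Some i) * Var (Some j) | i j. i \<noteq> j} \<union>
            {Var None ^ 3 + (\<Sum>i\<in>UNIV - {k}. L i * (Var (Some k) ^ 2 - Var (Some i) ^ 2))})"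
        using config_ideal_standard[OF n_ge_2 AV', of k] by blast
      show ?thesis
        by (rule exI[of _ "\<chi> i j. A i $ j"], rule exI[of _ L])
          (intro conjI orthonormal_matrix[OF A] L(1) trans[OF ideal L(2)])
    qed
    ultimately show ?thesis by (intro conjI allI) simp_all
  qed
  have rank: "waring_rank F = 3 * CARD('n)"
    unfolding quartic by (rule waring_rank_quartic[OF n_ge_2])
  have forbidden: "forbidden_locus F = zero_locus {\<Sum>j\<in>UNIV. Var (Some j) ^ 2}"
    unfolding quartic forbidden_locus_quartic[OF n_ge_2] qf_def ..
  show ?thesis
    by (rule conjI[OF rank conjI[OF forbidden]], intro allI impI, elim conjE, rule minimal)
qed

end
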